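(* For each $n$ let $\{x_{i,n};\,i\ge0\}$ be i.i.d. real random variables with all moments finite, such that for every $k\ge1$, $n\,\mathbb E[x_{0,n}^k]\to C_k$ as $n\to\infty$, and suppose that the moments of the random variable whose cumulants are $\{0,C_2,0,C_4,0,C_6,\dots\}$ satisfy Carleman's condition. Let $A_n$ be one of the $n\times n$ Hankel, symmetric Toeplitz or symmetric circulant matrices, with link function $L$, and let $A_n^u$ be its triangular version, whose $(i,j)$-th entry ($1\le i,j\le n$) is $$\begin{cases}x_{L(i,j),n}&\text{if } i+j\le n+1,\\0&\text{otherwise.}\end{cases}$$ Then, for each of the three patterns, the EESD of $A_n^u$ converges weakly, as $n\to\infty$, to a symmetric probability measure $\mu_A$ that depends on $\{C_{2k}\}_{k\ge1}$.
   Context: **Link functions** ($1\le i,j\le n$): Hankel $L(i,j)=i+j$; symmetric Toeplitz $L(i,j)=|i-j|$; symmetric circulant $L(i,j)=\frac n2-\big|\frac n2-|i-j|\big|$. **EESD.** For an $n\times n$ real symmetric random matrix $A$ with eigenvalues $\lambda_1,\dots,\lambda_n$, the expected empirical spectral distribution (EESD) is the probability distribution with measure $\mathbb E\mu_A$, where $\mu_A=\frac1n\sum_{i=1}^n\delta_{\lambda_i}$. **Carleman's condition** for the even moments $m_{2k}$ is $\sum_{k\ge1}m_{2k}^{-1/(2k)}=\infty$. Here the moments with cumulants $\{0,C_2,0,C_4,\dots\}$ are $m_{2k}=\sum_\sigma\prod_{V\in\sigma}C_{|V|}$, the sum being over all partitions $\sigma$ of $\{1,\dots,2k\}$ with all blocks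 $V$ of even size (odd moments are $0$). *)

theory Defs
  imports "HOL-Probability.Probability" "Jordan_Normal_Form.Char_Poly"
begin

datatype matrix_pattern = Hankel | Toeplitz | Sym_Circulant

text \<open>
  Row and column indices of a link function run over \<open>1, \<dots>, n\<close>. In the circulant case the
  real expression under the floor is already a natural number, see \<open>link_Sym_Circulant\<close>.
\<close>

fun link :: "matrix_pattern \<Rightarrow> nat \<Rightarrow> nat \<Rightarrow> nat \<Rightarrow> nat" where
  "link Hankel n i j = i + j"
| "link Toeplitz n i j = nat \<bar>int i - int j\<bar>"
| "link Sym_Circulant n i j =
     nat \<lfloor>real n / 2 - \<bar>real n / 2 - \<bar>real i - real j\<bar>\<bar>\<rfloor>"

lemma link_Sym_Circulant:
  assumes "i \<in> {1..n}" "j \<in> {1..n}"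
  shows "real (link Sym_Circulant n i j) = real n / 2 - \<bar>real n / 2 - \<bar>real i - real j\<bar>\<bar>"
proof -
  define d where "d = \<bar>int i - int j\<bar>"
  have d: "real_of_int d = \<bar>real i - real j\<bar>" "0 \<le> d" "d \<le> int n"
    using assms by (auto simp: d_def)
  have eq: "real n / 2 - \<bar>real n / 2 - \<bar>real i - real j\<bar>\<bar> = real_of_int (min d (int n - d))"
    unfolding d(1)[symmetric] by (auto simp: min_def abs_if field_simps)
  have "real (nat (min d (int n - d))) = real_of_int (min d (int n - d))"
    using d by (intro of_nat_nat) auto
  then show ?thesis
    unfolding link.simps eq floor_of_int .
qed

text \<open>\<open>Matrix.mat\<close> indexes from \<open>0\<close>, hence the shift by \<open>Suc\<close>.\<close>

definition triangular_patterned :: "matrix_pattern \<Rightarrow> nat \<Rightarrow> (nat \<Rightarrow> real) \<Rightarrow> real mat" where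
  "triangular_patterned L n x = Matrix.mat n n (\<lambda>(i, j).
     if Suc i + Suc j \<le> n + 1 then x (link L n (Suc i) (Suc j)) else 0)"

text \<open>
  The multiset of eigenvalues is that of the real roots of the characteristic polynomial, with
  multiplicity; for a real symmetric \<open>n \<times> n\<close> matrix there are exactly \<open>n\<close> of them.
\<close>

definition esd :: "real mat \<Rightarrow> real measure" where
  "esd A = measure_of UNIV (sets borel)
     (\<lambda>B. (\<Sum>t\<in>#proots (char_poly A). indicator B t) / of_nat (dim_row A))"

definition eesd :: "'a measure \<Rightarrow> ('a \<Rightarrow> real mat) \<Rightarrow> real measure" where
  "eesd M A = measure_of UNIV (sets borel) (\<lambda>B. \<integral>\<^sup>+ \<omega>. emeasure (esd (A \<omega>)) B \<partial>M)"

lemma sets_esd [simp]: "sets (esd A) = sets borel"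
  by (simp add: esd_def sets.sigma_sets_eq[of borel, simplified])

lemma sets_eesd [simp]: "sets (eesd M A) = sets borel"
  by (simp add: eesd_def sets.sigma_sets_eq[of borel, simplified])

lemma emeasure_esd:
  assumes "B \<in> sets borel"
  shows "emeasure (esd A) B = (\<Sum>t\<in>#proots (char_poly A). indicator B t) / of_nat (dim_row A)"
proof -
  have *: "(\<Sum>n. \<Sum>t\<in>#S. indicator (F n) t :: ennreal) = (\<Sum>t\<in>#S. indicator (\<Union>(range F)) t)"
    if "disjoint_family F" for F :: "nat \<Rightarrow> real set" and S
    by (induction S)
       (simp_all add: suminf_add[symmetric] suminf_indicator[OF that])
  have "countably_additive (sets borel)
      (\<lambda>B. (\<Sum>t\<in>#proots (char_poly A). indicator B t) / of_nat (dim_row A) :: ennreal)"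
    by (auto simp: countably_additive_def divide_ennreal_def *)
  then show ?thesis
    using assms
    by (intro emeasure_measure_of[OF esd_def])
       (auto simp: positive_def sets.sigma_sets_eq[of borel, simplified])
qed

text \<open>
  A triangular array: for each \<open>n\<close> the variables \<open>x n i\<close>, \<open>i \<ge> 0\<close>, live on a probability space
  of their own; nothing is assumed about the joint law for different \<open>n\<close>.
\<close>

definition iid_array_with_limits ::
    "(nat \<Rightarrow> 'a measure) \<Rightarrow> (nat \<Rightarrow> nat \<Rightarrow> 'a \<Rightarrow> real) \<Rightarrow> (nat \<Rightarrow> real) \<Rightarrow> bool" where
  "iid_array_with_limits M x C \<longleftrightarrow>
     (\<forall>n. prob_space (M n) \<and>
          prob_space.indep_vars (M n) (\<lambda>_. borel) (x n) UNIV \<and>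
          (\<forall>i. distr (M n) borel (x n i) = distr (M n) borel (x n 0)) \<and>
          (\<forall>i k. integrable (M n) (\<lambda>\<omega>. x n i \<omega> ^ k))) \<and>
     (\<forall>k\<ge>1. (\<lambda>n. real n * prob_space.expectation (M n) (\<lambda>\<omega>. x n 0 \<omega> ^ k)) \<longlonglongrightarrow> C k)"

text \<open>
  Moment of order \<open>m\<close> belonging to the cumulants \<open>0, C 2, 0, C 4, \<dots>\<close>; for odd \<open>m\<close> the index set
  is empty.
\<close>

definition even_cumulant_moment :: "(nat \<Rightarrow> real) \<Rightarrow> nat \<Rightarrow> real" where
  "even_cumulant_moment C m =
     (\<Sum>P | partition_on {1..m} P \<and> (\<forall>V\<in>P. even (card V)). \<Prod>V\<in>P. C (card V))"

text \<open>
  The series is taken in \<open>ennreal\<close>, where \<open>inverse 0 = \<infinity>\<close>: a vanishing even moment (which forces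
  the point mass at \<open>0\<close>) satisfies the condition, as it should.
\<close>

definition carleman_even :: "(nat \<Rightarrow> real) \<Rightarrow> bool" where
  "carleman_even m \<longleftrightarrow>
     (\<Sum>k. inverse (ennreal (root (2 * Suc k) (m (2 * Suc k))))) = \<infinity>"

definition symmetric_measure :: "real measure \<Rightarrow> bool" where
  "symmetric_measure \<mu> \<longleftrightarrow> distr \<mu> borel uminus = \<mu>"

end

theory Submission
  imports Defs "Jordan_Normal_Form.Schur_Decomposition"
begin

text \<open>
  The proof is by the method of moments. The moment of order \<open>k\<close> of the expected spectral
  distribution is \<open>E tr A\<^sup>k / n\<close>, a sum over closed walks in \<open>{1..n}\<close> that respect the triangular
  constraint. Grouping the walks by the partition \<open>\<sigma>\<close> of their \<open>k\<close> steps into classes of equal link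
  value, independence turns it into
  \<open>\<Sum>\<sigma>. (number of walks of type \<sigma>) / n ^ (1 + card \<sigma>) * (\<Prod>V\<in>\<sigma>. n * E (x ^ card V))\<close>
  (\<open>expectation_trace_power\<close>). The factors on the right tend to \<open>C (card V)\<close>, so everything rests on the
  normalised counts (\<open>path_density\<close>).

  For all three patterns the next vertex of a walk is, up to two binary choices, an affine function
  of the current vertex, the link value and \<open>n\<close>. A walk of type \<open>\<sigma>\<close> is therefore encoded by a word of
  choices, its starting vertex and one integer for each block of \<open>\<sigma>\<close>, and the admissible integer
  vectors are cut out by a Boolean combination of inequalities between affine forms. After rescaling to
  the unit cube, each such inequality is, for almost every point of the cube, eventually true or
  eventually false; dominated convergence then gives the limit of the counts without computing any
  volume (\<open>grid_count_converges\<close>, \<open>path_density_converges\<close>). If \<open>\<sigma>\<close> has a block of odd size, the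
  condition that the walk closes up is a nontrivial linear equation, because the coefficient of
  the variable of that block is odd, and the limit is \<open>0\<close>. Hence the odd moments vanish in the limit
  and the even ones depend only on the numbers \<open>C (2 * j)\<close>.

  The encoding also bounds the counts, so the limiting moment of order \<open>2 * k\<close> is at most
  \<open>3 * 12\<^sup>2\<^sup>k\<close> times the moment with cumulants \<open>0, C 2, 0, C 4, \<dots>\<close> (\<open>limit_moment_le\<close>). Such a factor
  does not affect Carleman's condition, so a distribution with the limiting moments is unique
  (\<open>carleman_determinate\<close>). The determinacy theorem is proved through quasi-analyticity: the
  difference of two characteristic functions with equal moments vanishes at \<open>0\<close> together with all its
  derivatives, and Bang's argument propagates this along the whole line. Existence comes from
  tightness, convergence from uniqueness of subsequential limits (\<open>method_of_moments\<close>), and symmetry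
  from uniqueness applied to the reflected measure.
\<close>

section \<open>Carleman's determinacy theorem\<close>

text \<open>
  Bang's step. At \<open>x\<close> every \<open>f n\<close> is bounded by \<open>exp (n - (K + 1))\<close> times the
  trivial bound \<open>M n\<close>; moving by at most
  \<open>M K / (e * M (K + 1))\<close> costs only one factor \<open>e\<close>. Expanding \<open>f n\<close> by Taylor's formula up to the
  derivative of order \<open>K + 1\<close>, where the trivial bound is as good as the hypothesis, log-convexity
  dominates the sum by an exponential series.
\<close>

lemma bang_step:
  fixes f :: "nat \<Rightarrow> real \<Rightarrow> complex" and M :: "nat \<Rightarrow> real"
  assumes pos: "\<And>n. M n > 0"
    and logconvex: "\<And>n. (M (Suc n))\<^sup>2 \<le> M n * M (Suc (Suc n))"
    and bound: "\<And>n x. norm (f n x) \<le> M n"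
    and taylor: "\<And>n m x h. norm (f n (x + h) - (\<Sum>i<m. f (n + i) x * of_real (h ^ i / fact i)))
                   \<le> M (n + m) * (\<bar>h\<bar> ^ m / fact m)"
    and prev: "\<And>n. norm (f n x) \<le> exp (real n - real (Suc K)) * M n"
    and h: "\<bar>h\<bar> \<le> M K / M (Suc K) / exp 1"
  shows "norm (f n (x + h)) \<le> exp (real n - real K) * M n"
proof (cases "n \<le> K")
  case False
  \<comment> \<open>here the claim is weaker than the trivial bound\<close>
  then have "1 \<le> exp (real n - real K)" by simp
  then have "1 * M n \<le> exp (real n - real K) * M n"
    using pos[of n] by (intro mult_right_mono) auto
  then show ?thesis using bound[of n "x + h"] by simp
next
  case True
  define r where "r n = M (Suc n) / M n" for n
  have r_pos: "r n > 0" for n using pos by (simp add: r_def)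
  have "r n \<le> r (Suc n)" for n
    using logconvex[of n] pos[of n] pos[of "Suc n"] by (simp add: r_def field_simps power2_eq_square)
  then have r_mono: "i \<le> j \<Longrightarrow> r i \<le> r j" for i j
    by (rule lift_Suc_mono_le)
  have growth: "M (n + i) \<le> M n * r K ^ i" if "n + i \<le> Suc K" for i
    using that
  proof (induction i)
    case (Suc i)
    have "M (n + Suc i) = r (n + i) * M (n + i)"
      using pos[of "n + i"] by (simp add: r_def)
    also have "\<dots> \<le> r K * (M n * r K ^ i)"
      using Suc r_mono[of "n + i" K] r_pos[of K] pos[of "n + i"] by (intro mult_mono) auto
    finally show ?case by (simp add: mult_ac)
  qed simp
  define m where "m = Suc K - n"
  have m: "n + m = Suc K" using True by (simp add: m_def)
  define c where "c = exp (real n - real (Suc K)) * M n"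
  have c_pos: "c > 0" using pos by (simp add: c_def)
  define y where "y = exp 1 * r K * \<bar>h\<bar>"
  have y0: "y \<ge> 0" using r_pos[of K] by (simp add: y_def)
  have "y \<le> exp 1 * r K * (M K / M (Suc K) / exp 1)"
    unfolding y_def using h r_pos[of K] by (intro mult_left_mono) auto
  also have "\<dots> = 1" using pos[of K] pos[of "Suc K"] by (simp add: r_def)
  finally have y1: "y \<le> 1" .
  have term_bound: "exp (real (n + i) - real (Suc K)) * M (n + i) * (\<bar>h\<bar> ^ i / fact i) \<le> c * (y ^ i / fact i)"
    if "i \<le> m" for i
  proof -
    have "exp (real (n + i) - real (Suc K)) = exp (real n - real (Suc K)) * exp 1 ^ i"
      by (simp add: exp_of_nat_mult[symmetric] exp_add[symmetric] exp_diff field_simps)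
    then have "exp (real (n + i) - real (Suc K)) * M (n + i) * (\<bar>h\<bar> ^ i / fact i) \<le>
        exp (real n - real (Suc K)) * exp 1 ^ i * (M n * r K ^ i) * (\<bar>h\<bar> ^ i / fact i)"
      using growth[of i] that m by (auto intro!: mult_right_mono mult_left_mono divide_right_mono)
    also have "\<dots> = c * (y ^ i / fact i)" by (simp add: c_def y_def power_mult_distrib field_simps)
    finally show ?thesis .
  qed
  have "norm (f n (x + h)) \<le> norm (\<Sum>i<m. f (n + i) x * of_real (h ^ i / fact i)) + M (n + m) * (\<bar>h\<bar> ^ m / fact m)"
    using taylor[of n x h m] norm_triangle_ineq2[of "f n (x + h)" "\<Sum>i<m. f (n + i) x * of_real (h ^ i / fact i)"]
    by linarith
  also have "norm (\<Sum>i<m. f (n + i) x * of_real (h ^ i / fact i)) \<le> (\<Sum>i<m. c * (y ^ i / fact i))"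
  proof (rule order_trans[OF norm_sum], rule sum_mono)
    fix i assume "i \<in> {..<m}"
    then have i: "i \<le> m" by simp
    have "norm (f (n + i) x * of_real (h ^ i / fact i)) = norm (f (n + i) x) * (\<bar>h\<bar> ^ i / fact i)"
      by (simp add: norm_mult norm_divide norm_power power_abs)
    also have "\<dots> \<le> exp (real (n + i) - real (Suc K)) * M (n + i) * (\<bar>h\<bar> ^ i / fact i)"
      by (intro mult_right_mono prev) auto
    finally show "norm (f (n + i) x * of_real (h ^ i / fact i)) \<le> c * (y ^ i / fact i)"
      using term_bound[OF i] by simp
  qed
  also have "M (n + m) * (\<bar>h\<bar> ^ m / fact m) \<le> c * (y ^ m / fact m)"
    using term_bound[of m] m by (simp del: of_nat_Suc)
  also have "(\<Sum>i<m. c * (y ^ i / fact i)) + c * (y ^ m / fact m) = c * (\<Sum>i<Suc m. y ^ i / fact i)"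
    by (simp add: sum_distrib_left ring_distribs)
  also have "(\<Sum>i<Suc m. y ^ i / fact i) \<le> exp y"
  proof -
    have "(\<Sum>i<Suc m. y ^ i /\<^sub>R fact i) \<le> (\<Sum>i. y ^ i /\<^sub>R fact i)"
      using y0 by (intro sum_le_suminf summable_exp_generic) auto
    then show ?thesis by (simp add: exp_def field_simps)
  qed
  also have "exp y \<le> exp 1" using y1 by simp
  also have "c * exp 1 = exp (real n - real K) * M n"
    by (simp add: c_def exp_add[symmetric] exp_diff field_simps)
  finally show ?thesis using c_pos by simp
qed

text \<open>
  The functions \<open>f n\<close> play the role of the derivatives of \<open>f 0\<close>; only Taylor's inequality is
  used. Starting at \<open>0\<close> with an arbitrarily high \<open>N\<close> and applying Bang's step for \<open>N - 1, \<dots>, K\<close>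
  covers an interval whose length is a block of a divergent series, so the bound with the factor
  \<open>exp (- K)\<close> holds at every point, for every \<open>K\<close>.
\<close>

lemma quasianalytic_vanishing:
  fixes f :: "nat \<Rightarrow> real \<Rightarrow> complex" and M :: "nat \<Rightarrow> real"
  assumes pos: "\<And>n. M n > 0"
    and logconvex: "\<And>n. (M (Suc n))\<^sup>2 \<le> M n * M (Suc (Suc n))"
    and bound: "\<And>n x. norm (f n x) \<le> M n"
    and taylor: "\<And>n m x h. norm (f n (x + h) - (\<Sum>i<m. f (n + i) x * of_real (h ^ i / fact i)))
                   \<le> M (n + m) * (\<bar>h\<bar> ^ m / fact m)"
    and zero: "\<And>n. f n 0 = 0"
    and divergent: "\<not> summable (\<lambda>n. M n / M (Suc n))"
  shows "f 0 x = 0"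
proof -
  define b where "b n = M n / M (Suc n) / exp 1" for n
  have b_pos: "b n > 0" for n using pos by (simp add: b_def)
  have b_div: "\<not> summable b"
    using divergent summable_mult2[of b "exp 1"] by (auto simp: b_def[abs_def])
  have *: "norm (f n x) \<le> exp (real n - real K) * M n"
    if "K \<le> N" "\<bar>x\<bar> \<le> sum b {K..<N}" for K N n x
    using that
  proof (induction K arbitrary: x n rule: inc_induct)
    case base
    then show ?case using zero pos[of n] by simp
  next
    case (step K)
    define S where "S = sum b {Suc K..<N}"
    have S: "S \<ge> 0" unfolding S_def using b_pos by (intro sum_nonneg) (simp add: less_imp_le)
    have KN: "sum b {K..<N} = b K + S" unfolding S_def using step.hyps by (simp add: sum.atLeast_Suc_lessThan)
    \<comment> \<open>the point of the interval covered so far that is nearest to \<open>x\<close>\<close>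
    define y where "y = max (- S) (min S x)"
    have "norm (f n (y + (x - y))) \<le> exp (real n - real K) * M n"
    proof (rule bang_step[OF pos logconvex bound taylor])
      show "norm (f n y) \<le> exp (real n - real (Suc K)) * M n" for n
        by (rule step.IH) (use S in \<open>auto simp: S_def[symmetric] y_def\<close>)
      show "\<bar>x - y\<bar> \<le> M K / M (Suc K) / exp 1"
        unfolding b_def[symmetric] using step.prems KN S b_pos[of K] by (auto simp: y_def max_def min_def)
    qed
    then show ?case by simp
  qed
  have small: "norm (f 0 x) \<le> exp (- real K) * M 0" for K
  proof -
    have "\<exists>N. sum b {..<N} > \<bar>x\<bar> + sum b {..<K}"
    proof (rule ccontr)
      assume "\<not> ?thesis"
      then have "\<And>N. sum b {..<N} \<le> \<bar>x\<bar> + sum b {..<K}" by (auto simp: not_less)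
      then have "summable b" using b_pos
        by (intro summableI_nonneg_bounded) (auto simp: less_imp_le)
      with b_div show False by blast
    qed
    then obtain N where N: "sum b {..<N} > \<bar>x\<bar> + sum b {..<K}" by blast
    have "K \<le> N"
    proof (rule ccontr)
      assume "\<not> K \<le> N"
      then have "sum b {..<N} \<le> sum b {..<K}" using b_pos by (intro sum_mono2) (auto simp: less_imp_le)
      with N show False by linarith
    qed
    moreover have "sum b {..<K} + sum b {K..<N} = sum b {..<N}"
      using \<open>K \<le> N\<close> by (simp add: lessThan_atLeast0 sum.atLeastLessThan_concat)
    ultimately show ?thesis using *[of K N x 0] N by auto
  qed
  have "(\<lambda>K. exp (- real K) * M 0) \<longlonglongrightarrow> 0"
    by (intro tendsto_mult_left_zero filterlim_compose[OF exp_at_bot]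
        filterlim_compose[OF filterlim_uminus_at_bot_at_top] filterlim_real_sequentially)
  then have "norm (f 0 x) \<le> 0"
    by (rule LIMSEQ_le_const) (use small in auto)
  then show ?thesis by simp
qed

text \<open>
  Carleman's inequality, without the optimal constant. The arithmetic-geometric mean inequality
  is applied to the numbers \<open>(i + 1) * b i\<close>; the weights are undone by \<open>(n / e)\<^sup>n \<le> n!\<close>, and
  interchanging the sums leaves the tails of \<open>\<Sum>1 / n\<^sup>2\<close>.
\<close>

lemma summable_geometric_means:
  fixes b :: "nat \<Rightarrow> real"
  assumes pos: "\<And>n. b n \<ge> 0" and summable: "summable b"
  shows "summable (\<lambda>n. root (Suc n) (\<Prod>i\<le>n. b i))"
proof (rule summableI_nonneg_bounded)
  define g where "g n = root (Suc n) (\<Prod>i\<le>n. b i)" for n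
  show "0 \<le> root (Suc n) (\<Prod>i\<le>n. b i)" for n
    using pos by (simp add: prod_nonneg)
  have g_le: "g n \<le> exp 1 * (\<Sum>i\<le>n. real (Suc i) * b i) / (real (Suc n))\<^sup>2" for n
  proof -
    define P where "P = (\<Prod>i\<le>n. b i)"
    have P0: "P \<ge> 0" unfolding P_def using pos by (intro prod_nonneg) auto
    have fact: "(\<Prod>i\<le>n. real (Suc i)) = fact (Suc n)"
      by (induction n) (simp_all add: algebra_simps)
    have "(\<Prod>i\<in>{..n}. real (Suc i) * b i) powr (1 / card {..n}) \<le> (\<Sum>i\<in>{..n}. real (Suc i) * b i / card {..n})"
      using pos by (intro arith_geom_mean) auto
    also have "(\<Prod>i\<in>{..n}. real (Suc i) * b i) = fact (Suc n) * P"
      by (simp add: prod.distrib fact P_def del: of_nat_Suc fact_Suc)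
    also have "(fact (Suc n) * P) powr (1 / card {..n}) = root (Suc n) (fact (Suc n) * P)"
      using P0 by (subst root_powr_inverse) (auto simp del: fact_Suc)
    also have "\<dots> = root (Suc n) (fact (Suc n)) * g n"
      by (simp add: real_root_mult g_def P_def del: fact_Suc)
    finally have *: "root (Suc n) (fact (Suc n)) * g n \<le> (\<Sum>i\<le>n. real (Suc i) * b i) / real (Suc n)"
      by (simp add: sum_divide_distrib del: fact_Suc)
    have "real (Suc n) ^ Suc n /\<^sub>R fact (Suc n) \<le> exp (real (Suc n))"
      unfolding exp_def using sum_le_suminf[OF summable_exp_generic[of "real (Suc n)"], of "{Suc n}"]
      by (simp del: fact_Suc of_nat_Suc power_Suc)
    moreover have "p / e \<le> f" if "p /\<^sub>R f \<le> e" "f > 0" "e > 0" for p f e :: real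
      using that by (simp add: field_simps)
    ultimately have "real (Suc n) ^ Suc n / exp (real (Suc n)) \<le> fact (Suc n)"
      using fact_gt_zero exp_gt_zero by blast
    moreover have "exp (real (Suc n)) = exp 1 ^ Suc n"
      using exp_of_nat_mult[of "Suc n" "1 :: real"] by (simp only: mult_1_right)
    ultimately have "(real (Suc n) / exp 1) ^ Suc n \<le> fact (Suc n)" by (simp only: power_divide)
    then have "root (Suc n) ((real (Suc n) / exp 1) ^ Suc n) \<le> root (Suc n) (fact (Suc n))"
      by (intro real_root_le_mono) auto
    then have "real (Suc n) / exp 1 \<le> root (Suc n) (fact (Suc n))"
      by (subst (asm) real_root_power_cancel) auto
    then have "real (Suc n) / exp 1 * g n \<le> root (Suc n) (fact (Suc n)) * g n"
      using pos by (intro mult_right_mono) (auto simp: g_def prod_nonneg)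
    then have "real (Suc n) / exp 1 * g n \<le> (\<Sum>i\<le>n. real (Suc i) * b i) / real (Suc n)"
      using * by (rule order_trans)
    moreover have "g n \<le> exp 1 * S / N\<^sup>2" if "N / exp 1 * g n \<le> S / N" "N > 0" for N S :: real
      using that by (simp add: field_simps power2_eq_square)
    ultimately show ?thesis by simp
  qed
  have tail: "(\<Sum>n\<in>{i..<N}. 1 / (real (Suc n))\<^sup>2) \<le> 2 / real (Suc i)" for i N
  proof (cases "i < N")
    case True
    have "(\<Sum>n\<in>{i..<N}. 1 / (real (Suc n))\<^sup>2) \<le> 2 / real (Suc i) - 1 / real N"
      using True
    proof (induction N)
      case (Suc N)
      have "1 / (real (Suc N))\<^sup>2 \<le> 1 / real N - 1 / real (Suc N)"
        if "N > 0"
      proof -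
        have "1 / (real (Suc N))\<^sup>2 \<le> 1 / (real N * real (Suc N))"
          using that by (intro divide_left_mono) (auto simp: power2_eq_square)
        also have "\<dots> = 1 / real N - 1 / real (Suc N)" using that by (simp add: field_simps)
        finally show ?thesis .
      qed
      moreover have "1 / (real (Suc N))\<^sup>2 \<le> 1 / real (Suc N)"
        by (intro divide_left_mono) (auto simp: power2_eq_square)
      ultimately show ?case using Suc by (cases "i < N") (auto simp: less_Suc_eq)
    qed simp
    then show ?thesis by (smt (verit) divide_nonneg_nonneg of_nat_0_le_iff)
  qed simp
  fix N
  have "(\<Sum>n<N. g n) \<le> (\<Sum>n<N. exp 1 * (\<Sum>i\<le>n. real (Suc i) * b i) / (real (Suc n))\<^sup>2)"
    by (intro sum_mono g_le)
  also have "\<dots> = exp 1 * (\<Sum>n<N. \<Sum>i\<le>n. real (Suc i) * b i * (1 / (real (Suc n))\<^sup>2))"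
    by (simp add: sum_distrib_left sum_divide_distrib)
  also have "(\<Sum>n<N. \<Sum>i\<le>n. real (Suc i) * b i * (1 / (real (Suc n))\<^sup>2)) =
      (\<Sum>i<N. \<Sum>n\<in>{i..<N}. real (Suc i) * b i * (1 / (real (Suc n))\<^sup>2))"
    by (subst (1 2) sum.Sigma) (auto intro!: sum.reindex_bij_witness[of _ prod.swap prod.swap])
  also have "\<dots> = (\<Sum>i<N. real (Suc i) * b i * (\<Sum>n\<in>{i..<N}. 1 / (real (Suc n))\<^sup>2))"
    by (simp add: sum_distrib_left)
  also have "\<dots> \<le> (\<Sum>i<N. real (Suc i) * b i * (2 / real (Suc i)))"
    using pos by (intro sum_mono mult_left_mono tail) auto
  also have "\<dots> = 2 * (\<Sum>i<N. b i)" by (simp add: sum_distrib_left mult.commute)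
  also have "(\<Sum>i<N. b i) \<le> suminf b" using pos summable by (intro sum_le_suminf) auto
  finally show "(\<Sum>n<N. root (Suc n) (\<Prod>i\<le>n. b i)) \<le> exp 1 * (2 * suminf b)"
    unfolding g_def by simp
qed

text \<open>
  Passes from roots of moments, which Carleman's condition is about, to ratios of consecutive moments,
  which Bang's argument needs: the geometric means of the ratios are roots of \<open>1 / M n\<close> up to the
  factor \<open>M 0\<close>. The maximum with \<open>1\<close> is harmless, since a series of positive terms and the
  series of their minima with \<open>1\<close> diverge simultaneously.
\<close>

lemma carleman_ratio_divergent:
  fixes M a :: "nat \<Rightarrow> real"
  assumes pos: "\<And>n. M n > 0" and M0: "M 0 \<ge> 1"
    and le: "\<And>k. M (2 * Suc k) \<le> (E * max (a k) 1) ^ (2 * Suc k)" and E: "E > 0"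
    and a: "\<And>k. a k > 0" and div: "\<not> summable (\<lambda>k. 1 / a k)"
  shows "\<not> summable (\<lambda>n. M n / M (Suc n))"
proof
  assume "summable (\<lambda>n. M n / M (Suc n))"
  then have "summable (\<lambda>n. root (Suc n) (\<Prod>i\<le>n. M i / M (Suc i)))"
    using pos by (intro summable_geometric_means) (auto simp: less_imp_le)
  also have "(\<lambda>n. \<Prod>i\<le>n. M i / M (Suc i)) = (\<lambda>n. M 0 / M (Suc n))"
  proof
    fix n show "(\<Prod>i\<le>n. M i / M (Suc i)) = M 0 / M (Suc n)"
      by (induction n) (use pos in \<open>auto simp: less_imp_neq[THEN not_sym]\<close>)
  qed
  then have "(\<lambda>n. root (Suc n) (\<Prod>i\<le>n. M i / M (Suc i))) = (\<lambda>n. root (Suc n) (M 0 / M (Suc n)))"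
    by (auto simp: fun_eq_iff)
  finally have sM: "summable (\<lambda>n. root (Suc n) (M 0 / M (Suc n)))" .
  define F where "F n = root (Suc n) (M 0 / M (Suc n))" for n
  have F0: "F n \<ge> 0" for n using pos by (simp add: F_def less_imp_le)
  have sF: "summable F" using sM by (simp add: F_def[abs_def])
  have s: "summable (\<lambda>k. root (2 * Suc k) (M 0 / M (2 * Suc k)))"
  proof (rule summableI_nonneg_bounded)
    show "0 \<le> root (2 * Suc k) (M 0 / M (2 * Suc k))" for k
      using F0[of "Suc (2 * k)"] by (simp add: F_def)
    fix N
    have "(\<Sum>k<N. root (2 * Suc k) (M 0 / M (2 * Suc k))) = sum F ((\<lambda>k. Suc (2 * k)) ` {..<N})"
      by (subst sum.reindex) (auto simp: inj_on_def F_def)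
    also have "\<dots> \<le> suminf F" using sF F0 by (intro sum_le_suminf) auto
    finally show "(\<Sum>k<N. root (2 * Suc k) (M 0 / M (2 * Suc k))) \<le> suminf F" .
  qed
  have "norm (min (1 / a k) 1) \<le> E * root (2 * Suc k) (M 0 / M (2 * Suc k))" for k
  proof -
    define A where "A = E * max (a k) 1"
    have A: "A > 0" using E by (simp add: A_def)
    have "(1 / A) ^ (2 * Suc k) \<le> 1 / M (2 * Suc k)"
      using le[of k] pos[of "2 * Suc k"] unfolding A_def[symmetric] using A
      by (simp add: field_simps power_divide del: power_Suc)
    also have "\<dots> \<le> M 0 / M (2 * Suc k)" using M0 pos[of "2 * Suc k"] by (simp add: divide_right_mono)
    finally have "root (2 * Suc k) ((1 / A) ^ (2 * Suc k)) \<le> root (2 * Suc k) (M 0 / M (2 * Suc k))"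
      by (intro real_root_le_mono) auto
    then have "1 / A \<le> root (2 * Suc k) (M 0 / M (2 * Suc k))"
      using A by (subst (asm) real_root_power_cancel) auto
    then have "E * (1 / A) \<le> E * root (2 * Suc k) (M 0 / M (2 * Suc k))"
      using E by (intro mult_left_mono) auto
    moreover have "E * (1 / A) = min (1 / a k) 1" using E a[of k] by (auto simp: A_def min_def max_def field_simps)
    moreover have "min (1 / a k) 1 \<ge> 0" using a[of k] by simp
    ultimately show ?thesis by simp
  qed
  then have min: "summable (\<lambda>k. min (1 / a k) 1)"
    by (intro summable_comparison_test'[OF summable_mult[OF s]])
  then have "(\<lambda>k. min (1 / a k) 1) \<longlonglongrightarrow> 0" by (rule summable_LIMSEQ_zero)
  then have "eventually (\<lambda>k. min (1 / a k) 1 < 1) sequentially" by (rule order_tendstoD) simp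
  then have "eventually (\<lambda>k. min (1 / a k) 1 = 1 / a k) sequentially" by eventually_elim auto
  then have "summable (\<lambda>k. min (1 / a k) 1) \<longleftrightarrow> summable (\<lambda>k. 1 / a k)" by (rule summable_cong)
  with min have "summable (\<lambda>k. 1 / a k)" by blast
  with div show False by blast
qed

definition has_moments :: "real measure \<Rightarrow> (nat \<Rightarrow> real) \<Rightarrow> bool" where
  "has_moments \<mu> \<beta> \<longleftrightarrow> real_distribution \<mu> \<and> (\<forall>k. has_bochner_integral \<mu> (\<lambda>t. t ^ k) (\<beta> k))"

lemma integrable_abs_moment:
  assumes "has_moments \<mu> \<beta>" shows "integrable \<mu> (\<lambda>t. \<bar>t\<bar> ^ k)"
  using assms integrable_abs[of \<mu> "\<lambda>t. t ^ k"] unfolding has_moments_def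
  by (auto simp: power_abs has_bochner_integral_iff)

text \<open>
  The derivative of order \<open>n\<close> of the characteristic function, written as an integral so that
  Taylor's inequality for it follows by integrating the one for the exponential function.
\<close>

definition char_deriv :: "real measure \<Rightarrow> nat \<Rightarrow> real \<Rightarrow> complex" where
  "char_deriv \<mu> n x = (CLINT t|\<mu>. (\<i> * of_real t) ^ n * iexp (x * t))"

lemma integrable_char_deriv:
  assumes "has_moments \<mu> \<beta>" 
  shows "integrable \<mu> (\<lambda>t. (\<i> * of_real t) ^ n * iexp (x * t))"
proof -
  interpret real_distribution \<mu> using assms by (simp add: has_moments_def)
  show ?thesis
    by (rule Bochner_Integration.integrable_bound[OF integrable_abs_moment[OF assms, of n]])
      (auto simp: norm_mult norm_power)
qed

lemma norm_char_deriv_le: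
  assumes "has_moments \<mu> \<beta>" 
  shows "norm (char_deriv \<mu> n x) \<le> (LINT t|\<mu>. \<bar>t\<bar> ^ n)"
proof -
  have "norm (char_deriv \<mu> n x) \<le> (LINT t|\<mu>. norm ((\<i> * of_real t) ^ n * iexp (x * t)))"
    unfolding char_deriv_def by (rule integral_norm_bound)
  then show ?thesis by (simp add: norm_mult norm_power)
qed

lemma char_deriv_taylor:
  assumes "has_moments \<mu> \<beta>" 
  shows "norm (char_deriv \<mu> n (x + h) - (\<Sum>i<m. char_deriv \<mu> (n + i) x * of_real (h ^ i / fact i)))
    \<le> (LINT t|\<mu>. \<bar>t\<bar> ^ (n + m)) * (\<bar>h\<bar> ^ m / fact m)"
proof -
  interpret real_distribution \<mu> using assms by (simp add: has_moments_def)
  note int [simp] = integrable_char_deriv[OF assms]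
  have expansion: "norm (iexp s - (\<Sum>i<m. (\<i> * s) ^ i / fact i)) \<le> \<bar>s\<bar> ^ m / fact m" for s :: real
    by (cases m) (use iexp_approx1[of s "m - 1"] in \<open>auto simp: lessThan_Suc_atMost\<close>)
  let ?R = "\<lambda>t. (\<i> * of_real t) ^ n * iexp ((x + h) * t) -
     (\<Sum>i<m. ((\<i> * of_real t) ^ (n + i) * iexp (x * t)) * of_real (h ^ i / fact i))"
  define G where "G n x t = (\<i> * of_real t) ^ n * iexp (x * t)" for n and x t :: real
  have G: "integrable \<mu> (G n x)" "char_deriv \<mu> n x = (CLINT t|\<mu>. G n x t)" for n x
    using int[of n x] by (simp_all add: G_def[abs_def] char_deriv_def)
  have R: "?R t = G n (x + h) t - (\<Sum>i<m. G (n + i) x t * of_real (h ^ i / fact i))" for t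
    by (simp only: G_def)
  have "char_deriv \<mu> n (x + h) - (\<Sum>i<m. char_deriv \<mu> (n + i) x * of_real (h ^ i / fact i)) = (CLINT t|\<mu>. ?R t)"
    unfolding R G(2) using G(1)
    by (subst Bochner_Integration.integral_diff)
       (auto intro!: Bochner_Integration.integrable_sum simp: Bochner_Integration.integral_sum)
  also have "norm \<dots> \<le> (LINT t|\<mu>. \<bar>t\<bar> ^ (n + m) * (\<bar>h\<bar> ^ m / fact m))"
  proof (rule Bochner_Integration.integral_norm_bound_integral)
    show "integrable \<mu> ?R"
      unfolding R using G(1) by (auto intro!: Bochner_Integration.integrable_sum Bochner_Integration.integrable_diff)
    show "integrable \<mu> (\<lambda>t. \<bar>t\<bar> ^ (n + m) * (\<bar>h\<bar> ^ m / fact m))"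
      using integrable_abs_moment[OF assms] by simp
    fix t
    have "?R t = (\<i> * of_real t) ^ n * iexp (x * t) * (iexp (h * t) - (\<Sum>i<m. (\<i> * of_real (h * t)) ^ i / fact i))"
      by (simp add: exp_add[symmetric] algebra_simps power_add power_mult_distrib sum_distrib_left)
    then have "norm (?R t) = \<bar>t\<bar> ^ n * norm (iexp (h * t) - (\<Sum>i<m. (\<i> * of_real (h * t)) ^ i / fact i))"
      by (simp add: norm_mult norm_power)
    also have "\<dots> \<le> \<bar>t\<bar> ^ n * (\<bar>h * t\<bar> ^ m / fact m)"
      using expansion[of "h * t"] by (intro mult_left_mono) auto
    finally show "norm (?R t) \<le> \<bar>t\<bar> ^ (n + m) * (\<bar>h\<bar> ^ m / fact m)"
      by (simp add: power_add abs_mult power_mult_distrib mult_ac)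
  qed
  finally show ?thesis using integrable_abs_moment[OF assms] by simp
qed

text \<open>
  A quadratic polynomial in \<open>s\<close> that is nonnegative for all \<open>s\<close>. This form of the log-convexity of
  absolute moments adds up over several measures.
\<close>

lemma abs_moment_quadratic:
  assumes "has_moments \<mu> \<beta>"
  shows "0 \<le> s\<^sup>2 * (LINT t|\<mu>. \<bar>t\<bar> ^ n) - 2 * s * (LINT t|\<mu>. \<bar>t\<bar> ^ Suc n) + (LINT t|\<mu>. \<bar>t\<bar> ^ Suc (Suc n))"
proof -
  have "0 \<le> (LINT t|\<mu>. \<bar>t\<bar> ^ n * (s - \<bar>t\<bar>)\<^sup>2)" by (intro integral_nonneg_AE) auto
  also have "(\<lambda>t::real. \<bar>t\<bar> ^ n * (s - \<bar>t\<bar>)\<^sup>2) = (\<lambda>t. s\<^sup>2 * \<bar>t\<bar> ^ n - 2 * s * \<bar>t\<bar> ^ Suc n + \<bar>t\<bar> ^ Suc (Suc n))"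
    by (auto simp: fun_eq_iff power2_eq_square algebra_simps)
  also have "(LINT t|\<mu>. s\<^sup>2 * \<bar>t\<bar> ^ n - 2 * s * \<bar>t\<bar> ^ Suc n + \<bar>t\<bar> ^ Suc (Suc n)) =
     s\<^sup>2 * (LINT t|\<mu>. \<bar>t\<bar> ^ n) - 2 * s * (LINT t|\<mu>. \<bar>t\<bar> ^ Suc n) + (LINT t|\<mu>. \<bar>t\<bar> ^ Suc (Suc n))"
    using integrable_abs_moment[OF assms, of n] integrable_abs_moment[OF assms, of "Suc n"]
      integrable_abs_moment[OF assms, of "Suc (Suc n)"]
    by (simp del: power_Suc)
  finally show ?thesis .
qed

lemma even_moment_zero:
  assumes "has_moments \<mu> \<beta>" "\<beta> (2 * k) = 0" "k \<ge> 1" "j \<ge> 1"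
  shows "\<beta> j = 0"
proof -
  have *: "has_bochner_integral \<mu> (\<lambda>t. t ^ k) (\<beta> k)" for k using assms by (simp add: has_moments_def)
  have "AE t in \<mu>. t ^ (2 * k) = 0"
    using *[of "2 * k"] assms(2)
    by (subst integral_nonneg_eq_0_iff_AE[symmetric]) (auto simp: has_bochner_integral_iff)
  then have "AE t in \<mu>. t ^ j = 0" by eventually_elim (use assms in auto)
  then have "(LINT t|\<mu>. t ^ j) = 0" by (rule integral_eq_zero_AE)
  with *[of j] show ?thesis by (simp add: has_bochner_integral_iff)
qed

text \<open>
  Carleman's theorem, with a geometric factor \<open>D * K\<^sup>2\<^sup>k\<close> of slack between the moments and the
  sequence that satisfies the condition.
\<close>

theorem carleman_determinate:
  assumes \<mu>: "has_moments \<mu> \<beta>" and \<nu>: "has_moments \<nu> \<beta>"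
    and le: "\<And>k. k \<ge> 1 \<Longrightarrow> \<beta> (2 * k) \<le> D * K ^ (2 * k) * m (2 * k)" and DK: "D > 0" "K > 0"
    and carleman: "carleman_even m"
  shows "\<mu> = \<nu>"
proof -
  interpret \<mu>: real_distribution \<mu> using \<mu> by (simp add: has_moments_def)
  interpret \<nu>: real_distribution \<nu> using \<nu> by (simp add: has_moments_def)
  \<comment> \<open>the summand \<open>1\<close>, the moment of a point mass at \<open>1\<close>, keeps \<open>M\<close> positive
      even if all higher moments vanish\<close>
  define M where "M n = (LINT t|\<mu>. \<bar>t\<bar> ^ n) + (LINT t|\<nu>. \<bar>t\<bar> ^ n) + 1" for n
  define f where "f n x = char_deriv \<mu> n x - char_deriv \<nu> n x" for n x
  have nonneg: "(LINT t|\<mu>. \<bar>t\<bar> ^ n) \<ge> 0" "(LINT t|\<nu>. \<bar>t\<bar> ^ n) \<ge> 0" for n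
    by (auto intro!: integral_nonneg_AE)
  have M_pos: "M n > 0" "M n \<ge> 1" for n using nonneg[of n] unfolding M_def by linarith+
  have M_even: "M (2 * k) = 2 * \<beta> (2 * k) + 1" for k
    using \<mu> \<nu> by (simp add: M_def has_moments_def has_bochner_integral_iff power_even_abs)
  have \<beta>0: "\<beta> (2 * k) \<ge> 0" for k
  proof -
    have "\<beta> (2 * k) = (LINT t|\<mu>. \<bar>t\<bar> ^ (2 * k))"
      using \<mu> by (simp add: has_moments_def has_bochner_integral_iff power_even_abs)
    then show ?thesis using nonneg(1)[of "2 * k"] by simp
  qed
  have "\<exists>a E. E > 0 \<and> (\<forall>k. a k > 0 \<and> M (2 * Suc k) \<le> (E * max (a k) 1) ^ (2 * Suc k)) \<and> \<not> summable (\<lambda>k. 1 / a k)"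
  proof (cases "\<exists>k\<ge>1. m (2 * k) \<le> 0")
    case True
    \<comment> \<open>then both measures are concentrated at \<open>0\<close>\<close>
    then obtain k where k: "k \<ge> 1" "m (2 * k) \<le> 0" by blast
    have "D * K ^ (2 * k) * m (2 * k) \<le> 0" using k DK by (simp add: mult_le_0_iff)
    then have "\<beta> (2 * k) = 0" using le[OF k(1)] \<beta>0[of k] by linarith
    then have "M (2 * Suc j) = 1" for j
      using M_even[of "Suc j"] even_moment_zero[OF \<mu>, of k "2 * Suc j"] k by simp
    then show ?thesis by (intro exI[of _ "\<lambda>_. 1"] exI[of _ 1]) (auto simp: summable_const_iff)
  next
    case False
    define a where "a k = root (2 * Suc k) (m (2 * Suc k))" for k
    have m: "m (2 * Suc k) > 0" for k using False by (auto simp: not_le dest: spec[of _ "Suc k"])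
    have a: "a k > 0" for k using m[of k] by (simp add: a_def)
    define E where "E = (2 * D + 1) * max K 1"
    have E: "E > 0" using DK by (auto simp: E_def)
    have "M (2 * Suc k) \<le> (E * max (a k) 1) ^ (2 * Suc k)" for k
    proof -
      define p where "p = 2 * Suc k"
      have p: "p > 0" by (simp add: p_def)
      have ap: "a k ^ p = m p" unfolding a_def p_def using m[of k] by (subst real_root_pow_pos2) auto
      define Q where "Q = max K 1 ^ p * max (a k) 1 ^ p"
      have 1: "K ^ p * m p \<le> Q"
        unfolding Q_def ap[symmetric] using DK a[of k] by (intro mult_mono power_mono) auto
      have 2: "1 * 1 \<le> Q" unfolding Q_def by (intro mult_mono one_le_power) auto
      have "M p = 2 * \<beta> p + 1" using M_even[of "Suc k"] by (simp add: p_def)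
      also have "\<beta> p \<le> D * K ^ p * m p" using le[of "Suc k"] by (simp add: p_def)
      also have "D * K ^ p * m p \<le> D * Q" using 1 DK by (simp add: mult.assoc)
      finally have "M p \<le> (2 * D + 1) * Q" using 2 by (simp add: algebra_simps)
      also have "\<dots> \<le> (2 * D + 1) ^ p * Q"
        using DK 2 p by (intro mult_right_mono self_le_power) auto
      finally show ?thesis unfolding p_def[symmetric] E_def Q_def power_mult_distrib by (simp only: mult_ac)
    qed
    moreover have "\<not> summable (\<lambda>k. 1 / a k)"
    proof
      assume s: "summable (\<lambda>k. 1 / a k)"
      have "inverse (ennreal (root (2 * Suc k) (m (2 * Suc k)))) = ennreal (1 / a k)" for k
        unfolding a_def[symmetric] using a[of k] by (simp add: inverse_ennreal inverse_eq_divide)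
      then have "(\<Sum>k. inverse (ennreal (root (2 * Suc k) (m (2 * Suc k))))) = (\<Sum>k. ennreal (1 / a k))"
        by simp
      also have "\<dots> = ennreal (\<Sum>k. 1 / a k)"
        using s a by (intro suminf_ennreal_eq summable_sums) (auto simp: less_imp_le)
      finally show False using carleman by (simp add: carleman_even_def)
    qed
    ultimately show ?thesis using a E by blast
  qed
  then obtain a E where aE: "E > 0" "\<And>k. a k > 0" "\<And>k. M (2 * Suc k) \<le> (E * max (a k) 1) ^ (2 * Suc k)"
    "\<not> summable (\<lambda>k. 1 / a k)" by blast
  have div: "\<not> summable (\<lambda>n. M n / M (Suc n))"
    by (rule carleman_ratio_divergent[OF M_pos(1) M_pos(2) aE(3) aE(1) aE(2) aE(4)])
  have logconvex: "(M (Suc n))\<^sup>2 \<le> M n * M (Suc (Suc n))" for n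
  proof -
    define s where "s = M (Suc n) / M n"
    have "0 \<le> s\<^sup>2 * M n - 2 * s * M (Suc n) + M (Suc (Suc n))"
      using abs_moment_quadratic[OF \<mu>, of s n] abs_moment_quadratic[OF \<nu>, of s n] zero_le_power2[of "s - 1"]
      unfolding M_def by (simp add: algebra_simps power2_eq_square)
    also have "s\<^sup>2 * M n - 2 * s * M (Suc n) = - (M (Suc n))\<^sup>2 / M n"
      using M_pos[of n] by (simp add: s_def field_simps power2_eq_square)
    finally show ?thesis using M_pos[of n] by (simp add: field_simps)
  qed
  have "f 0 x = 0" for x
  proof (rule quasianalytic_vanishing[OF M_pos(1) logconvex _ _ _ div])
    show "norm (f n x) \<le> M n" for n x
      using norm_char_deriv_le[OF \<mu>, of n x] norm_char_deriv_le[OF \<nu>, of n x]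
        norm_triangle_ineq4[of "char_deriv \<mu> n x" "char_deriv \<nu> n x"] by (simp add: f_def M_def)
    show "f n 0 = 0" for n
    proof -
      have "char_deriv \<rho> n 0 = \<i> ^ n * of_real (\<beta> n)" if "has_moments \<rho> \<beta>" for \<rho>
        using that by (simp add: char_deriv_def power_mult_distrib has_moments_def has_bochner_integral_iff
           flip: of_real_power)
      with \<mu> \<nu> show ?thesis by (simp add: f_def)
    qed
    fix n p x h
    let ?T = "\<lambda>\<rho>. char_deriv \<rho> n (x + h) - (\<Sum>i<p. char_deriv \<rho> (n + i) x * of_real (h ^ i / fact i))"
    have "f n (x + h) - (\<Sum>i<p. f (n + i) x * of_real (h ^ i / fact i)) = ?T \<mu> - ?T \<nu>"
      by (simp add: f_def algebra_simps sum_subtractf)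
    then have "norm (f n (x + h) - (\<Sum>i<p. f (n + i) x * of_real (h ^ i / fact i))) \<le> norm (?T \<mu>) + norm (?T \<nu>)"
      by (simp only: norm_triangle_ineq4)
    also have "\<dots> \<le> ((LINT t|\<mu>. \<bar>t\<bar> ^ (n + p)) + (LINT t|\<nu>. \<bar>t\<bar> ^ (n + p))) * (\<bar>h\<bar> ^ p / fact p)"
      unfolding distrib_right by (intro add_mono char_deriv_taylor[OF \<mu>] char_deriv_taylor[OF \<nu>])
    also have "\<dots> \<le> M (n + p) * (\<bar>h\<bar> ^ p / fact p)"
      unfolding M_def by (intro mult_right_mono) auto
    finally show "norm (f n (x + h) - (\<Sum>i<p. f (n + i) x * of_real (h ^ i / fact i))) \<le> M (n + p) * (\<bar>h\<bar> ^ p / fact p)" .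
  qed
  then have "char \<mu> = char \<nu>" by (simp add: f_def char_deriv_def char_def fun_eq_iff)
  then show ?thesis by (intro Levy_uniqueness \<mu>.real_distribution_axioms \<nu>.real_distribution_axioms)
qed

section \<open>The method of moments\<close>

definition clamp_real :: "real \<Rightarrow> real \<Rightarrow> real" where
  "clamp_real R t = max (- R) (min R t)"

text \<open>
  Weak convergence only controls bounded continuous functions. This estimate shows that replacing a power by its
  truncation costs a multiple of a higher moment that tends to \<open>0\<close> as the truncation level grows.
\<close>

lemma clamp_power_diff_le:
  assumes "R > 0"
  shows "\<bar>t ^ k - clamp_real R t ^ k\<bar> \<le> 2 * t ^ (2 * k) / R ^ k"
proof (cases "\<bar>t\<bar> \<le> R")
  case True
  then have "clamp_real R t = t" by (auto simp: clamp_real_def)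
  then show ?thesis using assms by simp
next
  case False
  have "\<bar>clamp_real R t\<bar> \<le> \<bar>t\<bar>" using assms by (auto simp: clamp_real_def)
  then have "\<bar>clamp_real R t ^ k\<bar> \<le> \<bar>t\<bar> ^ k" by (simp add: power_abs power_mono)
  then have "\<bar>t ^ k - clamp_real R t ^ k\<bar> \<le> 2 * \<bar>t\<bar> ^ k"
    using abs_triangle_ineq4[of "t ^ k" "clamp_real R t ^ k"] by (simp add: power_abs)
  also have "\<dots> \<le> 2 * \<bar>t\<bar> ^ k * (\<bar>t\<bar> ^ k / R ^ k)"
  proof -
    have "R ^ k \<le> \<bar>t\<bar> ^ k" using False assms by (intro power_mono) auto
    then have "1 \<le> \<bar>t\<bar> ^ k / R ^ k" using assms by simp
    from mult_left_mono[OF this, of "2 * \<bar>t\<bar> ^ k"] show ?thesis by simp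
  qed
  also have "\<bar>t\<bar> ^ k * \<bar>t\<bar> ^ k = t ^ (2 * k)"
    unfolding power_add[symmetric] mult_2[symmetric] by (rule power_even_abs) simp
  then have "2 * \<bar>t\<bar> ^ k * (\<bar>t\<bar> ^ k / R ^ k) = 2 * t ^ (2 * k) / R ^ k" by simp
  finally show ?thesis .
qed

lemma abs_clamp_le: "R > 0 \<Longrightarrow> \<bar>clamp_real R t\<bar> \<le> R" "R > 0 \<Longrightarrow> \<bar>clamp_real R t\<bar> \<le> \<bar>t\<bar>"
  by (auto simp: clamp_real_def)

lemma isCont_clamp [continuous_intros]: "isCont (clamp_real R) t"
  unfolding clamp_real_def[abs_def] by (intro continuous_intros)

lemma measurable_clamp [measurable]: "clamp_real R \<in> borel_measurable borel"
  unfolding clamp_real_def[abs_def] by measurable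

text \<open>
  The truncated powers are bounded and continuous, so their integrals converge; the error of the
  truncation is uniform in \<open>n\<close>, because the moments of order \<open>2 * k\<close> converge. Integrability under
  the limit is Fatou's lemma.
\<close>

lemma weak_limit_has_moments:
  fixes \<mu> :: "nat \<Rightarrow> real measure"
  assumes conv: "weak_conv_m \<mu> \<nu>" and \<nu>: "real_distribution \<nu>"
    and \<mu>: "\<And>n. has_moments (\<mu> n) (m n)" and lim: "\<And>k. (\<lambda>n. m n k) \<longlonglongrightarrow> \<beta> k"
  shows "has_moments \<nu> \<beta>"
proof -
  interpret \<nu>: real_distribution \<nu> by fact
  have rd: "real_distribution (\<mu> n)" for n using \<mu> by (simp add: has_moments_def)
  have hb: "has_bochner_integral (\<mu> n) (\<lambda>t. t ^ k) (m n k)" for n k using \<mu> by (simp add: has_moments_def)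
  have clamp_int: "integrable \<rho> (\<lambda>t. clamp_real R t ^ k)" if "real_distribution \<rho>" "R > 0" for \<rho> R k
  proof -
    interpret real_distribution \<rho> by fact
    show ?thesis by (rule integrable_const_bound[of _ "R ^ k"])
       (use that abs_clamp_le in \<open>auto simp: power_abs intro!: power_mono\<close>)
  qed
  have clamp_conv: "(\<lambda>n. LINT t|\<mu> n. clamp_real R t ^ k) \<longlonglongrightarrow> (LINT t|\<nu>. clamp_real R t ^ k)" if "R > 0" for R k
  proof (rule weak_conv_imp_integral_bdd_continuous_conv[OF rd \<nu> conv])
    show "isCont (\<lambda>t. clamp_real R t ^ k) x" for x by (intro continuous_intros)
    show "norm (clamp_real R x ^ k) \<le> R ^ k" for x
      using abs_clamp_le(1)[OF that, of x] by (auto simp: power_abs intro!: power_mono)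
  qed
  have even_bound: "(LINT t|\<nu>. clamp_real R t ^ (2 * k)) \<le> \<beta> (2 * k)" if "R > 0" for R k
  proof (rule LIMSEQ_le[OF clamp_conv[OF that] lim])
    have "(LINT t|\<mu> n. clamp_real R t ^ (2 * k)) \<le> m n (2 * k)" for n
    proof -
      have "(LINT t|\<mu> n. clamp_real R t ^ (2 * k)) \<le> (LINT t|\<mu> n. t ^ (2 * k))"
      proof (rule integral_mono[OF clamp_int[OF rd that]])
        show "integrable (\<mu> n) (\<lambda>t. t ^ (2 * k))" using hb by (auto simp: has_bochner_integral_iff)
        fix t
        have "\<bar>clamp_real R t\<bar> ^ (2 * k) \<le> \<bar>t\<bar> ^ (2 * k)"
          using abs_clamp_le(2)[OF that] by (intro power_mono) auto
        then show "clamp_real R t ^ (2 * k) \<le> t ^ (2 * k)" by (simp add: power_even_abs)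
      qed
      then show ?thesis using hb[of n "2 * k"] by (simp add: has_bochner_integral_iff)
    qed
    then show "\<exists>N. \<forall>n\<ge>N. (LINT t|\<mu> n. clamp_real R t ^ (2 * k)) \<le> m n (2 * k)" by blast
  qed
  have even_int: "integrable \<nu> (\<lambda>t. t ^ (2 * k))" and even_le: "(LINT t|\<nu>. t ^ (2 * k)) \<le> \<beta> (2 * k)" for k
  proof -
    have pos: "\<beta> (2 * k) \<ge> 0"
      by (rule order_trans[OF _ even_bound[of 1]]) (auto intro!: integral_nonneg_AE)
    let ?u = "\<lambda>i t. ennreal (clamp_real (real (Suc i)) t ^ (2 * k))"
    have "eventually (\<lambda>i. ?u i t = ennreal (t ^ (2 * k))) sequentially" for t
      using eventually_ge_at_top[of "nat \<lceil>\<bar>t\<bar>\<rceil>"]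
    proof eventually_elim
      case (elim i)
      then have "\<bar>t\<bar> \<le> real (Suc i)" by linarith
      then have "clamp_real (real (Suc i)) t = t" by (auto simp: clamp_real_def)
      then show ?case by simp
    qed
    then have "liminf (\<lambda>i. ?u i t) = ennreal (t ^ (2 * k))" for t
      by (intro lim_imp_Liminf tendsto_eventually) auto
    then have "(\<integral>\<^sup>+ t. ennreal (t ^ (2 * k)) \<partial>\<nu>) \<le> liminf (\<lambda>i. \<integral>\<^sup>+ t. ?u i t \<partial>\<nu>)"
      using nn_integral_liminf[of ?u \<nu>] by simp
    also have "\<dots> \<le> liminf (\<lambda>i. ennreal (\<beta> (2 * k)))"
    proof (rule Liminf_mono, rule always_eventually, rule allI)
      fix i
      have "(\<integral>\<^sup>+ t. ?u i t \<partial>\<nu>) = ennreal (LINT t|\<nu>. clamp_real (real (Suc i)) t ^ (2 * k))"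
        by (intro nn_integral_eq_integral clamp_int \<nu>) auto
      also have "\<dots> \<le> ennreal (\<beta> (2 * k))" by (intro ennreal_leI even_bound) simp
      finally show "(\<integral>\<^sup>+ t. ?u i t \<partial>\<nu>) \<le> ennreal (\<beta> (2 * k))" .
    qed
    finally have *: "(\<integral>\<^sup>+ t. ennreal (t ^ (2 * k)) \<partial>\<nu>) \<le> ennreal (\<beta> (2 * k))"
      by (simp add: Liminf_const)
    show int: "integrable \<nu> (\<lambda>t. t ^ (2 * k))"
      by (intro integrableI_nonneg) (use * in \<open>auto simp: less_top[symmetric] top_unique\<close>)
    show "(LINT t|\<nu>. t ^ (2 * k)) \<le> \<beta> (2 * k)"
      using * pos nn_integral_eq_integral[OF int] by simp
  qed
  have int: "integrable \<nu> (\<lambda>t. t ^ k)" for k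
  proof (rule Bochner_Integration.integrable_bound[of \<nu> "\<lambda>t. 1 + t ^ (2 * k)"])
    show "AE t in \<nu>. norm (t ^ k) \<le> norm (1 + t ^ (2 * k))"
    proof (rule AE_I2)
      fix t :: real
      have "2 * \<bar>t ^ k\<bar> \<le> 1 + (t ^ k)\<^sup>2" using zero_le_power2[of "\<bar>t ^ k\<bar> - 1"] by (simp add: power2_eq_square algebra_simps)
      then show "norm (t ^ k) \<le> norm (1 + t ^ (2 * k))" by (simp add: power_mult[symmetric] mult.commute)
    qed
  qed (use even_int in auto)
  have "(LINT t|\<nu>. t ^ k) = \<beta> k" for k
  proof (cases "k = 0")
    case True
    have "m n 0 = 1" for n
    proof -
      interpret real_distribution "\<mu> n" by (rule rd)
      show ?thesis using hb[of n 0] prob_space by (simp add: has_bochner_integral_iff)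
    qed
    then have "\<beta> 0 = 1" using lim[of 0] by (simp add: LIMSEQ_const_iff)
    then show ?thesis using True \<nu>.prob_space by simp
  next
    case k: False
    have diff: "\<bar>(LINT t|\<rho>. t ^ k) - (LINT t|\<rho>. clamp_real R t ^ k)\<bar> \<le> 2 / R ^ k * (LINT t|\<rho>. t ^ (2 * k))"
      if "R > 0" "real_distribution \<rho>" "\<And>k. integrable \<rho> (\<lambda>t. t ^ k)" for R \<rho>
    proof -
      have "(LINT t|\<rho>. t ^ k) - (LINT t|\<rho>. clamp_real R t ^ k) = (LINT t|\<rho>. t ^ k - clamp_real R t ^ k)"
        using that clamp_int by simp
      also have "\<bar>\<dots>\<bar> \<le> (LINT t|\<rho>. 2 / R ^ k * t ^ (2 * k))"
        using that(3)[of k] that(3)[of "2 * k"] clamp_int[OF that(2,1)] clamp_power_diff_le[OF that(1)]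
        by (intro integral_abs_bound_integral) auto
      finally show ?thesis using that(3)[of "2 * k"] by simp
    qed
    have bound: "\<bar>(LINT t|\<nu>. t ^ k) - \<beta> k\<bar> \<le> 4 * \<beta> (2 * k) / R ^ k" if R: "R > 0" for R
    proof -
      have "\<bar>(LINT t|\<nu>. clamp_real R t ^ k) - \<beta> k\<bar> \<le> 2 / R ^ k * \<beta> (2 * k)"
      proof (rule LIMSEQ_le)
        show "(\<lambda>n. \<bar>(LINT t|\<mu> n. clamp_real R t ^ k) - m n k\<bar>) \<longlonglongrightarrow> \<bar>(LINT t|\<nu>. clamp_real R t ^ k) - \<beta> k\<bar>"
          by (intro tendsto_intros clamp_conv lim R)
        show "(\<lambda>n. 2 / R ^ k * m n (2 * k)) \<longlonglongrightarrow> 2 / R ^ k * \<beta> (2 * k)" by (intro tendsto_intros lim)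
        show "\<exists>N. \<forall>n\<ge>N. \<bar>(LINT t|\<mu> n. clamp_real R t ^ k) - m n k\<bar> \<le> 2 / R ^ k * m n (2 * k)"
        proof (intro exI[of _ 0] allI impI)
          fix n
          have "integrable (\<mu> n) (\<lambda>t. t ^ k)" "(LINT t|\<mu> n. t ^ k) = m n k" for k
            using hb[of n k] by (auto simp: has_bochner_integral_iff)
          then show "\<bar>(LINT t|\<mu> n. clamp_real R t ^ k) - m n k\<bar> \<le> 2 / R ^ k * m n (2 * k)"
            using diff[OF R rd[of n]] by (simp add: abs_minus_commute)
        qed
      qed
      moreover have "2 / R ^ k * (LINT t|\<nu>. t ^ (2 * k)) \<le> 2 / R ^ k * \<beta> (2 * k)"
        using even_le R by (intro mult_left_mono) auto
      ultimately show ?thesis using diff[OF R \<nu> int] by (simp add: field_simps)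
    qed
    have "(\<lambda>i. 4 * \<beta> (2 * k) * inverse (real (Suc i)) ^ k) \<longlonglongrightarrow> 4 * \<beta> (2 * k) * 0 ^ k"
      by (intro tendsto_intros LIMSEQ_inverse_real_of_nat)
    then have "\<bar>(LINT t|\<nu>. t ^ k) - \<beta> k\<bar> \<le> 4 * \<beta> (2 * k) * 0 ^ k"
    proof (rule LIMSEQ_le_const)
      show "\<exists>N. \<forall>n\<ge>N. \<bar>(LINT t|\<nu>. t ^ k) - \<beta> k\<bar> \<le> 4 * \<beta> (2 * k) * inverse (real (Suc n)) ^ k"
        using bound[of "real (Suc _)"] by (auto simp: power_inverse divide_inverse)
    qed
    then show ?thesis using k by (simp add: power_0_left)
  qed
  then show ?thesis using \<nu> int by (simp add: has_moments_def has_bochner_integral_iff)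
qed

text \<open>
  Chebyshev's inequality; a convergent sequence of second moments is bounded.
\<close>

lemma tight_of_moments:
  assumes \<mu>: "\<And>n. has_moments (\<mu> n) (m n)" and lim: "(\<lambda>n. m n 2) \<longlonglongrightarrow> b"
  shows "tight \<mu>"
  unfolding tight_def
proof (intro conjI allI impI)
  show "real_distribution (\<mu> n)" for n using \<mu> by (simp add: has_moments_def)
  fix \<epsilon> :: real assume \<epsilon>: "\<epsilon> > 0"
  have "Bseq (\<lambda>n. m n 2)" using lim by (intro convergent_imp_Bseq convergentI)
  then obtain B where B: "B > 0" "\<And>n. \<bar>m n 2\<bar> \<le> B" by (auto simp: Bseq_def)
  define R where "R = sqrt (B / \<epsilon>) + 1"
  have R: "R > 0" "R\<^sup>2 > B / \<epsilon>"
  proof -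
    show "R > 0" using B \<epsilon> by (auto simp: R_def intro!: add_nonneg_pos)
    have "sqrt (B / \<epsilon>) < R" by (simp add: R_def)
    then have "(sqrt (B / \<epsilon>))\<^sup>2 < R\<^sup>2" using B \<epsilon> by (intro power_strict_mono) auto
    then show "R\<^sup>2 > B / \<epsilon>" using B \<epsilon> by simp
  qed
  have "1 - \<epsilon> < measure (\<mu> n) {- R<..R}" for n
  proof -
    interpret real_distribution "\<mu> n" using \<mu> by (simp add: has_moments_def)
    have hb: "has_bochner_integral (\<mu> n) (\<lambda>t. t ^ 2) (m n 2)" using \<mu> by (simp add: has_moments_def)
    have "prob {t \<in> space (\<mu> n). t\<^sup>2 \<ge> R\<^sup>2} \<le> expectation (\<lambda>t. t\<^sup>2) / R\<^sup>2"
      using hb R by (intro integral_Markov_inequality_measure[where A="{}"]) (auto simp: has_bochner_integral_iff)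
    also have "\<dots> \<le> B / R\<^sup>2" using hb B(2)[of n] R by (intro divide_right_mono) (auto simp: has_bochner_integral_iff)
    also have "\<dots> < \<epsilon>" using R \<epsilon> B by (simp add: field_simps)
    finally have "prob {t \<in> space (\<mu> n). t\<^sup>2 \<ge> R\<^sup>2} < \<epsilon>" .
    moreover have "prob (space (\<mu> n) - {- R<..R}) \<le> prob {t \<in> space (\<mu> n). t\<^sup>2 \<ge> R\<^sup>2}"
    proof (rule finite_measure_mono)
      show "space (\<mu> n) - {- R<..R} \<subseteq> {t \<in> space (\<mu> n). t\<^sup>2 \<ge> R\<^sup>2}"
        using R by (auto simp: abs_le_square_iff[symmetric])
    qed simp
    moreover have "prob (space (\<mu> n) - {- R<..R}) = 1 - prob {- R<..R}" by (rule prob_compl) simp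
    ultimately show ?thesis by linarith
  qed
  then show "\<exists>a b. a < b \<and> (\<forall>n. 1 - \<epsilon> < measure (\<mu> n) {a<..b})" using R by (intro exI[of _ "- R"] exI[of _ R]) auto
qed

text \<open>
  Every subsequential weak limit has the moments \<open>\<beta>\<close>, hence is \<open>\<nu>\<close>; tightness does the rest.
\<close>

lemma method_of_moments:
  fixes \<mu> :: "nat \<Rightarrow> real measure"
  assumes \<mu>: "\<And>n. has_moments (\<mu> n) (m n)" and lim: "\<And>k. (\<lambda>n. m n k) \<longlonglongrightarrow> \<beta> k"
    and \<nu>: "has_moments \<nu> \<beta>" and unique: "\<And>\<rho>. has_moments \<rho> \<beta> \<Longrightarrow> \<rho> = \<nu>"
  shows "weak_conv_m \<mu> \<nu>"
proof (rule tight_subseq_weak_converge)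
  show "real_distribution (\<mu> n)" for n using \<mu> by (simp add: has_moments_def)
  show "real_distribution \<nu>" using \<nu> by (simp add: has_moments_def)
  show "tight \<mu>" by (rule tight_of_moments[OF \<mu> lim])
  fix s \<rho> assume s: "strict_mono s" "real_distribution \<rho>" "weak_conv_m (\<mu> \<circ> s) \<rho>"
  have "has_moments \<rho> \<beta>"
    by (rule weak_limit_has_moments[OF s(3,2), where m = "m \<circ> s"])
      (use \<mu> LIMSEQ_subseq_LIMSEQ[OF lim s(1)] in \<open>auto simp: o_def\<close>)
  then show "weak_conv_m (\<mu> \<circ> s) \<nu>" using unique s(3) by simp
qed

lemma exists_moment_limit:
  fixes \<mu> :: "nat \<Rightarrow> real measure"
  assumes \<mu>: "\<And>n. has_moments (\<mu> n) (m n)" and lim: "\<And>k. (\<lambda>n. m n k) \<longlonglongrightarrow> \<beta> k"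
  shows "\<exists>\<nu>. has_moments \<nu> \<beta>"
proof -
  obtain r \<nu> where r: "strict_mono r" "real_distribution \<nu>" "weak_conv_m (\<mu> \<circ> id \<circ> r) \<nu>"
    using tight_imp_convergent_subsubsequence[OF tight_of_moments[OF \<mu> lim] strict_mono_id] by blast
  have "has_moments \<nu> \<beta>"
    by (rule weak_limit_has_moments[OF r(3,2), where m = "m \<circ> r"])
      (use \<mu> LIMSEQ_subseq_LIMSEQ[OF lim r(1)] in \<open>auto simp: o_def\<close>)
  then show ?thesis by blast
qed

text \<open>
  Reflection changes only the signs of the odd moments, and these are \<open>0\<close>.
\<close>

lemma symmetric_of_determinate:
  assumes \<nu>: "has_moments \<nu> \<beta>" and unique: "\<And>\<rho>. has_moments \<rho> \<beta> \<Longrightarrow> \<rho> = \<nu>"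
    and odd: "\<And>k. odd k \<Longrightarrow> \<beta> k = 0"
  shows "symmetric_measure \<nu>"
  unfolding symmetric_measure_def
proof (rule unique)
  interpret real_distribution \<nu> using \<nu> by (simp add: has_moments_def)
  have "real_distribution (distr \<nu> borel uminus)" by (rule real_distribution_distr) simp
  moreover have "has_bochner_integral (distr \<nu> borel uminus) (\<lambda>t. t ^ k) (\<beta> k)" for k
  proof -
    have "has_bochner_integral \<nu> (\<lambda>t. t ^ k) (\<beta> k)" using \<nu> by (simp add: has_moments_def)
    then have "has_bochner_integral \<nu> (\<lambda>t. (- 1) ^ k * t ^ k) ((- 1) ^ k * \<beta> k)" by (rule has_bochner_integral_mult_right)
    moreover have "(- 1) ^ k * \<beta> k = \<beta> k" using odd by (cases "even k") auto
    moreover have "(- 1) ^ k * t ^ k = (- t) ^ k" for t :: real by (simp add: power_minus[of t])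
    ultimately have "has_bochner_integral \<nu> (\<lambda>t. (- t) ^ k) (\<beta> k)" by simp
    then show ?thesis by (subst has_bochner_integral_distr) auto
  qed
  ultimately show "has_moments (distr \<nu> borel uminus) \<beta>" by (simp add: has_moments_def)
qed

section \<open>The spectrum of a real symmetric matrix\<close>

text \<open>
  The usual computation of \<open>v\<^sup>* A v\<close> in two ways, over the complex numbers.
\<close>

lemma symmetric_eigenvalue_real:
  fixes A :: "real mat"
  assumes A: "A \<in> carrier_mat n n" and sym: "transpose_mat A = A"
    and ev: "eigenvalue (map_mat complex_of_real A) a"
  shows "a \<in> \<real>"
proof -
  let ?A = "map_mat complex_of_real A"
  have cA: "?A \<in> carrier_mat n n" using A by simp
  obtain v where v: "v \<in> carrier_vec n" "v \<noteq> 0\<^sub>v n" "?A *\<^sub>v v = a \<cdot>\<^sub>v v"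
    using ev cA by (auto simp: eigenvalue_def eigenvector_def)
  have cv: "conjugate v \<in> carrier_vec n" using v by simp
  have conj: "?A *\<^sub>v conjugate v = conjugate a \<cdot>\<^sub>v conjugate v"
  proof -
    have "?A *\<^sub>v conjugate v = conjugate (?A *\<^sub>v v)"
      by (rule eq_vecI) (use A v(1) in \<open>auto simp: scalar_prod_def\<close>)
    then show ?thesis using v by (simp add: conjugate_smult_vec)
  qed
  have tA: "transpose_mat ?A = ?A" using sym by (metis map_mat_transpose)
  have "a * (v \<bullet> conjugate v) = (?A *\<^sub>v v) \<bullet> conjugate v"
    using v cv by simp
  also have "\<dots> = v \<bullet> (?A *\<^sub>v conjugate v)"
    using transpose_vec_mult_scalar[OF cA cv v(1)] by (simp add: tA)
  also have "\<dots> = conjugate a * (v \<bullet> conjugate v)" using conj v cv by simp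
  finally have "a = conjugate a" using conjugate_square_eq_0_vec[OF v(1)] v(2) by simp
  then show ?thesis by (simp add: Reals_cnj_iff)
qed

text \<open>
  The complex characteristic polynomial splits and all its roots are real; injectivity of the
  embedding of polynomials brings the factorisation back to the reals.
\<close>

lemma real_symmetric_char_poly_splits:
  fixes A :: "real mat"
  assumes A: "A \<in> carrier_mat n n" and sym: "transpose_mat A = A"
  obtains es where "char_poly A = (\<Prod>e\<leftarrow>es. [:- e, 1:])" "length es = n"
proof -
  interpret ph: map_poly_inj_idom_hom complex_of_real ..
  let ?A = "map_mat complex_of_real A"
  have cA: "?A \<in> carrier_mat n n" using A by simp
  obtain as where as: "char_poly ?A = (\<Prod>a\<leftarrow>as. [:- a, 1:])" "length as = n"
    using char_poly_factorized[OF cA] by blast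
  have real: "a \<in> \<real>" if "a \<in> set as" for a
  proof (rule symmetric_eigenvalue_real[OF A sym])
    have "poly (char_poly ?A) a = 0" unfolding as(1) poly_prod_list using that by (auto simp: prod_list_zero_iff)
    then show "eigenvalue ?A a" using eigenvalue_root_char_poly[OF cA] by simp
  qed
  have "map_poly complex_of_real (char_poly A) = map_poly complex_of_real (\<Prod>e\<leftarrow>map Re as. [:- e, 1:])"
  proof -
    have "char_poly ?A = map_poly complex_of_real (char_poly A)"
      by (rule of_real_hom.char_poly_hom[OF A])
    then have "map_poly complex_of_real (char_poly A) = (\<Prod>a\<leftarrow>as. [:- a, 1:])"
      using as(1) by simp
    also have "\<dots> = (\<Prod>e\<leftarrow>map Re as. map_poly complex_of_real [:- e, 1:])"
      using real by (intro arg_cong[where f = prod_list]) (auto simp: o_def)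
    also have "\<dots> = map_poly complex_of_real (\<Prod>e\<leftarrow>map Re as. [:- e, 1:])"
      by (induction as) (simp_all add: ph.hom_mult ph.hom_one del: map_poly_pCons mult_pCons_left)
    finally show ?thesis .
  qed
  then have "char_poly A = (\<Prod>e\<leftarrow>map Re as. [:- e, 1:])"
    by (rule ph.injectivity)
  then show ?thesis using that[of "map Re as"] as(2) by simp
qed

definition mat_trace :: "real mat \<Rightarrow> real" where
  "mat_trace A = (\<Sum>i<dim_row A. A $$ (i, i))"

lemma mat_trace_mult_commute:
  assumes "A \<in> carrier_mat n n" "B \<in> carrier_mat n n"
  shows "mat_trace (A * B) = mat_trace (B * A)"
proof -
  have "mat_trace (A * B) = (\<Sum>i<n. \<Sum>j<n. A $$ (i, j) * B $$ (j, i))"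
    using assms by (auto simp: mat_trace_def scalar_prod_def lessThan_atLeast0 intro!: sum.cong)
  also have "\<dots> = (\<Sum>j<n. \<Sum>i<n. B $$ (j, i) * A $$ (i, j))"
    by (subst sum.swap) (simp add: mult.commute)
  also have "\<dots> = mat_trace (B * A)"
    using assms by (auto simp: mat_trace_def scalar_prod_def lessThan_atLeast0 intro!: sum.cong)
  finally show ?thesis .
qed

lemma upper_triangular_pow:
  fixes B :: "real mat"
  assumes B: "B \<in> carrier_mat n n" and ut: "upper_triangular B"
  shows "upper_triangular (B ^\<^sub>m k) \<and> (\<forall>i<n. (B ^\<^sub>m k) $$ (i, i) = (B $$ (i, i)) ^ k)"
proof (induction k)
  case 0
  then show ?case using B by auto
next
  case (Suc k)
  have Bk: "B ^\<^sub>m k \<in> carrier_mat n n" using B by simp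
  have entry: "(B ^\<^sub>m Suc k) $$ (i, j) = (\<Sum>l<n. (B ^\<^sub>m k) $$ (i, l) * B $$ (l, j))" if "i < n" "j < n" for i j
    using B Bk that by (simp add: scalar_prod_def lessThan_atLeast0)
  have zero: "(B ^\<^sub>m k) $$ (i, l) * B $$ (l, j) = 0" if "i < n" "l < n" "l < i \<or> j < l" for i j l
    using that Suc ut B Bk by (auto simp: upper_triangular_def)
  have "(B ^\<^sub>m Suc k) $$ (i, j) = 0" if "j < i" "i < n" for i j
    using that by (subst entry) (auto intro!: sum.neutral zero)
  moreover have "(B ^\<^sub>m Suc k) $$ (i, i) = (B $$ (i, i)) ^ Suc k" if "i < n" for i
  proof -
    have "(B ^\<^sub>m Suc k) $$ (i, i) = (\<Sum>l\<in>{i}. (B ^\<^sub>m k) $$ (i, l) * B $$ (l, i))"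
      unfolding entry[OF that that]
    proof (intro sum.mono_neutral_right ballI)
      fix l assume "l \<in> {..<n} - {i}"
      then have "l < n" "l < i \<or> i < l" by auto
      then show "(B ^\<^sub>m k) $$ (i, l) * B $$ (l, i) = 0" using zero[of i l i] that by blast
    qed (use that in auto)
    then show ?thesis using Suc that by simp
  qed
  ultimately show ?case using B by (auto simp: upper_triangular_def)
qed

text \<open>
  Schur triangularisation identifies the diagonal with the roots of the characteristic polynomial, and
  the trace of a power is invariant under similarity.
\<close>

lemma spectrum_of_symmetric:
  fixes A :: "real mat"
  assumes A: "A \<in> carrier_mat n n" and sym: "transpose_mat A = A"
  obtains es where "proots (char_poly A) = mset es" "length es = n"
    "\<And>k. mat_trace (A ^\<^sub>m k) = (\<Sum>e\<leftarrow>es. e ^ k)"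
proof -
  obtain es where es: "char_poly A = (\<Prod>e\<leftarrow>es. [:- e, 1:])" "length es = n"
    by (rule real_symmetric_char_poly_splits[OF A sym])
  have roots: "proots (char_poly A) = mset es"
    unfolding es(1)
  proof (induction es)
    case (Cons e es)
    have "proots ([:- e, 1:] * (\<Prod>e\<leftarrow>es. [:- e, 1:])) = proots [:- e, 1:] + proots (\<Prod>e\<leftarrow>es. [:- e, 1:])"
      by (rule proots_mult) (auto simp: prod_list_zero_iff)
    then show ?case unfolding list.map prod_list.Cons Cons.IH by simp
  qed simp
  obtain B P Q where BPQ: "schur_decomposition A es = (B, P, Q)" by (cases "schur_decomposition A es")
  have sim: "similar_mat_wit A B P Q" and ut: "upper_triangular B" and diag: "diag_mat B = es"
    using schur_decomposition[OF A es(1) BPQ] by auto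
  have c: "B \<in> carrier_mat n n" "P \<in> carrier_mat n n" "Q \<in> carrier_mat n n" "Q * P = 1\<^sub>m n"
    using similar_mat_witD2[OF A sim] by auto
  have "mat_trace (A ^\<^sub>m k) = (\<Sum>e\<leftarrow>es. e ^ k)" for k
  proof -
    have Bk: "B ^\<^sub>m k \<in> carrier_mat n n" using c by simp
    have "mat_trace (A ^\<^sub>m k) = mat_trace ((P * B ^\<^sub>m k) * Q)"
      using similar_mat_wit_pow_id[OF sim] by simp
    also have "\<dots> = mat_trace (Q * (P * B ^\<^sub>m k))"
      by (rule mat_trace_mult_commute[of _ n]) (use c Bk in auto)
    also have "Q * (P * B ^\<^sub>m k) = (Q * P) * B ^\<^sub>m k"
      using c Bk by (metis assoc_mult_mat)
    also have "\<dots> = B ^\<^sub>m k" using c Bk by simp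
    also have "mat_trace (B ^\<^sub>m k) = (\<Sum>i<n. (B $$ (i, i)) ^ k)"
      using upper_triangular_pow[OF c(1) ut, of k] c(1) by (simp add: mat_trace_def)
    also have "\<dots> = (\<Sum>e\<leftarrow>diag_mat B. e ^ k)"
      using c(1) by (simp add: diag_mat_def sum_list_distinct_conv_sum_set lessThan_atLeast0 o_def)
    finally show ?thesis by (simp add: diag)
  qed
  then show ?thesis using that roots es(2) by blast
qed

section \<open>The expected empirical spectral distribution\<close>

text \<open>
  The spectral distribution is the law of a uniformly chosen eigenvalue, so integrals against it
  are averages over an enumeration of the eigenvalues.
\<close>

lemma esd_symmetric:
  fixes A :: "real mat"
  assumes A: "A \<in> carrier_mat n n" and sym: "transpose_mat A = A" and n: "n > 0"
  obtains ev where "prob_space (esd A)" "\<And>k. mat_trace (A ^\<^sub>m k) = (\<Sum>i<n. ev i ^ k)"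
    "\<And>f. f \<in> borel_measurable borel \<Longrightarrow> has_bochner_integral (esd A) f ((\<Sum>i<n. f (ev i)) / real n)"
proof -
  obtain es where es: "proots (char_poly A) = mset es" "length es = n"
      "\<And>k. mat_trace (A ^\<^sub>m k) = (\<Sum>e\<leftarrow>es. e ^ k)"
    using spectrum_of_symmetric[OF A sym] by blast
  define U where "U = uniform_count_measure {..<n}"
  have U: "prob_space U" "space U = {..<n}" "sets U = Pow {..<n}"
    using n by (auto simp: U_def space_uniform_count_measure sets_uniform_count_measure
        intro!: prob_space_uniform_count_measure)
  have meas: "f \<in> U \<rightarrow>\<^sub>M N" if "f \<in> {..<n} \<rightarrow> space N" for f and N :: "real measure"
    using that by (auto simp: measurable_def U)
  have eq: "esd A = distr U borel ((!) es)"
  proof (rule measure_eqI)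
    fix B :: "real set" assume "B \<in> sets (esd A)"
    then have B: "B \<in> sets borel" by simp
    define X where "X = {i\<in>{..<n}. es ! i \<in> B}"
    have "(\<Sum>t\<in>#proots (char_poly A). indicator B t :: ennreal) = (\<Sum>i<n. indicator B (es ! i))"
      unfolding es(1) using es(2)
      by (simp add: sum_mset_sum_list sum_list_sum_nth lessThan_atLeast0 flip: mset_map)
    also have "\<dots> = of_nat (card X)"
      by (simp add: X_def indicator_def sum.If_cases Collect_conj_eq[symmetric] Int_def conj_commute)
    finally have "emeasure (esd A) B = of_nat (card X) / of_nat n"
      using B A by (simp add: emeasure_esd)
    also have "\<dots> = ennreal (real (card X) / real n)"
      using n by (simp add: divide_ennreal ennreal_of_nat_eq_real_of_nat)
    also have "\<dots> = emeasure U X"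
      unfolding U_def by (subst emeasure_uniform_count_measure) (auto simp: X_def)
    also have "X = (!) es -` B \<inter> space U" by (auto simp: X_def U)
    also have "emeasure U \<dots> = emeasure (distr U borel ((!) es)) B"
      using B by (subst emeasure_distr) (auto intro!: meas)
    finally show "emeasure (esd A) B = emeasure (distr U borel ((!) es)) B" .
  qed simp
  have "has_bochner_integral (esd A) f ((\<Sum>i<n. f (es ! i)) / real n)" if f: "f \<in> borel_measurable borel" for f
    unfolding eq
  proof (rule has_bochner_integral_distr[OF f])
    show "(!) es \<in> U \<rightarrow>\<^sub>M borel" by (intro meas) auto
    have "integrable U (\<lambda>i. f (es ! i))"
      unfolding U_def uniform_count_measure_def by (rule integrable_point_measure_finite) simp
    moreover have "(LINT i|U. f (es ! i)) = (\<Sum>i<n. f (es ! i)) / real n"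
      unfolding U_def by (subst integral_uniform_count_measure) auto
    ultimately show "has_bochner_integral U (\<lambda>i. f (es ! i)) ((\<Sum>i<n. f (es ! i)) / real n)"
      by (simp add: has_bochner_integral_iff)
  qed
  moreover have "prob_space (esd A)"
    unfolding eq using U by (intro prob_space.prob_space_distr meas) auto
  moreover have "mat_trace (A ^\<^sub>m k) = (\<Sum>i<n. (es ! i) ^ k)" for k
    using es(2) by (simp add: es(3) sum_list_sum_nth lessThan_atLeast0)
  ultimately show ?thesis using that by blast
qed

locale random_symmetric_matrix = prob_space M for M :: "'a measure" +
  fixes A :: "'a \<Rightarrow> real mat" and n :: nat
  assumes dim: "A \<omega> \<in> carrier_mat n n" and sym: "transpose_mat (A \<omega>) = A \<omega>" and n_pos: "n > 0"
    and entry [measurable]: "i < n \<Longrightarrow> j < n \<Longrightarrow> (\<lambda>\<omega>. A \<omega> $$ (i, j)) \<in> borel_measurable M"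
begin

lemma prob_space_esd: "prob_space (esd (A \<omega>))"
  using esd_symmetric[OF dim sym n_pos] by blast

lemma measurable_pow_entry:
  "i < n \<Longrightarrow> j < n \<Longrightarrow> (\<lambda>\<omega>. (A \<omega> ^\<^sub>m k) $$ (i, j)) \<in> borel_measurable M"
proof (induction k arbitrary: i j)
  case 0
  have "(A \<omega> ^\<^sub>m 0) $$ (i, j) = (if i = j then 1 else 0)" for \<omega> using dim[of \<omega>] 0 by simp
  then show ?case by simp
next
  case (Suc k)
  have [simp]: "dim_row (A \<omega> ^\<^sub>m k) = n" "dim_row (A \<omega>) = n" "dim_col (A \<omega>) = n" "dim_col (A \<omega> ^\<^sub>m k) = n" for \<omega>
    using dim[of \<omega>] by auto
  have "(A \<omega> ^\<^sub>m Suc k) $$ (i, j) = (\<Sum>l<n. (A \<omega> ^\<^sub>m k) $$ (i, l) * A \<omega> $$ (l, j))" for \<omega>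
    using Suc.prems by (simp add: scalar_prod_def lessThan_atLeast0)
  moreover have "(\<lambda>\<omega>. \<Sum>l<n. (A \<omega> ^\<^sub>m k) $$ (i, l) * A \<omega> $$ (l, j)) \<in> borel_measurable M"
    using Suc by (intro borel_measurable_sum borel_measurable_times) auto
  ultimately show ?case by simp
qed

lemma measurable_trace_power [measurable]: "(\<lambda>\<omega>. mat_trace (A \<omega> ^\<^sub>m k)) \<in> borel_measurable M"
proof -
  have "mat_trace (A \<omega> ^\<^sub>m k) = (\<Sum>i<n. (A \<omega> ^\<^sub>m k) $$ (i, i))" for \<omega>
    using dim[of \<omega>] by (simp add: mat_trace_def)
  then show ?thesis using measurable_pow_entry by simp
qed

lemma esd_power: "has_bochner_integral (esd (A \<omega>)) (\<lambda>t. t ^ k) (mat_trace (A \<omega> ^\<^sub>m k) / real n)"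
proof -
  obtain ev where ev: "\<And>k. mat_trace (A \<omega> ^\<^sub>m k) = (\<Sum>i<n. ev i ^ k)"
    "\<And>f. f \<in> borel_measurable borel \<Longrightarrow> has_bochner_integral (esd (A \<omega>)) f ((\<Sum>i<n. f (ev i)) / real n)"
    using esd_symmetric[OF dim sym n_pos] by metis
  show ?thesis using ev(2)[of "\<lambda>t. t ^ k"] by (simp add: ev(1))
qed

lemma measurable_integral_polynomial:
  assumes "real_polynomial_function (p :: real \<Rightarrow> real)"
  shows "(\<lambda>\<omega>. LINT t|esd (A \<omega>). p t) \<in> borel_measurable M"
proof -
  obtain a d where p: "p = (\<lambda>t. \<Sum>i\<le>d. a i * t ^ i)"
    using assms real_polynomial_function_iff_sum by blast
  have "(LINT t|esd (A \<omega>). p t) = (\<Sum>i\<le>d. a i * (mat_trace (A \<omega> ^\<^sub>m i) / real n))" for \<omega>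
    unfolding p using esd_power[of \<omega>] by (simp add: has_bochner_integral_iff)
  then show ?thesis by simp
qed

text \<open>
  Averages of polynomials over the spectrum are polynomials in the entries, by the trace
  formula. For each \<open>\<omega>\<close> the spectrum is finite and hence lies in some \<open>{-m..m}\<close>, so polynomials that
  approximate \<open>f\<close> uniformly on these intervals give a pointwise limit.
\<close>

lemma measurable_integral_continuous:
  assumes cont: "continuous_on UNIV (f :: real \<Rightarrow> real)"
  shows "(\<lambda>\<omega>. LINT t|esd (A \<omega>). f t) \<in> borel_measurable M"
proof -
  have "\<exists>p. real_polynomial_function p \<and> (\<forall>t\<in>{- real m..real m}. \<bar>f t - p t\<bar> < inverse (real (Suc m)))" for m
    by (rule Stone_Weierstrass_real_polynomial_function[of "{- real m..real m}" f "inverse (real (Suc m))"])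
       (use continuous_on_subset[OF cont] in auto)
  then obtain p where p: "\<And>m. real_polynomial_function (p m)"
    "\<And>m t. \<bar>t\<bar> \<le> real m \<Longrightarrow> \<bar>f t - p m t\<bar> < inverse (real (Suc m))"
    by (metis abs_le_iff atLeastAtMost_iff minus_le_iff)
  show ?thesis
  proof (rule borel_measurable_LIMSEQ_real)
    show "(\<lambda>\<omega>. LINT t|esd (A \<omega>). p m t) \<in> borel_measurable M" for m
      by (rule measurable_integral_polynomial[OF p(1)])
    fix \<omega>
    obtain ev where ev: "\<And>f. f \<in> borel_measurable borel \<Longrightarrow>
        has_bochner_integral (esd (A \<omega>)) f ((\<Sum>i<n. f (ev i)) / real n)"
      using esd_symmetric[OF dim sym n_pos] by metis
    have f_meas: "f \<in> borel_measurable borel" using cont by (rule borel_measurable_continuous_onI)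
    have "continuous_on UNIV (p m)" for m
      using p(1)[of m] by (auto intro!: continuous_at_imp_continuous_on continuous_real_polymonial_function)
    then have p_meas: "p m \<in> borel_measurable borel" for m by (rule borel_measurable_continuous_onI)
    have "(\<lambda>m. p m t) \<longlonglongrightarrow> f t" for t
    proof (rule LIM_zero_cancel, rule Lim_null_comparison)
      show "\<forall>\<^sub>F m in sequentially. norm (p m t - f t) \<le> inverse (real (Suc m))"
        using eventually_ge_at_top[of "nat \<lceil>\<bar>t\<bar>\<rceil>"]
      proof eventually_elim
        case (elim m)
        then have "\<bar>t\<bar> \<le> real m" by linarith
        from p(2)[OF this] show ?case by simp
      qed
    qed (rule LIMSEQ_inverse_real_of_nat)
    then have "(\<lambda>m. (\<Sum>i<n. p m (ev i)) / real n) \<longlonglongrightarrow> (\<Sum>i<n. f (ev i)) / real n"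
      using n_pos by (intro tendsto_intros) auto
    then show "(\<lambda>m. LINT t|esd (A \<omega>). p m t) \<longlonglongrightarrow> (LINT t|esd (A \<omega>). f t)"
      using ev[OF f_meas] ev[OF p_meas] by (simp add: has_bochner_integral_iff)
  qed
qed

text \<open>
  The indicator of a half-line is a pointwise limit of continuous functions.
\<close>

lemma measurable_esd_atMost: "(\<lambda>\<omega>. emeasure (esd (A \<omega>)) {..a}) \<in> borel_measurable M"
proof -
  define f where "f m = cts_step a (a + inverse (real (Suc m)))" for m
  have f_cont: "continuous_on UNIV (f m)" for m
    unfolding f_def by (intro uniformly_continuous_imp_continuous cts_step_uniformly_continuous) simp
  have f_lim: "(\<lambda>m. f m t) \<longlonglongrightarrow> indicator {..a} t" for t
  proof (cases "t \<le> a")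
    case True
    then show ?thesis by (simp add: f_def cts_step_def)
  next
    case False
    have "(\<lambda>m. a + inverse (real (Suc m))) \<longlonglongrightarrow> a + 0"
      by (intro tendsto_intros LIMSEQ_inverse_real_of_nat)
    then have "\<forall>\<^sub>F m in sequentially. a + inverse (real (Suc m)) < t"
      using False by (intro order_tendstoD) auto
    then have "\<forall>\<^sub>F m in sequentially. f m t = indicator {..a} t"
      by eventually_elim (use False in \<open>auto simp: f_def cts_step_def\<close>)
    then show ?thesis by (rule tendsto_eventually)
  qed
  have "(\<lambda>\<omega>. measure (esd (A \<omega>)) {..a}) \<in> borel_measurable M"
  proof (rule borel_measurable_LIMSEQ_real)
    show "(\<lambda>\<omega>. LINT t|esd (A \<omega>). f m t) \<in> borel_measurable M" for m
      by (rule measurable_integral_continuous[OF f_cont])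
    fix \<omega>
    interpret E: prob_space "esd (A \<omega>)" by (rule prob_space_esd)
    obtain ev where ev: "\<And>f. f \<in> borel_measurable borel \<Longrightarrow>
        has_bochner_integral (esd (A \<omega>)) f ((\<Sum>i<n. f (ev i)) / real n)"
      using esd_symmetric[OF dim sym n_pos] by metis
    have "(\<lambda>m. (\<Sum>i<n. f m (ev i)) / real n) \<longlonglongrightarrow> (\<Sum>i<n. indicator {..a} (ev i)) / real n"
      using n_pos f_lim by (intro tendsto_intros) auto
    moreover have "(LINT t|esd (A \<omega>). f m t) = (\<Sum>i<n. f m (ev i)) / real n" for m
      using ev[OF borel_measurable_continuous_onI[OF f_cont]] by (simp add: has_bochner_integral_iff)
    moreover have "measure (esd (A \<omega>)) {..a} = (\<Sum>i<n. indicator {..a} (ev i)) / real n"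
      using ev[of "indicator {..a}"] by (simp add: has_bochner_integral_iff)
    ultimately show "(\<lambda>m. LINT t|esd (A \<omega>). f m t) \<longlonglongrightarrow> measure (esd (A \<omega>)) {..a}" by simp
  qed
  then have "(\<lambda>\<omega>. ennreal (measure (esd (A \<omega>)) {..a})) \<in> borel_measurable M" by simp
  moreover have "emeasure (esd (A \<omega>)) {..a} = ennreal (measure (esd (A \<omega>)) {..a})" for \<omega>
  proof -
    interpret E: prob_space "esd (A \<omega>)" by (rule prob_space_esd)
    show ?thesis by (rule E.emeasure_eq_measure)
  qed
  ultimately show ?thesis by simp
qed

lemma measurable_esd: "(\<lambda>\<omega>. esd (A \<omega>)) \<in> M \<rightarrow>\<^sub>M prob_algebra borel"
proof (rule measurable_prob_algebra_generated[where \<Omega> = UNIV and G = "range atMost"])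
  show "sets borel = sigma_sets UNIV (range atMost :: real set set)"
    by (subst borel_eq_atMost) simp
  show "Int_stable (range atMost :: real set set)"
    by (auto simp: Int_stable_def)
qed (auto intro: prob_space_esd measurable_esd_atMost)

text \<open>
  The expected spectral distribution is the mixture of the random spectral distributions over
  \<open>M\<close>; countable additivity of its defining set function is a consequence of measurability of the
  kernel.
\<close>

lemma eesd_eq_bind: "eesd M A = M \<bind> (\<lambda>\<omega>. esd (A \<omega>))"
proof -
  let ?N = "M \<bind> (\<lambda>\<omega>. esd (A \<omega>))"
  have k: "(\<lambda>\<omega>. esd (A \<omega>)) \<in> M \<rightarrow>\<^sub>M subprob_algebra borel"
    by (rule measurable_prob_algebraD[OF measurable_esd])
  have sets: "sets ?N = sets borel" using not_empty by (intro sets_bind) auto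
  have "?N = measure_of UNIV (sets borel) (emeasure ?N)"
    using measure_of_of_measure[of ?N] sets sets_eq_imp_space_eq[OF sets] by simp
  also have "\<dots> = eesd M A"
    unfolding eesd_def
    by (rule measure_of_eq) (auto simp: sets.sigma_sets_eq[of borel, simplified] emeasure_bind[OF not_empty k])
  finally show ?thesis ..
qed

lemma real_distribution_eesd: "real_distribution (eesd M A)"
proof -
  have "prob_space (M \<bind> (\<lambda>\<omega>. esd (A \<omega>)))"
    by (rule prob_space_bind'[OF _ measurable_esd]) (auto simp: space_prob_algebra prob_space_axioms)
  then interpret E: prob_space "eesd M A" by (simp add: eesd_eq_bind)
  show ?thesis by standard simp
qed

text \<open>
  The formula for integrals against a mixture is available for nonnegative functions, and
  \<open>t\<^sup>k\<close> is the difference of the nonnegative functions \<open>1 + t\<^sup>2\<^sup>k + t\<^sup>k\<close> and \<open>1 + t\<^sup>2\<^sup>k\<close>.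
\<close>

lemma eesd_moment:
  assumes int: "\<And>k. integrable M (\<lambda>\<omega>. mat_trace (A \<omega> ^\<^sub>m k))"
  shows "has_bochner_integral (eesd M A) (\<lambda>t. t ^ k) (expectation (\<lambda>\<omega>. mat_trace (A \<omega> ^\<^sub>m k)) / real n)"
proof -
  have k: "(\<lambda>\<omega>. esd (A \<omega>)) \<in> M \<rightarrow>\<^sub>M subprob_algebra borel"
    by (rule measurable_prob_algebraD[OF measurable_esd])
  have nonneg: "has_bochner_integral (eesd M A) p (expectation r)"
    if p: "p \<in> borel_measurable borel" "\<And>t. p t \<ge> 0"
      and r: "\<And>\<omega>. has_bochner_integral (esd (A \<omega>)) p (r \<omega>)" "integrable M r" for p :: "real \<Rightarrow> real" and r
  proof (rule has_bochner_integral_nn_integral)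
    have r0: "r \<omega> \<ge> 0" for \<omega>
      using r(1)[of \<omega>] Bochner_Integration.integral_nonneg[of "esd (A \<omega>)" p] p(2) by (simp add: has_bochner_integral_iff)
    show "p \<in> borel_measurable (eesd M A)" using p(1) by (simp add: measurable_def)
    show "0 \<le> expectation r" using r0 by (auto intro!: integral_nonneg_AE)
    have "(\<integral>\<^sup>+ t. p t \<partial>eesd M A) = (\<integral>\<^sup>+ \<omega>. \<integral>\<^sup>+ t. p t \<partial>esd (A \<omega>) \<partial>M)"
      unfolding eesd_eq_bind by (rule nn_integral_bind[OF _ k]) (use p(1) in simp)
    also have "\<dots> = (\<integral>\<^sup>+ \<omega>. r \<omega> \<partial>M)"
      using r(1) p(2) by (simp add: has_bochner_integral_iff nn_integral_eq_integral)
    also have "\<dots> = ennreal (expectation r)"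
      using r(2) r0 by (intro nn_integral_eq_integral) auto
    finally show "(\<integral>\<^sup>+ t. p t \<partial>eesd M A) = ennreal (expectation r)" .
  qed (use p in simp)
  define T where "T k \<omega> = mat_trace (A \<omega> ^\<^sub>m k) / real n" for k \<omega>
  have T: "has_bochner_integral (esd (A \<omega>)) (\<lambda>t. t ^ k) (T k \<omega>)" "integrable M (T k)" for k \<omega>
    using esd_power int by (simp_all add: T_def[abs_def])
  have pos: "0 \<le> 1 + t ^ (2 * k) + t ^ k" "0 \<le> 1 + t ^ (2 * k)" for t :: real
  proof -
    have *: "t ^ (2 * k) = (t ^ k)\<^sup>2" by (simp add: power_mult[symmetric] mult.commute)
    have "1 + (t ^ k)\<^sup>2 + t ^ k = (t ^ k + 1 / 2)\<^sup>2 + 3 / 4" by (simp add: power2_eq_square field_simps)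
    then show "0 \<le> 1 + t ^ (2 * k) + t ^ k" unfolding * by (metis add_nonneg_nonneg zero_le_divide_iff zero_le_numeral zero_le_power2)
    show "0 \<le> 1 + t ^ (2 * k)" unfolding * by simp
  qed
  have T0: "has_bochner_integral (esd (A \<omega>)) (\<lambda>t. 1) (T 0 \<omega>)" for \<omega> using T(1)[of \<omega> 0] by simp
  have "has_bochner_integral (eesd M A) (\<lambda>t. 1 + t ^ (2 * k) + t ^ k) (expectation (\<lambda>\<omega>. T 0 \<omega> + T (2 * k) \<omega> + T k \<omega>))"
    by (rule nonneg) (auto intro!: pos has_bochner_integral_add T T0 Bochner_Integration.integrable_add)
  moreover have "has_bochner_integral (eesd M A) (\<lambda>t. 1 + t ^ (2 * k)) (expectation (\<lambda>\<omega>. T 0 \<omega> + T (2 * k) \<omega>))"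
    by (rule nonneg) (auto intro!: pos has_bochner_integral_add T T0 Bochner_Integration.integrable_add)
  ultimately have "has_bochner_integral (eesd M A) (\<lambda>t. (1 + t ^ (2 * k) + t ^ k) - (1 + t ^ (2 * k)))
      (expectation (\<lambda>\<omega>. T 0 \<omega> + T (2 * k) \<omega> + T k \<omega>) - expectation (\<lambda>\<omega>. T 0 \<omega> + T (2 * k) \<omega>))"
    by (rule has_bochner_integral_diff)
  moreover have "expectation (\<lambda>\<omega>. T 0 \<omega> + T (2 * k) \<omega> + T k \<omega>) - expectation (\<lambda>\<omega>. T 0 \<omega> + T (2 * k) \<omega>) = expectation (T k)"
    using T(2) by simp
  moreover have "expectation (T k) = expectation (\<lambda>\<omega>. mat_trace (A \<omega> ^\<^sub>m k)) / real n"
    by (simp add: T_def[abs_def])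
  ultimately show ?thesis by simp
qed

end

section \<open>Limits of lattice point counts\<close>

definition unit_cube :: "'i set \<Rightarrow> ('i \<Rightarrow> real) measure" where
  "unit_cube I = PiM I (\<lambda>_. restrict_space lborel {0..<1})"

definition grid_point :: "'i set \<Rightarrow> nat \<Rightarrow> ('i \<Rightarrow> real) \<Rightarrow> 'i \<Rightarrow> int" where
  "grid_point I m u = (\<lambda>i\<in>I. \<lfloor>real m * u i\<rfloor>)"

definition affine_form :: "'i set \<Rightarrow> ('i \<Rightarrow> int) \<Rightarrow> (nat \<Rightarrow> ('i \<Rightarrow> int) \<Rightarrow> int) \<Rightarrow> bool" where
  "affine_form I a f \<longleftrightarrow> (\<exists>e c. \<forall>n z. f n z = (\<Sum>i\<in>I. a i * z i) + e * int n + c)"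

text \<open>
  The mesh \<open>1 / (3 * n)\<close> makes room for link values, which can be as large as \<open>2 * n\<close>, while
  the values of all coordinates stay in \<open>{0..<3 * n}\<close>.
\<close>

definition eventually_decided :: "'i set \<Rightarrow> (nat \<Rightarrow> ('i \<Rightarrow> int) \<Rightarrow> bool) \<Rightarrow> bool" where
  "eventually_decided I P \<longleftrightarrow> (AE u in unit_cube I.
     (\<forall>\<^sub>F n in sequentially. P n (grid_point I (3 * n) u)) \<or>
     (\<forall>\<^sub>F n in sequentially. \<not> P n (grid_point I (3 * n) u)))"

lemma prob_space_unit_interval: "prob_space (restrict_space lborel {0..<1::real})"
  by (rule prob_spaceI) (simp add: space_restrict_space emeasure_restrict_space)

lemma space_unit_cube: "space (unit_cube I) = (\<Pi>\<^sub>E i\<in>I. {0..<1})"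
  by (simp add: unit_cube_def space_PiM space_restrict_space)

lemma prob_space_unit_cube: "prob_space (unit_cube I)"
  unfolding unit_cube_def by (intro prob_space_PiM prob_space_unit_interval)

lemma measurable_unit_cube_component:
  "i \<in> I \<Longrightarrow> (\<lambda>u. u i) \<in> borel_measurable (unit_cube I)"
proof -
  assume "i \<in> I"
  then have "(\<lambda>u. u i) \<in> unit_cube I \<rightarrow>\<^sub>M restrict_space lborel {0..<1}"
    unfolding unit_cube_def by (rule measurable_component_singleton)
  then have "(\<lambda>u. u i) \<in> unit_cube I \<rightarrow>\<^sub>M lborel" by (simp add: measurable_restrict_space2_iff)
  then show ?thesis by simp
qed

text \<open>
  By Fubini's theorem: for fixed values of the other coordinates at most one value of the
  coordinate \<open>i\<close> satisfies the equation.
\<close>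

lemma AE_not_on_hyperplane:
  fixes a :: "'i \<Rightarrow> real"
  assumes I: "finite I" "i \<in> I" "a i \<noteq> 0"
  shows "AE u in unit_cube I. (\<Sum>j\<in>I. a j * u j) \<noteq> c"
proof -
  let ?U = "restrict_space lborel {0..<1::real}"
  interpret U: prob_space ?U by (rule prob_space_unit_interval)
  interpret product_sigma_finite "\<lambda>_. ?U" by standard
  define J where "J = I - {i}"
  have J: "finite J" "i \<notin> J" "I = insert i J" using I by (auto simp: J_def)
  have meas: "(\<lambda>u. \<Sum>j\<in>I. a j * u j) \<in> borel_measurable (unit_cube I)"
    by (intro borel_measurable_sum borel_measurable_times measurable_unit_cube_component) auto
  define S where "S = {u \<in> space (unit_cube I). (\<Sum>j\<in>I. a j * u j) = c}"
  have S: "S \<in> sets (unit_cube I)" unfolding S_def using meas by measurable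
  have "emeasure (unit_cube I) S = (\<integral>\<^sup>+ u. indicator S u \<partial>unit_cube I)" using S by simp
  also have "\<dots> = (\<integral>\<^sup>+ x. \<integral>\<^sup>+ y. indicator S (x(i := y)) \<partial>?U \<partial>PiM J (\<lambda>_. ?U))"
    unfolding unit_cube_def J(3)
    by (rule product_nn_integral_insert[OF J(1,2)]) (use S in \<open>simp add: unit_cube_def J(3)\<close>)
  also have "\<dots> = (\<integral>\<^sup>+ x. 0 \<partial>PiM J (\<lambda>_. ?U))"
  proof (rule nn_integral_cong)
    fix x
    have "AE y in lborel. y \<noteq> (c - (\<Sum>j\<in>J. a j * x j)) / a i" by (rule AE_lborel_singleton)
    then have "AE y in ?U. y \<noteq> (c - (\<Sum>j\<in>J. a j * x j)) / a i"
      by (subst AE_restrict_space_iff) (auto elim: eventually_mono)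
    then have "AE y in ?U. indicator S (x(i := y)) = (0 :: ennreal)"
    proof eventually_elim
      case (elim y)
      have "(\<Sum>j\<in>I. a j * (x(i := y)) j) = a i * y + (\<Sum>j\<in>J. a j * x j)"
        using J by (auto intro!: sum.cong)
      then show ?case using elim I(3) by (auto simp: S_def field_simps)
    qed
    then have "(\<integral>\<^sup>+ y. indicator S (x(i := y)) \<partial>?U) = (\<integral>\<^sup>+ y. 0 \<partial>?U)" by (rule nn_integral_cong_AE)
    then show "(\<integral>\<^sup>+ y. indicator S (x(i := y)) \<partial>?U) = 0" by simp
  qed
  finally have "emeasure (unit_cube I) S = 0" by simp
  then show ?thesis using S by (intro AE_I[of _ _ S]) (auto simp: S_def)
qed

lemma grid_point_scaling: "(\<lambda>n. real_of_int \<lfloor>real (3 * n) * x\<rfloor> / real n) \<longlonglongrightarrow> 3 * x"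
proof (rule LIM_zero_cancel, rule Lim_null_comparison)
  show "\<forall>\<^sub>F n in sequentially. norm (real_of_int \<lfloor>real (3 * n) * x\<rfloor> / real n - 3 * x) \<le> inverse (real n)"
    using eventually_gt_at_top[of 0]
  proof eventually_elim
    case (elim n)
    have "real_of_int \<lfloor>real (3 * n) * x\<rfloor> / real n - 3 * x = (real_of_int \<lfloor>real (3 * n) * x\<rfloor> - real (3 * n) * x) / real n"
      using elim by (simp add: field_simps)
    also have "\<bar>\<dots>\<bar> \<le> 1 / real n"
      unfolding abs_divide using elim by (intro frac_le) (auto, linarith)
    finally show ?case by (simp add: inverse_eq_divide)
  qed
qed (rule lim_inverse_n)

text \<open>
  The constant term of an affine form disappears in the limit, while the term proportional to \<open>n\<close> survives as the
  constant term of the limiting form on the cube.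
\<close>

lemma affine_form_scaling:
  assumes "\<And>n z. f n z = (\<Sum>i\<in>I. a i * z i) + e * int n + c"
  shows "(\<lambda>n. real_of_int (f n (grid_point I (3 * n) u)) / real n) \<longlonglongrightarrow> (\<Sum>i\<in>I. 3 * real_of_int (a i) * u i) + e"
proof -
  have "(\<lambda>n. (\<Sum>i\<in>I. of_int (a i) * (of_int \<lfloor>real (3 * n) * u i\<rfloor> / real n)) + of_int e + of_int c * inverse (real n))
      \<longlonglongrightarrow> (\<Sum>i\<in>I. of_int (a i) * (3 * u i)) + of_int e + of_int c * 0"
    by (intro tendsto_intros grid_point_scaling lim_inverse_n)
  moreover have "\<forall>\<^sub>F n in sequentially. (\<Sum>i\<in>I. of_int (a i) * (of_int \<lfloor>real (3 * n) * u i\<rfloor> / real n)) + of_int e + of_int c * inverse (real n) =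
      real_of_int (f n (grid_point I (3 * n) u)) / real n"
    using eventually_gt_at_top[of 0]
  proof eventually_elim
    case (elim n)
    have "real_of_int (f n (grid_point I (3 * n) u)) =
        (\<Sum>i\<in>I. of_int (a i) * of_int \<lfloor>real (3 * n) * u i\<rfloor>) + of_int e * real n + of_int c"
      by (simp add: assms grid_point_def)
    then show ?case using elim
      by (simp add: add_divide_distrib sum_divide_distrib inverse_eq_divide)
  qed
  ultimately show ?thesis by (auto simp: mult_ac elim: Lim_transform_eventually)
qed

lemma eventually_nonzero_affine:
  assumes I: "finite I" "i \<in> I" "a i \<noteq> 0" and f: "affine_form I a f"
  shows "AE u in unit_cube I. (\<forall>\<^sub>F n in sequentially. f n (grid_point I (3 * n) u) < 0) \<or>
    (\<forall>\<^sub>F n in sequentially. f n (grid_point I (3 * n) u) > 0)"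
proof -
  obtain e c where ec: "\<And>n z. f n z = (\<Sum>i\<in>I. a i * z i) + e * int n + c"
    using f by (auto simp: affine_form_def)
  have "AE u in unit_cube I. (\<Sum>j\<in>I. 3 * real_of_int (a j) * u j) \<noteq> - real_of_int e"
    using AE_not_on_hyperplane[OF I(1,2), of "\<lambda>j. 3 * real_of_int (a j)"] I(3) by simp
  then show ?thesis
  proof eventually_elim
    case (elim u)
    note lim = affine_form_scaling[OF ec, of u]
    consider "(\<Sum>j\<in>I. 3 * real_of_int (a j) * u j) + e < 0" | "(\<Sum>j\<in>I. 3 * real_of_int (a j) * u j) + e > 0"
      using elim by linarith
    then show ?case
    proof cases
      case 1
      from order_tendstoD(2)[OF lim 1]
      have "\<forall>\<^sub>F n in sequentially. f n (grid_point I (3 * n) u) < 0"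
        by eventually_elim (auto simp: divide_less_0_iff)
      then show ?thesis by blast
    next
      case 2
      from order_tendstoD(1)[OF lim 2]
      have "\<forall>\<^sub>F n in sequentially. f n (grid_point I (3 * n) u) > 0"
        by eventually_elim (auto simp: zero_less_divide_iff)
      then show ?thesis by blast
    qed
  qed
qed

text \<open>
  If some coefficient is nonzero, the limiting form is nonzero almost everywhere and its sign
  decides; otherwise the form does not depend on the point and is an affine function of \<open>n\<close>.
\<close>

lemma eventually_decided_nonpos:
  assumes I: "finite I" and f: "affine_form I a f"
  shows "eventually_decided I (\<lambda>n z. f n z \<le> 0)"
proof (cases "\<exists>i\<in>I. a i \<noteq> 0")
  case True
  then obtain i where "i \<in> I" "a i \<noteq> 0" by blast
  from eventually_nonzero_affine[OF I this f] show ?thesis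
    unfolding eventually_decided_def
  proof eventually_elim
    case (elim u)
    then show ?case
    proof
      assume "\<forall>\<^sub>F n in sequentially. f n (grid_point I (3 * n) u) < 0"
      then have "\<forall>\<^sub>F n in sequentially. f n (grid_point I (3 * n) u) \<le> 0" by eventually_elim simp
      then show ?thesis ..
    next
      assume "\<forall>\<^sub>F n in sequentially. f n (grid_point I (3 * n) u) > 0"
      then have "\<forall>\<^sub>F n in sequentially. \<not> f n (grid_point I (3 * n) u) \<le> 0" by eventually_elim simp
      then show ?thesis ..
    qed
  qed
next
  case False
  obtain e c where "\<And>n z. f n z = (\<Sum>i\<in>I. a i * z i) + e * int n + c"
    using f by (auto simp: affine_form_def)
  with False have f': "\<And>n z. f n z = e * int n + c" by simp
  have "(\<forall>\<^sub>F n in sequentially. e * int n + c \<le> 0) \<or> (\<forall>\<^sub>F n in sequentially. \<not> e * int n + c \<le> 0)"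
  proof (cases e "0 :: int" rule: linorder_cases)
    case less
    have "\<forall>\<^sub>F n in sequentially. e * int n + c \<le> 0"
      using eventually_ge_at_top[of "nat \<bar>c\<bar>"]
    proof eventually_elim
      case (elim n)
      have "e * int n \<le> (- 1) * int n" using less by (intro mult_right_mono) auto
      then show ?case using elim by linarith
    qed
    then show ?thesis by blast
  next
    case greater
    have "\<forall>\<^sub>F n in sequentially. \<not> e * int n + c \<le> 0"
      using eventually_gt_at_top[of "nat \<bar>c\<bar>"]
    proof eventually_elim
      case (elim n)
      have "1 * int n \<le> e * int n" using greater by (intro mult_right_mono) auto
      then show ?case using elim by linarith
    qed
    then show ?thesis by blast
  qed simp
  then show ?thesis by (simp add: eventually_decided_def f')
qed

lemma eventually_decided_const: "eventually_decided I (\<lambda>n z. b)"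
  by (cases b) (simp_all add: eventually_decided_def)

lemma eventually_decided_not:
  assumes "eventually_decided I P" shows "eventually_decided I (\<lambda>n z. \<not> P n z)"
  using assms unfolding eventually_decided_def by eventually_elim auto

lemma eventually_decided_conj:
  assumes "eventually_decided I P" "eventually_decided I Q"
  shows "eventually_decided I (\<lambda>n z. P n z \<and> Q n z)"
  using assms unfolding eventually_decided_def
proof eventually_elim
  case (elim u)
  let ?g = "\<lambda>n. grid_point I (3 * n) u"
  consider "\<forall>\<^sub>F n in sequentially. P n (?g n)" "\<forall>\<^sub>F n in sequentially. Q n (?g n)"
    | "\<forall>\<^sub>F n in sequentially. \<not> P n (?g n)" | "\<forall>\<^sub>F n in sequentially. \<not> Q n (?g n)"
    using elim by blast
  then show ?case
  proof cases
    case 1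
    then show ?thesis by (simp add: eventually_conj_iff)
  next
    case 2
    then have "\<forall>\<^sub>F n in sequentially. \<not> (P n (?g n) \<and> Q n (?g n))" by eventually_elim simp
    then show ?thesis ..
  next
    case 3
    then have "\<forall>\<^sub>F n in sequentially. \<not> (P n (?g n) \<and> Q n (?g n))" by eventually_elim simp
    then show ?thesis ..
  qed
qed

lemma eventually_decided_disj:
  assumes "eventually_decided I P" "eventually_decided I Q"
  shows "eventually_decided I (\<lambda>n z. P n z \<or> Q n z)"
  using eventually_decided_not[OF eventually_decided_conj[OF assms[THEN eventually_decided_not]]] by simp

lemma eventually_decided_ball:
  assumes "finite S" "\<And>s. s \<in> S \<Longrightarrow> eventually_decided I (P s)"
  shows "eventually_decided I (\<lambda>n z. \<forall>s\<in>S. P s n z)"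
  using assms
  by (induction S rule: finite_induct) (auto intro!: eventually_decided_const eventually_decided_conj)

lemma affine_form_diff:
  "affine_form I a f \<Longrightarrow> affine_form I b g \<Longrightarrow> affine_form I (\<lambda>i. a i - b i) (\<lambda>n z. f n z - g n z)"
  unfolding affine_form_def
  by (elim exE, rule_tac x = "e - ea" in exI, rule_tac x = "c - ca" in exI)
     (simp add: algebra_simps sum_subtractf)

lemma affine_form_add:
  "affine_form I a f \<Longrightarrow> affine_form I b g \<Longrightarrow> affine_form I (\<lambda>i. a i + b i) (\<lambda>n z. f n z + g n z)"
  unfolding affine_form_def
  by (elim exE, rule_tac x = "e + ea" in exI, rule_tac x = "c + ca" in exI)
     (simp add: algebra_simps sum.distrib)

lemma affine_form_const: "affine_form I (\<lambda>_. 0) (\<lambda>n z. c)"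
  unfolding affine_form_def by (rule exI[of _ 0], rule exI[of _ c]) simp

lemma affine_form_size: "affine_form I (\<lambda>_. 0) (\<lambda>n z. int n)"
  unfolding affine_form_def by (rule exI[of _ 1], rule exI[of _ 0]) simp

lemma affine_form_coordinate:
  "finite I \<Longrightarrow> i \<in> I \<Longrightarrow> affine_form I (\<lambda>j. if j = i then 1 else 0) (\<lambda>n z. z i)"
  unfolding affine_form_def
  by (rule exI[of _ 0], rule exI[of _ 0]) (simp add: if_distrib[of "\<lambda>x. x * _"] cong: if_cong)

definition grid_affine :: "'i set \<Rightarrow> (nat \<Rightarrow> ('i \<Rightarrow> int) \<Rightarrow> int) \<Rightarrow> bool" where
  "grid_affine I f \<longleftrightarrow> (\<exists>a. affine_form I a f)"

lemma grid_affine_intros: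
  "grid_affine I f \<Longrightarrow> grid_affine I g \<Longrightarrow> grid_affine I (\<lambda>n z. f n z - g n z)"
  "grid_affine I f \<Longrightarrow> grid_affine I g \<Longrightarrow> grid_affine I (\<lambda>n z. f n z + g n z)"
  "grid_affine I (\<lambda>n z. c)" "grid_affine I (\<lambda>n z. int n)"
  "finite I \<Longrightarrow> i \<in> I \<Longrightarrow> grid_affine I (\<lambda>n z. z i)"
  unfolding grid_affine_def
      apply (elim exE, rule exI, erule (1) affine_form_diff)
     apply (elim exE, rule exI, erule (1) affine_form_add)
    apply (rule exI, rule affine_form_const)
   apply (rule exI, rule affine_form_size)
  apply (rule exI, erule (1) affine_form_coordinate)
  done

lemma eventually_decided_le:
  assumes "finite I" "grid_affine I f" "grid_affine I g"
  shows "eventually_decided I (\<lambda>n z. f n z \<le> g n z)"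
proof -
  have "grid_affine I (\<lambda>n z. f n z - g n z)" by (intro grid_affine_intros assms)
  then obtain a where "affine_form I a (\<lambda>n z. f n z - g n z)" by (auto simp: grid_affine_def)
  from eventually_decided_nonpos[OF assms(1) this] show ?thesis by simp
qed

lemma eventually_decided_eq:
  assumes "finite I" "grid_affine I f" "grid_affine I g"
  shows "eventually_decided I (\<lambda>n z. f n z = g n z)"
  unfolding order.eq_iff by (intro eventually_decided_conj eventually_decided_le assms)

text \<open>
  Rounding a uniform point of the cube gives a uniform point of the grid, since the cells have
  equal measure.
\<close>

lemma prob_grid_point:
  assumes I: "finite I" and m: "m > 0"
  shows "{u \<in> space (unit_cube I). Q (grid_point I m u)} \<in> sets (unit_cube I)" (is ?sets)
    and "measure (unit_cube I) {u \<in> space (unit_cube I). Q (grid_point I m u)} =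
      real (card {z \<in> PiE I (\<lambda>_. {0..<int m}). Q z}) / real m ^ card I" (is ?prob)
proof -
  let ?U = "restrict_space lborel {0..<1::real}"
  interpret U: prob_space ?U by (rule prob_space_unit_interval)
  interpret product_sigma_finite "\<lambda>_. ?U" by standard
  interpret C: prob_space "unit_cube I" by (rule prob_space_unit_cube)
  define Z where "Z = PiE I (\<lambda>_. {0..<int m})"
  have Z: "finite Z" unfolding Z_def using I by (intro finite_PiE) auto
  \<comment> \<open>the points of the cube that are rounded to \<open>z\<close>\<close>
  define cell where "cell z = PiE I (\<lambda>i. {of_int (z i) / real m..<(of_int (z i) + 1) / real m})" for z :: "'a \<Rightarrow> int"
  have interval: "{of_int k / real m..<(of_int k + 1) / real m} \<subseteq> {0..<1}" if "k \<in> {0..<int m}" for k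
  proof -
    have "0 \<le> of_int k / real m" using that by simp
    moreover have "(of_int k + 1) / real m \<le> 1" using that m by simp
    ultimately show ?thesis by auto
  qed
  have interval_sets: "{of_int k / real m..<(of_int k + 1) / real m} \<in> sets ?U" if "k \<in> {0..<int m}" for k
    using interval[OF that] by (auto simp: sets_restrict_space image_iff intro!: bexI)
  have cell_sets: "cell z \<in> sets (unit_cube I)" if "z \<in> Z" for z
    unfolding cell_def unit_cube_def using that
    by (intro sets_PiM_I_finite I interval_sets) (auto simp: Z_def)
  have cell_measure: "measure (unit_cube I) (cell z) = (1 / real m) ^ card I" if z: "z \<in> Z" for z
  proof -
    have "emeasure ?U {of_int (z i) / real m..<(of_int (z i) + 1) / real m} = ennreal (1 / real m)" if "i \<in> I" for i
    proof -
      have zi: "z i \<in> {0..<int m}" using that z by (auto simp: Z_def)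
      have "emeasure ?U {of_int (z i) / real m..<(of_int (z i) + 1) / real m} =
          emeasure lborel {of_int (z i) / real m..<(of_int (z i) + 1) / real m}"
        by (rule emeasure_restrict_space) (use interval[OF zi] in auto)
      also have "\<dots> = ennreal ((of_int (z i) + 1) / real m - of_int (z i) / real m)"
        by (rule emeasure_lborel_Ico) (simp add: divide_right_mono)
      finally show ?thesis by (simp add: add_divide_distrib)
    qed
    then have "emeasure (unit_cube I) (cell z) = (\<Prod>i\<in>I. ennreal (1 / real m))"
      unfolding cell_def unit_cube_def using z
      by (subst emeasure_PiM[OF I]) (auto intro!: interval_sets prod.cong simp: Z_def)
    also have "\<dots> = ennreal ((1 / real m) ^ card I)" by (simp add: ennreal_power)
    finally show ?thesis by (simp add: measure_def)
  qed
  have grid_Z: "grid_point I m u \<in> Z" if "u \<in> space (unit_cube I)" for u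
    using that m by (auto simp: Z_def grid_point_def space_unit_cube PiE_iff floor_less_iff)
  have cell_iff: "u \<in> cell z \<longleftrightarrow> u \<in> space (unit_cube I) \<and> grid_point I m u = z" if z: "z \<in> Z" for u z
  proof -
    have *: "x \<in> {of_int k / real m..<(of_int k + 1) / real m} \<longleftrightarrow> \<lfloor>real m * x\<rfloor> = k" for x k
      using m by (auto simp: floor_eq_iff field_simps)
    have "u \<in> cell z \<longleftrightarrow> u \<in> extensional I \<and> (\<forall>i\<in>I. \<lfloor>real m * u i\<rfloor> = z i)"
      unfolding cell_def PiE_iff * by blast
    also have "(\<forall>i\<in>I. \<lfloor>real m * u i\<rfloor> = z i) \<longleftrightarrow> grid_point I m u = z"
      using z by (auto simp: grid_point_def fun_eq_iff Z_def PiE_iff extensional_def restrict_def)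
    finally show ?thesis
      using sets.sets_into_space[OF cell_sets[OF z]] by (auto simp: space_unit_cube PiE_iff)
  qed
  have eq: "{u \<in> space (unit_cube I). Q (grid_point I m u)} = (\<Union>z\<in>{z\<in>Z. Q z}. cell z)"
    using grid_Z cell_iff by auto
  show ?sets unfolding eq using Z cell_sets by (intro sets.finite_UN) auto
  have "measure (unit_cube I) (\<Union>z\<in>{z\<in>Z. Q z}. cell z) = (\<Sum>z\<in>{z\<in>Z. Q z}. measure (unit_cube I) (cell z))"
    using Z cell_sets cell_iff
    by (intro C.finite_measure_finite_Union) (auto simp: disjoint_family_on_def)
  also have "\<dots> = real (card {z\<in>Z. Q z}) * (1 / real m) ^ card I"
    using cell_measure by simp
  finally show ?prob unfolding eq Z_def by (simp add: power_divide)
qed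

text \<open>
  The normalised counts are integrals of indicator functions that converge almost everywhere, so
  dominated convergence applies.
\<close>

lemma grid_count_converges:
  assumes I: "finite I" and P: "eventually_decided I P"
  shows "convergent (\<lambda>n. real (card {z \<in> PiE I (\<lambda>_. {0..<int (3 * n)}). P n z}) / real (3 * n) ^ card I)"
    and "(AE u in unit_cube I. \<forall>\<^sub>F n in sequentially. \<not> P n (grid_point I (3 * n) u)) \<Longrightarrow>
      (\<lambda>n. real (card {z \<in> PiE I (\<lambda>_. {0..<int (3 * n)}). P n z}) / real (3 * n) ^ card I) \<longlonglongrightarrow> 0"
proof -
  interpret C: prob_space "unit_cube I" by (rule prob_space_unit_cube)
  define r where "r n = real (card {z \<in> PiE I (\<lambda>_. {0..<int (3 * n)}). P n z}) / real (3 * n) ^ card I" for n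
  define A where "A n = {u \<in> space (unit_cube I). P (Suc n) (grid_point I (3 * Suc n) u)}" for n
  have A: "A n \<in> sets (unit_cube I)" for n unfolding A_def by (rule prob_grid_point[OF I]) simp
  have r: "r (Suc n) = (LINT u|unit_cube I. indicator (A n) u)" for n
    using prob_grid_point(2)[OF I, of "3 * Suc n" "P (Suc n)"] A by (simp add: r_def A_def)
  define g where "g u = lim (\<lambda>n. indicator (A n) u :: real)" for u
  have g: "g \<in> borel_measurable (unit_cube I)"
    unfolding g_def using A by (intro borel_measurable_lim_metric) auto
  have "AE u in unit_cube I. (\<lambda>n. indicator (A n) u :: real) \<longlonglongrightarrow> g u"
    using P[unfolded eventually_decided_def] AE_space
  proof eventually_elim
    case (elim u)
    from elim(1) have "(\<lambda>n. indicator (A n) u :: real) \<longlonglongrightarrow> 1 \<or> (\<lambda>n. indicator (A n) u :: real) \<longlonglongrightarrow> 0"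
    proof
      assume "\<forall>\<^sub>F n in sequentially. P n (grid_point I (3 * n) u)"
      then have "\<forall>\<^sub>F n in sequentially. P (Suc n) (grid_point I (3 * Suc n) u)"
        by (rule eventually_sequentially_Suc[of "\<lambda>n. P n (grid_point I (3 * n) u)", THEN iffD2])
      then have "\<forall>\<^sub>F n in sequentially. indicator (A n) u = (1 :: real)"
        by eventually_elim (use elim(2) in \<open>simp add: A_def\<close>)
      then show ?thesis by (intro disjI1 tendsto_eventually)
    next
      assume "\<forall>\<^sub>F n in sequentially. \<not> P n (grid_point I (3 * n) u)"
      then have "\<forall>\<^sub>F n in sequentially. \<not> P (Suc n) (grid_point I (3 * Suc n) u)"
        by (rule eventually_sequentially_Suc[of "\<lambda>n. \<not> P n (grid_point I (3 * n) u)", THEN iffD2])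
      then have "\<forall>\<^sub>F n in sequentially. indicator (A n) u = (0 :: real)"
        by eventually_elim (use elim(2) in \<open>simp add: A_def\<close>)
      then show ?thesis by (intro disjI2 tendsto_eventually)
    qed
    then have "convergent (\<lambda>n. indicator (A n) u :: real)" by (auto simp: convergent_def)
    then show ?case unfolding g_def by (simp add: convergent_LIMSEQ_iff)
  qed
  note lim = this
  have dct: "(\<lambda>n. r (Suc n)) \<longlonglongrightarrow> (LINT u|unit_cube I. g u)"
    unfolding r
    by (rule integral_dominated_convergence[where w = "\<lambda>_. 1"]) (use g lim A in auto)
  then have conv: "r \<longlonglongrightarrow> (LINT u|unit_cube I. g u)" by (simp add: filterlim_sequentially_Suc)
  then show "convergent (\<lambda>n. real (card {z \<in> PiE I (\<lambda>_. {0..<int (3 * n)}). P n z}) / real (3 * n) ^ card I)"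
    unfolding r_def by (rule convergentI)
  assume "AE u in unit_cube I. \<forall>\<^sub>F n in sequentially. \<not> P n (grid_point I (3 * n) u)"
  then have "AE u in unit_cube I. g u = 0"
    using lim AE_space
  proof eventually_elim
    case (elim u)
    from elim(1) have "\<forall>\<^sub>F n in sequentially. \<not> P (Suc n) (grid_point I (3 * Suc n) u)"
      by (rule eventually_sequentially_Suc[of "\<lambda>n. \<not> P n (grid_point I (3 * n) u)", THEN iffD2])
    then have "\<forall>\<^sub>F n in sequentially. indicator (A n) u = (0 :: real)"
      by eventually_elim (use elim(3) in \<open>simp add: A_def\<close>)
    then have "(\<lambda>n. indicator (A n) u :: real) \<longlonglongrightarrow> 0" by (rule tendsto_eventually)
    then show ?case using elim(2) by (rule LIMSEQ_unique[symmetric])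
  qed
  then have "(LINT u|unit_cube I. g u) = 0" by (rule integral_eq_zero_AE)
  with conv show "(\<lambda>n. real (card {z \<in> PiE I (\<lambda>_. {0..<int (3 * n)}). P n z}) / real (3 * n) ^ card I) \<longlonglongrightarrow> 0"
    unfolding r_def by simp
qed

section \<open>Closed walks with prescribed coincidences of link values\<close>

fun int_link :: "matrix_pattern \<Rightarrow> int \<Rightarrow> int \<Rightarrow> int \<Rightarrow> int" where
  "int_link Hankel n p q = p + q"
| "int_link Toeplitz n p q = \<bar>p - q\<bar>"
| "int_link Sym_Circulant n p q = min \<bar>p - q\<bar> (n - \<bar>p - q\<bar>)"

text \<open>
  For symmetric Toeplitz and circulant matrices the link value determines the step from \<open>p\<close> to \<open>q\<close>
  only up to its direction and, in the circulant case, up to whether it equals \<open>\<bar>p - q\<bar>\<close> or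
  \<open>n - \<bar>p - q\<bar>\<close>. These two bits are recorded.
\<close>

definition step_code :: "int \<Rightarrow> int \<Rightarrow> int \<Rightarrow> bool \<times> bool" where
  "step_code n p q = (p \<le> q, 2 * \<bar>p - q\<bar> \<le> n)"

fun next_vertex :: "matrix_pattern \<Rightarrow> int \<Rightarrow> bool \<times> bool \<Rightarrow> int \<Rightarrow> int \<Rightarrow> int" where
  "next_vertex Hankel n c p d = d - p"
| "next_vertex Toeplitz n c p d = (if fst c then p + d else p - d)"
| "next_vertex Sym_Circulant n c p d =
     (if fst c then p + (if snd c then d else n - d) else p - (if snd c then d else n - d))"

lemma int_link_eq:
  assumes "i \<in> {1..n}" "j \<in> {1..n}"
  shows "int (link L n i j) = int_link L (int n) (int i) (int j)"
proof (cases L)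
  case Sym_Circulant
  define d where "d = \<bar>int i - int j\<bar>"
  have d: "real_of_int d = \<bar>real i - real j\<bar>" by (simp add: d_def)
  have "real_of_int (int (link Sym_Circulant n i j)) = real n / 2 - \<bar>real n / 2 - real_of_int d\<bar>"
    using link_Sym_Circulant[OF assms] by (simp only: d of_int_of_nat_eq)
  also have "\<dots> = real_of_int (min d (int n - d))" by (auto simp: min_def abs_if field_simps)
  finally have "int (link Sym_Circulant n i j) = min d (int n - d)" by (simp only: of_int_eq_iff)
  then show ?thesis by (simp only: Sym_Circulant int_link.simps d_def)
qed auto

lemma int_link_range:
  assumes "p \<in> {1..n}" "q \<in> {1..n}"
  shows "int_link L n p q \<in> {0..2 * n}"
  using assms by (cases L) auto

lemma next_vertex_step_code:
  assumes "p \<in> {1..n}" "q \<in> {1..n}"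
  shows "next_vertex L n (step_code n p q) p (int_link L n p q) = q"
  using assms by (cases L) (auto simp: step_code_def min_def abs_if)

definition block_of :: "nat set set \<Rightarrow> nat \<Rightarrow> nat set" where
  "block_of \<sigma> t = (THE V. V \<in> \<sigma> \<and> t \<in> V)"

lemma block_of_eq:
  assumes "partition_on S \<sigma>" "V \<in> \<sigma>" "t \<in> V"
  shows "block_of \<sigma> t = V"
  unfolding block_of_def
  by (rule the_equality) (use assms partition_onD2[OF assms(1)] in \<open>auto simp: disjoint_def\<close>)

lemma block_of_in:
  assumes "partition_on S \<sigma>" "t \<in> S"
  shows "block_of \<sigma> t \<in> \<sigma>" "t \<in> block_of \<sigma> t"
proof -
  obtain V where "V \<in> \<sigma>" "t \<in> V" using assms partition_onD1 by blast
  then show "block_of \<sigma> t \<in> \<sigma>" "t \<in> block_of \<sigma> t" using block_of_eq[OF assms(1)] by auto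
qed

text \<open>
  The coordinate \<open>{}\<close>, which is never a block of a partition, holds the starting vertex.
\<close>

primrec walk :: "matrix_pattern \<Rightarrow> nat set set \<Rightarrow> (nat \<Rightarrow> bool \<times> bool) \<Rightarrow> nat \<Rightarrow> (nat set \<Rightarrow> int) \<Rightarrow> nat \<Rightarrow> int" where
  "walk L \<sigma> \<gamma> n z 0 = z {}"
| "walk L \<sigma> \<gamma> n z (Suc t) =
     next_vertex L (int n) (\<gamma> (Suc t)) (walk L \<sigma> \<gamma> n z t) (z (block_of \<sigma> (Suc t)))"

text \<open>
  Requiring the word \<open>\<gamma>\<close> to be the actual code of the steps makes the parametrisation injective:
  otherwise different words would describe the same walk, for instance if a step has length \<open>0\<close>.
\<close>

definition valid_parameters ::
    "matrix_pattern \<Rightarrow> nat set set \<Rightarrow> nat \<Rightarrow> (nat \<Rightarrow> bool \<times> bool) \<Rightarrow> nat \<Rightarrow> (nat set \<Rightarrow> int) \<Rightarrow> bool" where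
  "valid_parameters L \<sigma> k \<gamma> n z \<longleftrightarrow> (let w = walk L \<sigma> \<gamma> n z in
     (\<forall>t\<in>{0..k}. 1 \<le> w t \<and> w t \<le> int n) \<and> w k = w 0 \<and>
     (\<forall>t\<in>{1..k}. w (t - 1) + w t \<le> int n + 1 \<and>
        int_link L (int n) (w (t - 1)) (w t) = z (block_of \<sigma> t) \<and>
        step_code (int n) (w (t - 1)) (w t) = \<gamma> t) \<and>
     (\<forall>V\<in>\<sigma>. \<forall>W\<in>\<sigma>. V \<noteq> W \<longrightarrow> z V \<noteq> z W))"

definition kernel_paths :: "matrix_pattern \<Rightarrow> nat set set \<Rightarrow> nat \<Rightarrow> nat \<Rightarrow> (nat \<Rightarrow> nat) set" where
  "kernel_paths L \<sigma> k n = {\<pi> \<in> PiE {0..k} (\<lambda>_. {1..n}). \<pi> 0 = \<pi> k \<and>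
     (\<forall>t\<in>{1..k}. \<pi> (t - 1) + \<pi> t \<le> n + 1) \<and>
     (\<forall>s\<in>{1..k}. \<forall>t\<in>{1..k}. link L n (\<pi> (s - 1)) (\<pi> s) = link L n (\<pi> (t - 1)) (\<pi> t) \<longleftrightarrow>
        block_of \<sigma> s = block_of \<sigma> t)}"

abbreviation walk_index :: "nat set set \<Rightarrow> nat set set" where
  "walk_index \<sigma> \<equiv> insert {} \<sigma>"

text \<open>
  The coefficients of \<open>p\<close> and \<open>d\<close> are \<open>1\<close> or \<open>-1\<close> in all three patterns. Modulo \<open>2\<close> the signs are irrelevant,
  and this is all that is needed to detect odd blocks.
\<close>

lemma next_vertex_affine:
  assumes p: "affine_form I a p" and d: "affine_form I b d"
  shows "\<exists>a'. affine_form I a' (\<lambda>n z. next_vertex L (int n) c (p n z) (d n z)) \<and>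
    (\<forall>i. even (a' i) \<longleftrightarrow> even (a i + b i))"
proof -
  note minus = affine_form_diff[OF p d]
  note plus = affine_form_add[OF p d]
  note rev = affine_form_diff[OF affine_form_size d]
  show ?thesis
  proof (cases L)
    case Hankel
    then show ?thesis using affine_form_diff[OF d p] by (intro exI[of _ "\<lambda>i. b i - a i"]) auto
  next
    case Toeplitz
    then show ?thesis
      using minus plus
      by (cases "fst c") (auto intro!: exI[of _ "\<lambda>i. if fst c then a i + b i else a i - b i"])
  next
    case Sym_Circulant
    show ?thesis
      by (rule exI[of _ "\<lambda>i. if fst c then (if snd c then a i + b i else a i + (0 - b i))
          else (if snd c then a i - b i else a i - (0 - b i))"])
         (use plus minus affine_form_add[OF p rev] affine_form_diff[OF p rev] in
            \<open>cases "fst c"; cases "snd c"; simp add: Sym_Circulant\<close>)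
  qed
qed

text \<open>
  Each step in the block \<open>V\<close> changes the parity of the coefficient of the variable of \<open>V\<close> exactly
  once.
\<close>

lemma walk_affine:
  assumes \<sigma>: "partition_on {1..k} \<sigma>" "finite \<sigma>" and t: "t \<le> k"
  shows "\<exists>a. affine_form (walk_index \<sigma>) a (\<lambda>n z. walk L \<sigma> \<gamma> n z t) \<and>
    (\<forall>V\<in>\<sigma>. odd (a V) \<longleftrightarrow> odd (card {s\<in>{1..t}. block_of \<sigma> s = V}))"
  using t
proof (induction t)
  case 0
  have "{} \<notin> \<sigma>" using \<sigma>(1) by (rule partition_onD3)
  moreover have "affine_form (walk_index \<sigma>) (\<lambda>j. if j = {} then 1 else 0) (\<lambda>n z. z {})"
    using \<sigma> by (intro affine_form_coordinate) auto
  ultimately show ?case by (intro exI[of _ "\<lambda>j. if j = {} then 1 else 0"]) auto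
next
  case (Suc t)
  then obtain a where a: "affine_form (walk_index \<sigma>) a (\<lambda>n z. walk L \<sigma> \<gamma> n z t)"
    "\<And>V. V \<in> \<sigma> \<Longrightarrow> odd (a V) \<longleftrightarrow> odd (card {s\<in>{1..t}. block_of \<sigma> s = V})" by auto
  let ?B = "block_of \<sigma> (Suc t)"
  have B: "?B \<in> \<sigma>" using block_of_in[OF \<sigma>(1), of "Suc t"] Suc.prems by simp
  have coord: "affine_form (walk_index \<sigma>) (\<lambda>j. if j = ?B then 1 else 0) (\<lambda>n z. z ?B)"
    using \<sigma> B by (intro affine_form_coordinate) auto
  obtain a' where a': "affine_form (walk_index \<sigma>) a' (\<lambda>n z. walk L \<sigma> \<gamma> n z (Suc t))"
    "\<And>i. even (a' i) \<longleftrightarrow> even (a i + (if i = ?B then 1 else 0))"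
    using next_vertex_affine[OF a(1) coord, of L "\<gamma> (Suc t)"] by auto
  have "odd (a' V) \<longleftrightarrow> odd (card {s\<in>{1..Suc t}. block_of \<sigma> s = V})" if "V \<in> \<sigma>" for V
  proof (cases "V = ?B")
    case True
    have "{s\<in>{1..Suc t}. block_of \<sigma> s = V} = insert (Suc t) {s\<in>{1..t}. block_of \<sigma> s = V}"
      using True by auto
    then have "card {s\<in>{1..Suc t}. block_of \<sigma> s = V} = Suc (card {s\<in>{1..t}. block_of \<sigma> s = V})"
      by simp
    then show ?thesis using a'(2)[of V] a(2)[OF that] True by simp
  next
    case False
    have "{s\<in>{1..Suc t}. block_of \<sigma> s = V} = {s\<in>{1..t}. block_of \<sigma> s = V}"
      using False by (auto simp: le_Suc_eq)
    then show ?thesis using a'(2)[of V] a(2)[OF that] False by simp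
  qed
  then show ?case using a'(1) by blast
qed

lemma eventually_decided_iff_const:
  "eventually_decided I P \<Longrightarrow> eventually_decided I (\<lambda>n z. P n z \<longleftrightarrow> b)"
  by (cases b) (simp_all add: eventually_decided_not)

text \<open>
  The absolute value and the minimum are resolved into a case distinction between affine inequalities.
\<close>

lemma eventually_decided_int_link:
  assumes I: "finite I" and p: "grid_affine I p" and q: "grid_affine I q" and d: "grid_affine I d"
  shows "eventually_decided I (\<lambda>n z. int_link L (int n) (p n z) (q n z) = d n z)"
proof (cases L)
  case Hankel
  then show ?thesis by simp (intro eventually_decided_eq grid_affine_intros assms)
next
  case Toeplitz
  have "\<bar>x - y\<bar> = w \<longleftrightarrow> (x \<le> y \<and> y - x = w) \<or> (y \<le> x \<and> x - y = w)" for x y w :: int by auto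
  then show ?thesis unfolding Toeplitz int_link.simps
    by (simp only:) (intro eventually_decided_eq eventually_decided_le eventually_decided_disj
        eventually_decided_conj grid_affine_intros assms)
next
  case Sym_Circulant
  have "min \<bar>x - y\<bar> (m - \<bar>x - y\<bar>) = w \<longleftrightarrow>
      (x \<le> y \<and> (((y - x) + (y - x) \<le> m \<and> y - x = w) \<or> (m \<le> (y - x) + (y - x) \<and> m - (y - x) = w))) \<or>
      (y \<le> x \<and> (((x - y) + (x - y) \<le> m \<and> x - y = w) \<or> (m \<le> (x - y) + (x - y) \<and> m - (x - y) = w)))"
    for x y w m :: int by auto
  then show ?thesis unfolding Sym_Circulant int_link.simps
    by (simp only:) (intro eventually_decided_eq eventually_decided_le eventually_decided_disj
        eventually_decided_conj grid_affine_intros assms)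
qed

lemma eventually_decided_step_code:
  assumes I: "finite I" and p: "grid_affine I p" and q: "grid_affine I q"
  shows "eventually_decided I (\<lambda>n z. step_code (int n) (p n z) (q n z) = c)"
proof -
  have *: "2 * \<bar>x - y\<bar> \<le> m \<longleftrightarrow> (x - y) + (x - y) \<le> m \<and> (y - x) + (y - x) \<le> m" for m x y :: int
    by (cases "x \<le> y") (auto simp: abs_if)
  have "step_code m x y = c \<longleftrightarrow> ((x \<le> y) \<longleftrightarrow> fst c) \<and>
      (((x - y) + (x - y) \<le> m \<and> (y - x) + (y - x) \<le> m) \<longleftrightarrow> snd c)" for m x y
    unfolding step_code_def * by (cases c) simp
  then show ?thesis
    by (simp only:) (intro eventually_decided_conj eventually_decided_iff_const eventually_decided_le
        grid_affine_intros assms)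
qed

lemma eventually_decided_valid:
  assumes \<sigma>: "partition_on {1..k} \<sigma>" "finite \<sigma>"
  shows "eventually_decided (walk_index \<sigma>) (valid_parameters L \<sigma> k \<gamma>)"
proof -
  have fin: "finite (walk_index \<sigma>)" using \<sigma> by simp
  have w: "grid_affine (walk_index \<sigma>) (\<lambda>n z. walk L \<sigma> \<gamma> n z t)" if "t \<in> {0..k}" for t
    using walk_affine[OF \<sigma>, of t L \<gamma>] that by (auto simp: grid_affine_def)
  have w': "grid_affine (walk_index \<sigma>) (\<lambda>n z. walk L \<sigma> \<gamma> n z t)"
      "grid_affine (walk_index \<sigma>) (\<lambda>n z. walk L \<sigma> \<gamma> n z (t - 1))" if "t \<in> {1..k}" for t
    using w[of t] w[of "t - 1"] that by auto
  have coord: "grid_affine (walk_index \<sigma>) (\<lambda>n z. z (block_of \<sigma> t))" if "t \<in> {1..k}" for t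
    by (rule grid_affine_intros(5)[OF fin]) (use block_of_in[OF \<sigma>(1) that] in simp)
  have w0: "grid_affine (walk_index \<sigma>) (\<lambda>n z. walk L \<sigma> \<gamma> n z 0)" "grid_affine (walk_index \<sigma>) (\<lambda>n z. walk L \<sigma> \<gamma> n z k)"
    using w[of 0] w[of k] by simp_all
  have distinct: "eventually_decided (walk_index \<sigma>) (\<lambda>n z. V \<noteq> W \<longrightarrow> z V \<noteq> z W)" if "V \<in> \<sigma>" "W \<in> \<sigma>" for V W
    using that fin
    by (cases "V = W")
       (auto intro!: eventually_decided_const eventually_decided_not eventually_decided_eq grid_affine_intros)
  have "eventually_decided (walk_index \<sigma>) (\<lambda>n z.
     (\<forall>t\<in>{0..k}. 1 \<le> walk L \<sigma> \<gamma> n z t \<and> walk L \<sigma> \<gamma> n z t \<le> int n) \<and> walk L \<sigma> \<gamma> n z k = walk L \<sigma> \<gamma> n z 0 \<and>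
     (\<forall>t\<in>{1..k}. walk L \<sigma> \<gamma> n z (t - 1) + walk L \<sigma> \<gamma> n z t \<le> int n + 1 \<and>
        int_link L (int n) (walk L \<sigma> \<gamma> n z (t - 1)) (walk L \<sigma> \<gamma> n z t) = z (block_of \<sigma> t) \<and>
        step_code (int n) (walk L \<sigma> \<gamma> n z (t - 1)) (walk L \<sigma> \<gamma> n z t) = \<gamma> t) \<and>
     (\<forall>V\<in>\<sigma>. \<forall>W\<in>\<sigma>. V \<noteq> W \<longrightarrow> z V \<noteq> z W))"
    by (intro eventually_decided_conj eventually_decided_ball eventually_decided_le eventually_decided_eq
        eventually_decided_int_link eventually_decided_step_code grid_affine_intros(2-4) distinct w w' coord w0 fin \<sigma> finite_atLeastAtMost)
  then show ?thesis by (simp add: valid_parameters_def[abs_def] Let_def)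
qed

text \<open>
  In the equation that closes the walk, the variable of the odd block has an odd, hence nonzero,
  coefficient.
\<close>

lemma odd_block_not_valid:
  assumes \<sigma>: "partition_on {1..k} \<sigma>" "finite \<sigma>" and V: "V \<in> \<sigma>" "odd (card V)"
  shows "AE u in unit_cube (walk_index \<sigma>).
    \<forall>\<^sub>F n in sequentially. \<not> valid_parameters L \<sigma> k \<gamma> n (grid_point (walk_index \<sigma>) (3 * n) u)"
proof -
  have "{s\<in>{1..k}. block_of \<sigma> s = V} = V"
  proof (intro equalityI subsetI)
    fix s assume "s \<in> {s\<in>{1..k}. block_of \<sigma> s = V}"
    then show "s \<in> V" using block_of_in(2)[OF \<sigma>(1), of s] by simp
  next
    fix s assume s: "s \<in> V"
    then have "s \<in> {1..k}" using V(1) partition_onD1[OF \<sigma>(1)] by blast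
    then show "s \<in> {s\<in>{1..k}. block_of \<sigma> s = V}" using block_of_eq[OF \<sigma>(1) V(1) s] by simp
  qed
  then obtain a where a: "affine_form (walk_index \<sigma>) a (\<lambda>n z. walk L \<sigma> \<gamma> n z k)" "odd (a V)"
    using walk_affine[OF \<sigma>, of k L \<gamma>] V by auto
  have start: "affine_form (walk_index \<sigma>) (\<lambda>j. if j = {} then 1 else 0) (\<lambda>n z. walk L \<sigma> \<gamma> n z 0)"
    using affine_form_coordinate[of "walk_index \<sigma>" "{}"] \<sigma> by simp
  have "V \<noteq> {}" using V partition_onD3[OF \<sigma>(1)] by auto
  then have "a V - (if V = {} then 1 else 0) \<noteq> 0" using a(2) by auto
  from eventually_nonzero_affine[OF _ _ this affine_form_diff[OF a(1) start]] \<sigma> V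
  have "AE u in unit_cube (walk_index \<sigma>).
      (\<forall>\<^sub>F n in sequentially. walk L \<sigma> \<gamma> n (grid_point (walk_index \<sigma>) (3 * n) u) k -
         walk L \<sigma> \<gamma> n (grid_point (walk_index \<sigma>) (3 * n) u) 0 < 0) \<or>
      (\<forall>\<^sub>F n in sequentially. walk L \<sigma> \<gamma> n (grid_point (walk_index \<sigma>) (3 * n) u) k -
         walk L \<sigma> \<gamma> n (grid_point (walk_index \<sigma>) (3 * n) u) 0 > 0)"
    by simp
  then show ?thesis
  proof eventually_elim
    case (elim u)
    then show ?case
    proof
      assume "\<forall>\<^sub>F n in sequentially. walk L \<sigma> \<gamma> n (grid_point (walk_index \<sigma>) (3 * n) u) k -
         walk L \<sigma> \<gamma> n (grid_point (walk_index \<sigma>) (3 * n) u) 0 < 0"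
      then show ?thesis by eventually_elim (auto simp: valid_parameters_def Let_def)
    next
      assume "\<forall>\<^sub>F n in sequentially. walk L \<sigma> \<gamma> n (grid_point (walk_index \<sigma>) (3 * n) u) k -
         walk L \<sigma> \<gamma> n (grid_point (walk_index \<sigma>) (3 * n) u) 0 > 0"
      then show ?thesis by eventually_elim (auto simp: valid_parameters_def Let_def)
    qed
  qed
qed

text \<open>
  A walk corresponds to the word of its step codes together with its starting vertex and the link
  value on each block; conversely the walk is rebuilt step by step from these data.
\<close>

lemma card_kernel_paths:
  assumes \<sigma>: "partition_on {1..k} \<sigma>" "finite \<sigma>" and n: "n > 0"
  shows "card (kernel_paths L \<sigma> k n) = (\<Sum>\<gamma>\<in>PiE {1..k} (\<lambda>_. UNIV).
    card {z \<in> PiE (walk_index \<sigma>) (\<lambda>_. {0..<int (3 * n)}). valid_parameters L \<sigma> k \<gamma> n z})"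
proof -
  define I where "I = walk_index \<sigma>"
  have fin: "finite I" using \<sigma> by (simp add: I_def)
  have empty: "{} \<notin> \<sigma>" using \<sigma>(1) by (rule partition_onD3)
  have block: "block_of \<sigma> t \<in> \<sigma>" "t \<in> block_of \<sigma> t" if "t \<in> {1..k}" for t
    using block_of_in[OF \<sigma>(1) that] by auto
  have pick: "(SOME t. t \<in> V) \<in> V" "(SOME t. t \<in> V) \<in> {1..k}" "block_of \<sigma> (SOME t. t \<in> V) = V" if "V \<in> \<sigma>" for V
  proof -
    have "\<exists>t. t \<in> V" using that empty by (metis all_not_in_conv)
    then show *: "(SOME t. t \<in> V) \<in> V" by (rule someI_ex)
    then show "(SOME t. t \<in> V) \<in> {1..k}" using partition_onD1[OF \<sigma>(1)] that by blast
    show "block_of \<sigma> (SOME t. t \<in> V) = V" using block_of_eq[OF \<sigma>(1) that *] .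
  qed
  define Z where "Z \<gamma> = {z \<in> PiE I (\<lambda>_. {0..<int (3 * n)}). valid_parameters L \<sigma> k \<gamma> n z}" for \<gamma>
  define \<Gamma> where "\<Gamma> = PiE {1..k} (\<lambda>_. UNIV :: (bool \<times> bool) set)"
  define to_path where "to_path = (\<lambda>(\<gamma>, z). \<lambda>t\<in>{0..k}. nat (walk L \<sigma> \<gamma> n z t))"
  define code where "code \<pi> = (\<lambda>t\<in>{1..k}. step_code (int n) (int (\<pi> (t - 1))) (int (\<pi> t)))" for \<pi> :: "nat \<Rightarrow> nat"
  define lnk where "lnk \<pi> t = int_link L (int n) (int (\<pi> (t - 1))) (int (\<pi> t))" for \<pi> :: "nat \<Rightarrow> nat" and t
  \<comment> \<open>the link value is the same on all of \<open>V\<close>, so the choice of \<open>t\<close> does not matter\<close>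
  define coord where "coord \<pi> = (\<lambda>V\<in>I. if V = {} then int (\<pi> 0) else lnk \<pi> (SOME t. t \<in> V))" for \<pi>
  have "bij_betw to_path (Sigma \<Gamma> Z) (kernel_paths L \<sigma> k n)"
  proof (rule bij_betw_byWitness[where f' = "\<lambda>\<pi>. (code \<pi>, coord \<pi>)"])
    have path: "to_path (\<gamma>, z) \<in> kernel_paths L \<sigma> k n \<and> code (to_path (\<gamma>, z)) = \<gamma> \<and> coord (to_path (\<gamma>, z)) = z"
      if \<gamma>: "\<gamma> \<in> \<Gamma>" and z: "z \<in> Z \<gamma>" for \<gamma> z
    proof -
      define w where "w = walk L \<sigma> \<gamma> n z"
      have v: "\<And>t. t \<in> {0..k} \<Longrightarrow> 1 \<le> w t \<and> w t \<le> int n" "w k = w 0"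
        "\<And>t. t \<in> {1..k} \<Longrightarrow> w (t - 1) + w t \<le> int n + 1"
        "\<And>t. t \<in> {1..k} \<Longrightarrow> int_link L (int n) (w (t - 1)) (w t) = z (block_of \<sigma> t)"
        "\<And>t. t \<in> {1..k} \<Longrightarrow> step_code (int n) (w (t - 1)) (w t) = \<gamma> t"
        "\<And>V W. V \<in> \<sigma> \<Longrightarrow> W \<in> \<sigma> \<Longrightarrow> V \<noteq> W \<Longrightarrow> z V \<noteq> z W"
        using z unfolding Z_def valid_parameters_def Let_def w_def by auto
      define \<pi> where "\<pi> = to_path (\<gamma>, z)"
      have \<pi>_eq: "\<pi> t = nat (w t)" if "t \<in> {0..k}" for t using that by (simp add: \<pi>_def to_path_def w_def)
      have \<pi>: "int (\<pi> t) = w t" "\<pi> t \<in> {1..n}" if "t \<in> {0..k}" for t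
        using v(1)[OF that] \<pi>_eq[OF that] by auto
      have pred: "t - 1 \<in> {0..k}" "t \<in> {0..k}" if "t \<in> {1..k}" for t using that by auto
      have lnk_z: "lnk \<pi> t = z (block_of \<sigma> t)" if "t \<in> {1..k}" for t
        using v(4)[OF that] \<pi>(1) pred[OF that] by (simp add: lnk_def)
      have link: "int (link L n (\<pi> (t - 1)) (\<pi> t)) = z (block_of \<sigma> t)" if "t \<in> {1..k}" for t
        using int_link_eq[OF \<pi>(2) \<pi>(2)] pred[OF that] lnk_z[OF that] by (simp add: lnk_def)
      have "\<pi> \<in> kernel_paths L \<sigma> k n"
        unfolding kernel_paths_def
      proof (intro CollectI conjI ballI)
        show "\<pi> \<in> PiE {0..k} (\<lambda>_. {1..n})" using \<pi>(2) by (auto simp: \<pi>_def to_path_def)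
        show "\<pi> 0 = \<pi> k" using v(2) \<pi>_eq by simp
        show "\<pi> (t - 1) + \<pi> t \<le> n + 1" if "t \<in> {1..k}" for t
          using v(3)[OF that] \<pi>(1)[OF pred(1)[OF that]] \<pi>(1)[OF pred(2)[OF that]] by linarith
        show "link L n (\<pi> (s - 1)) (\<pi> s) = link L n (\<pi> (t - 1)) (\<pi> t) \<longleftrightarrow> block_of \<sigma> s = block_of \<sigma> t"
          if st: "s \<in> {1..k}" "t \<in> {1..k}" for s t
          using link[OF st(1)] link[OF st(2)] v(6)[OF block(1)[OF st(1)] block(1)[OF st(2)]]
          by (metis of_nat_eq_iff)
      qed
      moreover have "code \<pi> = \<gamma>"
      proof
        fix t show "code \<pi> t = \<gamma> t"
          using v(5)[of t] \<pi>(1) pred[of t] \<gamma> by (cases "t \<in> {1..k}") (auto simp: code_def \<Gamma>_def PiE_def extensional_def)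
      qed
      moreover have "coord \<pi> = z"
      proof
        fix V
        have "z V = undefined" if "V \<notin> I" using that z by (auto simp: Z_def PiE_def extensional_def)
        moreover have "lnk \<pi> (SOME t. t \<in> V) = z V" if "V \<in> \<sigma>"
          using lnk_z[OF pick(2)[OF that]] pick(3)[OF that] by simp
        moreover have "int (\<pi> 0) = z {}" using \<pi>(1)[of 0] by (simp add: w_def)
        ultimately show "coord \<pi> V = z V" by (auto simp: coord_def I_def)
      qed
      ultimately show ?thesis by (simp add: \<pi>_def)
    qed
    show "\<forall>a\<in>Sigma \<Gamma> Z. (code (to_path a), coord (to_path a)) = a" using path by auto
    show "to_path ` Sigma \<Gamma> Z \<subseteq> kernel_paths L \<sigma> k n" using path by auto
    have params: "(code \<pi>, coord \<pi>) \<in> Sigma \<Gamma> Z \<and> to_path (code \<pi>, coord \<pi>) = \<pi>"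
      if \<pi>: "\<pi> \<in> kernel_paths L \<sigma> k n" for \<pi>
    proof -
      have p: "\<pi> \<in> PiE {0..k} (\<lambda>_. {1..n})" "\<And>t. t \<in> {0..k} \<Longrightarrow> \<pi> t \<in> {1..n}" "\<pi> 0 = \<pi> k"
          "\<And>t. t \<in> {1..k} \<Longrightarrow> \<pi> (t - 1) + \<pi> t \<le> n + 1"
          "\<And>s t. s \<in> {1..k} \<Longrightarrow> t \<in> {1..k} \<Longrightarrow>
             link L n (\<pi> (s - 1)) (\<pi> s) = link L n (\<pi> (t - 1)) (\<pi> t) \<longleftrightarrow> block_of \<sigma> s = block_of \<sigma> t"
        using \<pi> by (auto simp: kernel_paths_def)
      have pred: "t - 1 \<in> {0..k}" "t \<in> {0..k}" if "t \<in> {1..k}" for t using that by auto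
      have link: "int (link L n (\<pi> (t - 1)) (\<pi> t)) = lnk \<pi> t" if "t \<in> {1..k}" for t
        unfolding lnk_def using pred[OF that] by (intro int_link_eq p(2))
      have lnk_iff: "lnk \<pi> s = lnk \<pi> t \<longleftrightarrow> block_of \<sigma> s = block_of \<sigma> t" if "s \<in> {1..k}" "t \<in> {1..k}" for s t
        using p(5)[OF that] link[OF that(1)] link[OF that(2)] by (metis of_nat_eq_iff)
      have coord_block: "coord \<pi> (block_of \<sigma> t) = lnk \<pi> t" if "t \<in> {1..k}" for t
      proof -
        have B: "block_of \<sigma> t \<in> \<sigma>" using block that by blast
        then have "coord \<pi> (block_of \<sigma> t) = lnk \<pi> (SOME s. s \<in> block_of \<sigma> t)"
          using empty by (auto simp: coord_def I_def)
        also have "\<dots> = lnk \<pi> t"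
          using lnk_iff[OF pick(2)[OF B] that] pick(3)[OF B] by simp
        finally show ?thesis .
      qed
      have walk: "walk L \<sigma> (code \<pi>) n (coord \<pi>) t = int (\<pi> t)" if "t \<le> k" for t
        using that
      proof (induction t)
        case 0
        then show ?case by (simp add: coord_def I_def)
      next
        case (Suc t)
        have "int (\<pi> t) \<in> {1..int n}" "int (\<pi> (Suc t)) \<in> {1..int n}"
          using p(2)[of t] p(2)[of "Suc t"] Suc.prems by auto
        from next_vertex_step_code[OF this, of L] show ?case
          using Suc coord_block[of "Suc t"] by (simp add: code_def lnk_def)
      qed
      have "code \<pi> \<in> \<Gamma>" by (auto simp: code_def \<Gamma>_def)
      moreover have "coord \<pi> \<in> PiE I (\<lambda>_. {0..<int (3 * n)})"
      proof -
        have "lnk \<pi> t \<in> {0..<int (3 * n)}" if "t \<in> {1..k}" for t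
        proof -
          have "int (\<pi> (t - 1)) \<in> {1..int n}" "int (\<pi> t) \<in> {1..int n}"
            using p(2)[OF pred(1)[OF that]] p(2)[OF pred(2)[OF that]] by auto
          from int_link_range[OF this, of L] show ?thesis using n by (simp add: lnk_def)
        qed
        then show ?thesis using p(2)[of 0] pick(2) n by (auto simp: coord_def I_def)
      qed
      moreover have "valid_parameters L \<sigma> k (code \<pi>) n (coord \<pi>)"
        unfolding valid_parameters_def Let_def
      proof (intro conjI ballI impI)
        fix t assume t: "t \<in> {0..k}"
        then show "1 \<le> walk L \<sigma> (code \<pi>) n (coord \<pi>) t" "walk L \<sigma> (code \<pi>) n (coord \<pi>) t \<le> int n"
          using walk[of t] p(2)[of t] by auto
      next
        show "walk L \<sigma> (code \<pi>) n (coord \<pi>) k = walk L \<sigma> (code \<pi>) n (coord \<pi>) 0"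
          using walk[of k] walk[of 0] p(3) by simp
      next
        fix t assume t: "t \<in> {1..k}"
        have wt: "walk L \<sigma> (code \<pi>) n (coord \<pi>) (t - 1) = int (\<pi> (t - 1))"
            "walk L \<sigma> (code \<pi>) n (coord \<pi>) t = int (\<pi> t)"
          using walk t by auto
        show "walk L \<sigma> (code \<pi>) n (coord \<pi>) (t - 1) + walk L \<sigma> (code \<pi>) n (coord \<pi>) t \<le> int n + 1"
          unfolding wt using p(4)[OF t] by linarith
        show "int_link L (int n) (walk L \<sigma> (code \<pi>) n (coord \<pi>) (t - 1)) (walk L \<sigma> (code \<pi>) n (coord \<pi>) t) =
            coord \<pi> (block_of \<sigma> t)"
          unfolding wt using coord_block[OF t] by (simp add: lnk_def)
        show "step_code (int n) (walk L \<sigma> (code \<pi>) n (coord \<pi>) (t - 1)) (walk L \<sigma> (code \<pi>) n (coord \<pi>) t) = code \<pi> t"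
          unfolding wt using t by (simp add: code_def)
      next
        fix V W assume VW: "V \<in> \<sigma>" "W \<in> \<sigma>" "V \<noteq> W"
        then show "coord \<pi> V \<noteq> coord \<pi> W"
          using lnk_iff[OF pick(2)[OF VW(1)] pick(2)[OF VW(2)]] pick(3) empty by (auto simp: coord_def I_def)
      qed
      moreover have "to_path (code \<pi>, coord \<pi>) = \<pi>"
      proof
        fix t show "to_path (code \<pi>, coord \<pi>) t = \<pi> t"
          using walk[of t] p(1) by (cases "t \<in> {0..k}") (auto simp: to_path_def PiE_def extensional_def)
      qed
      ultimately show ?thesis by (simp add: Z_def)
    qed
    show "\<forall>a'\<in>kernel_paths L \<sigma> k n. to_path (code a', coord a') = a'" using params by blast
    show "(\<lambda>\<pi>. (code \<pi>, coord \<pi>)) ` kernel_paths L \<sigma> k n \<subseteq> Sigma \<Gamma> Z" using params by blast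
  qed
  then have "card (kernel_paths L \<sigma> k n) = card (Sigma \<Gamma> Z)" by (simp add: bij_betw_same_card)
  also have "\<dots> = (\<Sum>\<gamma>\<in>\<Gamma>. card (Z \<gamma>))"
    using fin by (intro card_SigmaI) (auto simp: \<Gamma>_def Z_def intro!: finite_PiE)
  finally show ?thesis by (simp add: \<Gamma>_def Z_def I_def)
qed

text \<open>
  The exponent is the number of free parameters: the starting vertex and one link value per
  block.
\<close>

definition path_density :: "matrix_pattern \<Rightarrow> nat set set \<Rightarrow> nat \<Rightarrow> nat \<Rightarrow> real" where
  "path_density L \<sigma> k n = real (card (kernel_paths L \<sigma> k n)) / real n ^ Suc (card \<sigma>)"

lemma path_density_eq:
  assumes \<sigma>: "partition_on {1..k} \<sigma>" "finite \<sigma>" and n: "n > 0"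
  shows "path_density L \<sigma> k n = 3 ^ Suc (card \<sigma>) * (\<Sum>\<gamma>\<in>PiE {1..k} (\<lambda>_. UNIV).
    real (card {z \<in> PiE (walk_index \<sigma>) (\<lambda>_. {0..<int (3 * n)}). valid_parameters L \<sigma> k \<gamma> n z})
      / real (3 * n) ^ card (walk_index \<sigma>))"
proof -
  have "card (walk_index \<sigma>) = Suc (card \<sigma>)" using \<sigma> partition_onD3[OF \<sigma>(1)] by simp
  then show ?thesis
    using n unfolding path_density_def card_kernel_paths[OF assms]
    by (simp add: sum_divide_distrib[symmetric] power_mult_distrib field_simps)
qed

lemma path_density_converges:
  assumes \<sigma>: "partition_on {1..k} \<sigma>" "finite \<sigma>"
  shows "convergent (path_density L \<sigma> k)"
    and "V \<in> \<sigma> \<Longrightarrow> odd (card V) \<Longrightarrow> path_density L \<sigma> k \<longlonglongrightarrow> 0"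
proof -
  define r where "r \<gamma> n = real (card {z \<in> PiE (walk_index \<sigma>) (\<lambda>_. {0..<int (3 * n)}). valid_parameters L \<sigma> k \<gamma> n z})
      / real (3 * n) ^ card (walk_index \<sigma>)" for \<gamma> n
  have fin: "finite (walk_index \<sigma>)" using \<sigma> by simp
  have ev: "\<forall>\<^sub>F n in sequentially. 3 ^ Suc (card \<sigma>) * (\<Sum>\<gamma>\<in>PiE {1..k} (\<lambda>_. UNIV). r \<gamma> n) = path_density L \<sigma> k n"
    using eventually_gt_at_top[of 0] by eventually_elim (simp add: path_density_eq[OF \<sigma>] r_def)
  have lim: "path_density L \<sigma> k \<longlonglongrightarrow> 3 ^ Suc (card \<sigma>) * (\<Sum>\<gamma>\<in>PiE {1..k} (\<lambda>_. UNIV). l \<gamma>)"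
    if "\<And>\<gamma>. r \<gamma> \<longlonglongrightarrow> l \<gamma>" for l
    by (rule Lim_transform_eventually[OF _ ev]) (intro tendsto_intros that)
  have "convergent (r \<gamma>)" for \<gamma>
    using grid_count_converges(1)[OF fin eventually_decided_valid[OF \<sigma>, of L \<gamma>]] by (simp add: r_def[abs_def])
  then have "r \<gamma> \<longlonglongrightarrow> lim (r \<gamma>)" for \<gamma> by (simp add: convergent_LIMSEQ_iff)
  from lim[OF this] show "convergent (path_density L \<sigma> k)" by (rule convergentI)
  assume V: "V \<in> \<sigma>" "odd (card V)"
  have "r \<gamma> \<longlonglongrightarrow> 0" for \<gamma>
    using grid_count_converges(2)[OF fin eventually_decided_valid[OF \<sigma>, of L \<gamma>] odd_block_not_valid[OF \<sigma> V]]
    by (simp add: r_def[abs_def])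
  from lim[OF this] show "path_density L \<sigma> k \<longlonglongrightarrow> 0" by simp
qed

text \<open>
  There are \<open>4\<^sup>k\<close> words of step codes and at most \<open>(3 * n)\<^sup>|\<^sup>\<sigma>\<^sup>|\<^sup>+\<^sup>1\<close> points of the grid, and \<open>\<sigma>\<close> has at
  most \<open>k\<close> blocks.
\<close>

lemma path_density_bounds:
  assumes \<sigma>: "partition_on {1..k} \<sigma>" "finite \<sigma>" and n: "n > 0"
  shows "0 \<le> path_density L \<sigma> k n" "path_density L \<sigma> k n \<le> 3 * 12 ^ k"
proof -
  show "0 \<le> path_density L \<sigma> k n" by (simp add: path_density_def)
  have fin: "finite (walk_index \<sigma>)" using \<sigma> by simp
  have "card \<sigma> \<le> card {1..k}"
  proof (rule surj_card_le)
    show "\<sigma> \<subseteq> block_of \<sigma> ` {1..k}"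
    proof
      fix V assume V: "V \<in> \<sigma>"
      then obtain t where "t \<in> V" using partition_onD3[OF \<sigma>(1)] by (cases "V = {}") auto
      moreover have "V \<subseteq> {1..k}" using V partition_onD1[OF \<sigma>(1)] by blast
      ultimately show "V \<in> block_of \<sigma> ` {1..k}" using block_of_eq[OF \<sigma>(1) V] by force
    qed
  qed simp
  then have card: "card \<sigma> \<le> k" by simp
  have le: "real (card {z \<in> PiE (walk_index \<sigma>) (\<lambda>_. {0..<int (3 * n)}). valid_parameters L \<sigma> k \<gamma> n z})
      / real (3 * n) ^ card (walk_index \<sigma>) \<le> 1" for \<gamma>
  proof -
    have "card {z \<in> PiE (walk_index \<sigma>) (\<lambda>_. {0..<int (3 * n)}). valid_parameters L \<sigma> k \<gamma> n z} \<le>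
        card (PiE (walk_index \<sigma>) (\<lambda>_. {0..<int (3 * n)}))"
      using fin by (intro card_mono finite_PiE) auto
    also have "\<dots> = (3 * n) ^ card (walk_index \<sigma>)" using fin by (subst card_PiE) (auto simp del: of_nat_mult)
    finally have "real (card {z \<in> PiE (walk_index \<sigma>) (\<lambda>_. {0..<int (3 * n)}). valid_parameters L \<sigma> k \<gamma> n z}) \<le>
        real ((3 * n) ^ card (walk_index \<sigma>))" by (simp only: of_nat_le_iff)
    then show ?thesis using n by (simp add: divide_le_eq)
  qed
  have "path_density L \<sigma> k n \<le> 3 ^ Suc (card \<sigma>) * (\<Sum>\<gamma>\<in>PiE {1..k} (\<lambda>_. UNIV :: (bool \<times> bool) set). 1)"
    unfolding path_density_eq[OF assms] by (intro mult_left_mono sum_mono le) auto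
  also have "(\<Sum>\<gamma>\<in>PiE {1..k} (\<lambda>_. UNIV :: (bool \<times> bool) set). 1) = real (4 ^ k)"
    by (simp add: card_PiE card_UNIV_bool)
  also have "3 ^ Suc (card \<sigma>) * real (4 ^ k) \<le> 3 ^ Suc k * real (4 ^ k)"
    using card by (intro mult_right_mono power_increasing) auto
  also have "\<dots> = 3 * 12 ^ k" by (simp add: power_mult_distrib[symmetric])
  finally show "path_density L \<sigma> k n \<le> 3 * 12 ^ k" .
qed

section \<open>Trace moments\<close>

lemma matrix_power_entry_paths:
  fixes a :: "nat \<Rightarrow> nat \<Rightarrow> real"
  assumes "i < n" "j < n"
  shows "(Matrix.mat n n (\<lambda>(i, j). a (Suc i) (Suc j)) ^\<^sub>m k) $$ (i, j) =
    (\<Sum>\<pi> | \<pi> \<in> PiE {0..k} (\<lambda>_. {1..n}) \<and> \<pi> 0 = Suc i \<and> \<pi> k = Suc j. \<Prod>t\<in>{1..k}. a (\<pi> (t - 1)) (\<pi> t))"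
  using assms(2)
proof (induction k arbitrary: j)
  case 0
  have "{\<pi> \<in> PiE {0..0::nat} (\<lambda>_. {1..n}). \<pi> 0 = Suc i \<and> \<pi> 0 = Suc j} =
      (if i = j then {\<lambda>t\<in>{0}. Suc i} else {})"
    using assms by (auto simp: PiE_def extensional_def fun_eq_iff)
  then show ?case using assms 0 by simp
next
  case (Suc k)
  let ?A = "Matrix.mat n n (\<lambda>(i, j). a (Suc i) (Suc j))"
  define P where "P m l = {\<pi> \<in> PiE {0..m} (\<lambda>_. {1..n}). \<pi> 0 = Suc i \<and> \<pi> m = Suc l}" for m l :: nat
  define w where "w m \<pi> = (\<Prod>t\<in>{1..m}. a (\<pi> (t - 1)) (\<pi> t))" for m :: nat and \<pi> :: "nat \<Rightarrow> nat"
  have fin: "finite (P m l)" for m l unfolding P_def by (auto intro!: finite_Collect_conjI disjI1 finite_PiE simp del: PiE_iff)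
  have dims: "dim_row (?A ^\<^sub>m k) = n" "dim_col (?A ^\<^sub>m k) = n"
    using pow_carrier_mat[of ?A n k] by auto
  have "(?A ^\<^sub>m Suc k) $$ (i, j) = (\<Sum>l<n. (?A ^\<^sub>m k) $$ (i, l) * a (Suc l) (Suc j))"
    using assms Suc.prems dims by (simp add: scalar_prod_def lessThan_atLeast0)
  also have "\<dots> = (\<Sum>l<n. \<Sum>\<pi>\<in>P k l. w k \<pi> * a (Suc l) (Suc j))"
    using Suc.IH by (simp add: P_def w_def sum_distrib_right)
  also have "\<dots> = (\<Sum>(l, \<pi>)\<in>Sigma {..<n} (P k). w k \<pi> * a (Suc l) (Suc j))"
    using fin by (subst sum.Sigma) auto
  also have "\<dots> = (\<Sum>\<pi>\<in>P (Suc k) j. w (Suc k) \<pi>)"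
  proof (rule sum.reindex_bij_witness[where i = "\<lambda>\<pi>. (\<pi> k - 1, restrict \<pi> {0..k})"
        and j = "\<lambda>(l, \<pi>). \<pi>(Suc k := Suc j)"])
    fix p assume p: "p \<in> Sigma {..<n} (P k)"
    obtain l \<pi> where lp: "p = (l, \<pi>)" "l < n" "\<pi> \<in> P k l" using p by auto
    have ext: "\<pi> \<in> PiE {0..k} (\<lambda>_. {1..n})" "\<pi> 0 = Suc i" "\<pi> k = Suc l" using lp by (auto simp: P_def)
    have "restrict (\<pi>(Suc k := Suc j)) {0..k} = \<pi>"
      using ext(1) by (auto simp: fun_eq_iff PiE_def extensional_def restrict_def)
    then show "((case p of (l, \<pi>) \<Rightarrow> \<pi>(Suc k := Suc j)) k - 1,
        restrict (case p of (l, \<pi>) \<Rightarrow> \<pi>(Suc k := Suc j)) {0..k}) = p"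
      using ext by (simp add: lp)
    show "(case p of (l, \<pi>) \<Rightarrow> \<pi>(Suc k := Suc j)) \<in> P (Suc k) j"
      using ext Suc.prems by (auto simp: lp P_def PiE_def extensional_def Pi_def)
    have "w (Suc k) (\<pi>(Suc k := Suc j)) = w k (\<pi>(Suc k := Suc j)) * a (Suc l) (Suc j)"
      using ext by (simp add: w_def mult.commute)
    also have "w k (\<pi>(Suc k := Suc j)) = w k \<pi>"
      unfolding w_def by (intro prod.cong) auto
    finally show "w (Suc k) (case p of (l, \<pi>) \<Rightarrow> \<pi>(Suc k := Suc j)) =
        (case p of (l, \<pi>) \<Rightarrow> w k \<pi> * a (Suc l) (Suc j))"
      by (simp only: lp prod.case)
  next
    fix \<pi> assume \<pi>: "\<pi> \<in> P (Suc k) j"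
    then have p: "\<pi> \<in> PiE {0..Suc k} (\<lambda>_. {1..n})" "\<pi> 0 = Suc i" "\<pi> (Suc k) = Suc j" by (auto simp: P_def)
    then have pk: "\<pi> k \<in> {1..n}" by auto
    have "(restrict \<pi> {0..k})(Suc k := Suc j) = \<pi>"
      using p by (auto simp: fun_eq_iff PiE_def extensional_def restrict_def)
    then show "(case (\<pi> k - 1, restrict \<pi> {0..k}) of (l, \<pi>) \<Rightarrow> \<pi>(Suc k := Suc j)) = \<pi>" by simp
    show "(\<pi> k - 1, restrict \<pi> {0..k}) \<in> Sigma {..<n} (P k)"
      using p pk by (auto simp: P_def)
  qed
  finally show ?case by (simp only: P_def w_def)
qed

definition closed_paths :: "nat \<Rightarrow> nat \<Rightarrow> (nat \<Rightarrow> nat) set" where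
  "closed_paths k n = {\<pi> \<in> PiE {0..k} (\<lambda>_. {1..n}). \<pi> 0 = \<pi> k \<and> (\<forall>t\<in>{1..k}. \<pi> (t - 1) + \<pi> t \<le> n + 1)}"

lemma finite_closed_paths: "finite (closed_paths k n)"
  unfolding closed_paths_def by (auto intro!: finite_Collect_conjI disjI1 finite_PiE simp del: PiE_iff)

lemma trace_power_triangular_patterned:
  "mat_trace (triangular_patterned L n x ^\<^sub>m k) =
    (\<Sum>\<pi>\<in>closed_paths k n. \<Prod>t\<in>{1..k}. x (link L n (\<pi> (t - 1)) (\<pi> t)))"
proof -
  define a where "a i j = (if i + j \<le> n + 1 then x (link L n i j) else 0)" for i j
  define Q where "Q = {\<pi> \<in> PiE {0..k} (\<lambda>_. {1..n}). \<pi> 0 = \<pi> k}"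
  define w where "w \<pi> = (\<Prod>t\<in>{1..k}. a (\<pi> (t - 1)) (\<pi> t))" for \<pi> :: "nat \<Rightarrow> nat"
  have Q: "finite Q" unfolding Q_def by (auto intro!: finite_Collect_conjI disjI1 finite_PiE simp del: PiE_iff)
  have A: "triangular_patterned L n x = Matrix.mat n n (\<lambda>(i, j). a (Suc i) (Suc j))"
    by (simp add: triangular_patterned_def a_def)
  have "mat_trace (triangular_patterned L n x ^\<^sub>m k) =
      (\<Sum>i<n. (Matrix.mat n n (\<lambda>(i, j). a (Suc i) (Suc j)) ^\<^sub>m k) $$ (i, i))"
    unfolding A mat_trace_def using pow_carrier_mat[of "Matrix.mat n n (\<lambda>(i, j). a (Suc i) (Suc j))" n k] by simp
  also have "\<dots> = (\<Sum>i<n. \<Sum>\<pi> | \<pi> \<in> Q \<and> \<pi> 0 - 1 = i. w \<pi>)"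
  proof (rule sum.cong[OF refl])
    fix i assume i: "i \<in> {..<n}"
    have "{\<pi> \<in> PiE {0..k} (\<lambda>_. {1..n}). \<pi> 0 = Suc i \<and> \<pi> k = Suc i} = {\<pi> \<in> Q. \<pi> 0 - 1 = i}"
    proof (intro equalityI subsetI)
      fix \<pi> assume "\<pi> \<in> {\<pi> \<in> Q. \<pi> 0 - 1 = i}"
      moreover from this have "\<pi> 0 \<in> {1..n}" by (auto simp: Q_def)
      ultimately show "\<pi> \<in> {\<pi> \<in> PiE {0..k} (\<lambda>_. {1..n}). \<pi> 0 = Suc i \<and> \<pi> k = Suc i}"
        by (auto simp: Q_def)
    qed (auto simp: Q_def)
    then show "(Matrix.mat n n (\<lambda>(i, j). a (Suc i) (Suc j)) ^\<^sub>m k) $$ (i, i) = (\<Sum>\<pi> | \<pi> \<in> Q \<and> \<pi> 0 - 1 = i. w \<pi>)"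
      using i by (simp add: matrix_power_entry_paths w_def)
  qed
  also have "\<dots> = (\<Sum>\<pi>\<in>Q. w \<pi>)"
  proof (rule sum.group[OF Q])
    show "(\<lambda>\<pi>. \<pi> 0 - 1) ` Q \<subseteq> {..<n}"
    proof
      fix y assume "y \<in> (\<lambda>\<pi>. \<pi> 0 - 1) ` Q"
      then obtain \<pi> where "\<pi> \<in> Q" "y = \<pi> 0 - 1" by auto
      moreover from this have "\<pi> 0 \<in> {1..n}" by (auto simp: Q_def)
      ultimately show "y \<in> {..<n}" by auto
    qed
  qed simp
  also have "\<dots> = (\<Sum>\<pi>\<in>closed_paths k n. w \<pi>)"
  proof (rule sum.mono_neutral_right[OF Q])
    show "closed_paths k n \<subseteq> Q" by (auto simp: closed_paths_def Q_def)
    show "\<forall>\<pi>\<in>Q - closed_paths k n. w \<pi> = 0"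
    proof
      fix \<pi> assume "\<pi> \<in> Q - closed_paths k n"
      then obtain t where "t \<in> {1..k}" "\<not> \<pi> (t - 1) + \<pi> t \<le> n + 1" by (auto simp: Q_def closed_paths_def)
      then show "w \<pi> = 0" unfolding w_def by (intro prod_zero) (auto simp: a_def)
    qed
  qed
  also have "\<dots> = (\<Sum>\<pi>\<in>closed_paths k n. \<Prod>t\<in>{1..k}. x (link L n (\<pi> (t - 1)) (\<pi> t)))"
    unfolding w_def by (intro sum.cong prod.cong) (auto simp: a_def closed_paths_def)
  finally show ?thesis .
qed

definition kernel_partition :: "(nat \<Rightarrow> 'b) \<Rightarrow> nat \<Rightarrow> nat set set" where
  "kernel_partition l k = (\<lambda>v. {t \<in> {1..k}. l t = v}) ` l ` {1..k}"

lemma partition_on_kernel_partition: "partition_on {1..k} (kernel_partition l k)"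
  by (rule partition_onI) (auto simp: kernel_partition_def disjnt_def)

lemma kernel_partition_eq_iff:
  assumes \<sigma>: "partition_on {1..k} \<sigma>"
  shows "kernel_partition l k = \<sigma> \<longleftrightarrow>
    (\<forall>s\<in>{1..k}. \<forall>t\<in>{1..k}. l s = l t \<longleftrightarrow> block_of \<sigma> s = block_of \<sigma> t)"
proof
  assume eq: "kernel_partition l k = \<sigma>"
  have block: "block_of \<sigma> t = {s \<in> {1..k}. l s = l t}" if "t \<in> {1..k}" for t
    by (rule block_of_eq[OF \<sigma>]) (use that in \<open>auto simp: eq[symmetric] kernel_partition_def\<close>)
  show "\<forall>s\<in>{1..k}. \<forall>t\<in>{1..k}. l s = l t \<longleftrightarrow> block_of \<sigma> s = block_of \<sigma> t"
  proof (intro ballI iffI)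
    fix s t assume st: "s \<in> {1..k}" "t \<in> {1..k}"
    show "block_of \<sigma> s = block_of \<sigma> t" if "l s = l t" using that st by (simp add: block)
    show "l s = l t" if "block_of \<sigma> s = block_of \<sigma> t"
      using that st block_of_in(2)[OF \<sigma> st(1)] block[OF st(2)] by auto
  qed
next
  assume iff: "\<forall>s\<in>{1..k}. \<forall>t\<in>{1..k}. l s = l t \<longleftrightarrow> block_of \<sigma> s = block_of \<sigma> t"
  have block: "{s \<in> {1..k}. l s = l t} = block_of \<sigma> t" if t: "t \<in> {1..k}" for t
  proof (intro equalityI subsetI)
    fix s assume "s \<in> {s \<in> {1..k}. l s = l t}"
    then show "s \<in> block_of \<sigma> t" using iff t block_of_in(2)[OF \<sigma>, of s] by auto
  next
    fix s assume s: "s \<in> block_of \<sigma> t"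
    have B: "block_of \<sigma> t \<in> \<sigma>" by (rule block_of_in(1)[OF \<sigma> t])
    then have "s \<in> {1..k}" using s partition_onD1[OF \<sigma>] by blast
    moreover have "block_of \<sigma> s = block_of \<sigma> t" by (rule block_of_eq[OF \<sigma> B s])
    ultimately show "s \<in> {s \<in> {1..k}. l s = l t}" using iff t by auto
  qed
  have "kernel_partition l k = block_of \<sigma> ` {1..k}"
    unfolding kernel_partition_def image_image using block by (intro image_cong) auto
  also have "\<dots> = \<sigma>"
  proof (intro equalityI subsetI)
    fix V assume V: "V \<in> \<sigma>"
    then obtain t where t: "t \<in> V" using partition_onD3[OF \<sigma>] by (metis all_not_in_conv)
    then have "t \<in> {1..k}" using V partition_onD1[OF \<sigma>] by blast
    then show "V \<in> block_of \<sigma> ` {1..k}" using block_of_eq[OF \<sigma> V t] by blast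
  qed (use block_of_in(1)[OF \<sigma>] in auto)
  finally show "kernel_partition l k = \<sigma>" .
qed

lemma finite_partition_on: "partition_on {1..k::nat} \<sigma> \<Longrightarrow> finite \<sigma>"
  by (rule finite_elements[OF finite_atLeastAtMost])

text \<open>
  Equal factors are collected into powers of distinct, hence independent, variables; the exponents
  are the sizes of the blocks of the kernel.
\<close>

lemma (in prob_space) expectation_prod_kernel:
  fixes X :: "nat \<Rightarrow> 'a \<Rightarrow> real"
  assumes indep: "indep_vars (\<lambda>_. borel) X UNIV"
    and int: "\<And>i k. integrable M (\<lambda>\<omega>. X i \<omega> ^ k)"
    and mom: "\<And>i k. expectation (\<lambda>\<omega>. X i \<omega> ^ k) = m k"
  shows "integrable M (\<lambda>\<omega>. \<Prod>t\<in>{1..k}. X (l t) \<omega>)"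
    and "expectation (\<lambda>\<omega>. \<Prod>t\<in>{1..k}. X (l t) \<omega>) = (\<Prod>V\<in>kernel_partition l k. m (card V))"
proof -
  define J where "J = l ` {1..k}"
  define c where "c v = card {t \<in> {1..k}. l t = v}" for v
  have J: "finite J" by (simp add: J_def)
  have eq: "(\<Prod>t\<in>{1..k}. X (l t) \<omega>) = (\<Prod>v\<in>J. X v \<omega> ^ c v)" for \<omega>
  proof -
    have "(\<Prod>t\<in>{1..k}. X (l t) \<omega>) = (\<Prod>v\<in>J. \<Prod>t | t \<in> {1..k} \<and> l t = v. X (l t) \<omega>)"
      by (rule prod.group[symmetric]) (auto simp: J_def)
    also have "\<dots> = (\<Prod>v\<in>J. X v \<omega> ^ c v)"
      by (intro prod.cong refl) (simp add: c_def)
    finally show ?thesis .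
  qed
  have ind: "indep_vars (\<lambda>_. borel) (\<lambda>v \<omega>. X v \<omega> ^ c v) J"
    by (rule indep_vars_compose2[OF indep_vars_subset[OF indep, of J]]) auto
  show "integrable M (\<lambda>\<omega>. \<Prod>t\<in>{1..k}. X (l t) \<omega>)"
    unfolding eq by (rule indep_vars_integrable[OF J ind int])
  have "expectation (\<lambda>\<omega>. \<Prod>t\<in>{1..k}. X (l t) \<omega>) = (\<Prod>v\<in>J. m (c v))"
    unfolding eq by (subst indep_vars_lebesgue_integral[OF J ind int]) (simp add: mom)
  also have "\<dots> = (\<Prod>V\<in>kernel_partition l k. m (card V))"
  proof -
    have "inj_on (\<lambda>v. {t \<in> {1..k}. l t = v}) J"
    proof (rule inj_onI)
      fix v w assume "v \<in> J" and eq: "{t \<in> {1..k}. l t = v} = {t \<in> {1..k}. l t = w}"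
      then obtain t where "t \<in> {1..k}" "l t = v" unfolding J_def by blast
      then have "t \<in> {t \<in> {1..k}. l t = w}" unfolding eq[symmetric] by blast
      then show "v = w" using \<open>l t = v\<close> by blast
    qed
    then show ?thesis
      unfolding kernel_partition_def J_def[symmetric] c_def by (simp only: prod.reindex o_def)
  qed
  finally show "expectation (\<lambda>\<omega>. \<Prod>t\<in>{1..k}. X (l t) \<omega>) = (\<Prod>V\<in>kernel_partition l k. m (card V))" .
qed

lemma (in prob_space) expectation_trace_power:
  fixes X :: "nat \<Rightarrow> 'a \<Rightarrow> real"
  assumes indep: "indep_vars (\<lambda>_. borel) X UNIV"
    and int: "\<And>i k. integrable M (\<lambda>\<omega>. X i \<omega> ^ k)"
    and mom: "\<And>i k. expectation (\<lambda>\<omega>. X i \<omega> ^ k) = m k"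
    and n: "n > 0"
  shows "integrable M (\<lambda>\<omega>. mat_trace (triangular_patterned L n (\<lambda>i. X i \<omega>) ^\<^sub>m k))"
    and "expectation (\<lambda>\<omega>. mat_trace (triangular_patterned L n (\<lambda>i. X i \<omega>) ^\<^sub>m k)) / real n =
      (\<Sum>\<sigma> | partition_on {1..k} \<sigma>. path_density L \<sigma> k n * (\<Prod>V\<in>\<sigma>. real n * m (card V)))"
proof -
  define lk where "lk \<pi> t = link L n (\<pi> (t - 1)) (\<pi> t)" for \<pi> :: "nat \<Rightarrow> nat" and t
  note E = expectation_prod_kernel[OF indep int mom]
  show "integrable M (\<lambda>\<omega>. mat_trace (triangular_patterned L n (\<lambda>i. X i \<omega>) ^\<^sub>m k))"
    unfolding trace_power_triangular_patterned lk_def[symmetric] by (intro Bochner_Integration.integrable_sum E(1))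
  have fin: "finite {\<sigma>. partition_on {1..k} \<sigma>}" by (rule finitely_many_partition_on) simp
  have paths: "{\<pi> \<in> closed_paths k n. kernel_partition (lk \<pi>) k = \<sigma>} = kernel_paths L \<sigma> k n"
    if "partition_on {1..k} \<sigma>" for \<sigma>
    unfolding kernel_partition_eq_iff[OF that] by (auto simp: kernel_paths_def closed_paths_def lk_def)
  have "expectation (\<lambda>\<omega>. mat_trace (triangular_patterned L n (\<lambda>i. X i \<omega>) ^\<^sub>m k)) =
      (\<Sum>\<pi>\<in>closed_paths k n. \<Prod>V\<in>kernel_partition (lk \<pi>) k. m (card V))"
    unfolding trace_power_triangular_patterned lk_def[symmetric]
    by (subst Bochner_Integration.integral_sum, rule E(1), rule sum.cong[OF refl], rule E(2))
  also have "\<dots> = (\<Sum>\<sigma> | partition_on {1..k} \<sigma>. \<Sum>\<pi> | \<pi> \<in> closed_paths k n \<and> kernel_partition (lk \<pi>) k = \<sigma>.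
      \<Prod>V\<in>kernel_partition (lk \<pi>) k. m (card V))"
    by (rule sum.group[symmetric, OF finite_closed_paths fin]) (use partition_on_kernel_partition in blast)
  also have "\<dots> = (\<Sum>\<sigma> | partition_on {1..k} \<sigma>. real (card (kernel_paths L \<sigma> k n)) * (\<Prod>V\<in>\<sigma>. m (card V)))"
  proof (rule sum.cong[OF refl])
    fix \<sigma> assume "\<sigma> \<in> {\<sigma>. partition_on {1..k} \<sigma>}"
    then have \<sigma>: "partition_on {1..k} \<sigma>" by simp
    have "(\<Sum>\<pi> | \<pi> \<in> closed_paths k n \<and> kernel_partition (lk \<pi>) k = \<sigma>. \<Prod>V\<in>kernel_partition (lk \<pi>) k. m (card V)) =
        (\<Sum>\<pi>\<in>kernel_paths L \<sigma> k n. \<Prod>V\<in>\<sigma>. m (card V))"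
      unfolding paths[OF \<sigma>, symmetric] by (intro sum.cong) auto
    then show "(\<Sum>\<pi> | \<pi> \<in> closed_paths k n \<and> kernel_partition (lk \<pi>) k = \<sigma>. \<Prod>V\<in>kernel_partition (lk \<pi>) k. m (card V)) =
        real (card (kernel_paths L \<sigma> k n)) * (\<Prod>V\<in>\<sigma>. m (card V))" by simp
  qed
  finally have "expectation (\<lambda>\<omega>. mat_trace (triangular_patterned L n (\<lambda>i. X i \<omega>) ^\<^sub>m k)) / real n =
      (\<Sum>\<sigma> | partition_on {1..k} \<sigma>. real (card (kernel_paths L \<sigma> k n)) * (\<Prod>V\<in>\<sigma>. m (card V)) / real n)"
    by (simp add: sum_divide_distrib)
  also have "\<dots> = (\<Sum>\<sigma> | partition_on {1..k} \<sigma>. path_density L \<sigma> k n * (\<Prod>V\<in>\<sigma>. real n * m (card V)))"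
    using n by (intro sum.cong refl) (simp add: path_density_def prod.distrib field_simps)
  finally show "expectation (\<lambda>\<omega>. mat_trace (triangular_patterned L n (\<lambda>i. X i \<omega>) ^\<^sub>m k)) / real n =
      (\<Sum>\<sigma> | partition_on {1..k} \<sigma>. path_density L \<sigma> k n * (\<Prod>V\<in>\<sigma>. real n * m (card V)))" .
qed

lemma random_symmetric_matrix_triangular_patterned:
  assumes "prob_space M" "\<And>i. X i \<in> borel_measurable M" and n: "n > 0"
  shows "random_symmetric_matrix M (\<lambda>\<omega>. triangular_patterned L n (\<lambda>i. X i \<omega>)) n"
proof -
  interpret prob_space M by (rule assms(1))
  have link_sym: "link L n i j = link L n j i" for i j
  proof (cases L)
    case Hankel
    show ?thesis unfolding Hankel link.simps by (rule add.commute)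
  next
    case Toeplitz
    show ?thesis unfolding Toeplitz link.simps by (subst abs_minus_commute) (rule refl)
  next
    case Sym_Circulant
    have "\<bar>real i - real j\<bar> = \<bar>real j - real i\<bar>" by (rule abs_minus_commute)
    then show ?thesis unfolding Sym_Circulant link.simps by (rule arg_cong)
  qed
  show ?thesis
  proof
    fix \<omega>
    show "triangular_patterned L n (\<lambda>i. X i \<omega>) \<in> carrier_mat n n" by (simp add: triangular_patterned_def)
    show "transpose_mat (triangular_patterned L n (\<lambda>i. X i \<omega>)) = triangular_patterned L n (\<lambda>i. X i \<omega>)"
      
    proof (rule eq_matI)
      fix i j assume "i < dim_row (triangular_patterned L n (\<lambda>i. X i \<omega>))"
        "j < dim_col (triangular_patterned L n (\<lambda>i. X i \<omega>))"
      then show "transpose_mat (triangular_patterned L n (\<lambda>i. X i \<omega>)) $$ (i, j) = triangular_patterned L n (\<lambda>i. X i \<omega>) $$ (i, j)"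
        using link_sym[of "Suc i" "Suc j"] by (simp add: triangular_patterned_def add.commute[of i j])
    qed (simp_all add: triangular_patterned_def)
  next
    fix i j assume "i < n" "j < n"
    then have "(\<lambda>\<omega>. triangular_patterned L n (\<lambda>i. X i \<omega>) $$ (i, j)) =
        (\<lambda>\<omega>. if Suc i + Suc j \<le> n + 1 then X (link L n (Suc i) (Suc j)) \<omega> else 0)"
      by (simp add: triangular_patterned_def)
    then show "(\<lambda>\<omega>. triangular_patterned L n (\<lambda>i. X i \<omega>) $$ (i, j)) \<in> borel_measurable M"
      using assms(2) by simp
  qed (rule n)
qed

definition limit_moment :: "matrix_pattern \<Rightarrow> (nat \<Rightarrow> real) \<Rightarrow> nat \<Rightarrow> real" where
  "limit_moment L C k =
     (\<Sum>\<sigma> | partition_on {1..k} \<sigma>. lim (path_density L \<sigma> k) * (\<Prod>V\<in>\<sigma>. C (card V)))"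

lemma block_card_pos:
  assumes \<sigma>: "partition_on {1..k::nat} \<sigma>" and V: "V \<in> \<sigma>"
  shows "1 \<le> card V"
proof -
  have "V \<subseteq> {1..k}" using V partition_onD1[OF \<sigma>] by blast
  then have "finite V" by (rule finite_subset) simp
  moreover have "V \<noteq> {}" using V partition_onD3[OF \<sigma>] by metis
  ultimately show ?thesis by (simp add: Suc_le_eq card_gt_0_iff)
qed

text \<open>
  Partitions with an odd block have density \<open>0\<close> in the limit.
\<close>

lemma limit_moment_eq_even:
  "limit_moment L C k = (\<Sum>\<sigma> | partition_on {1..k} \<sigma> \<and> (\<forall>V\<in>\<sigma>. even (card V)).
     lim (path_density L \<sigma> k) * (\<Prod>V\<in>\<sigma>. C (card V)))"
  unfolding limit_moment_def
proof (rule sum.mono_neutral_right)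
  show "finite {\<sigma>. partition_on {1..k} \<sigma>}" by (rule finitely_many_partition_on) simp
  show "\<forall>\<sigma>\<in>{\<sigma>. partition_on {1..k} \<sigma>} - {\<sigma>. partition_on {1..k} \<sigma> \<and> (\<forall>V\<in>\<sigma>. even (card V))}.
      lim (path_density L \<sigma> k) * (\<Prod>V\<in>\<sigma>. C (card V)) = 0"
    using limI[OF path_density_converges(2)] finite_partition_on by auto
qed auto

text \<open>
  A set of odd size has no partition into blocks of even size.
\<close>

lemma limit_moment_odd:
  assumes "odd k" shows "limit_moment L C k = 0"
proof -
  have "\<not> (partition_on {1..k} \<sigma> \<and> (\<forall>V\<in>\<sigma>. even (card V)))" for \<sigma>
  proof
    assume *: "partition_on {1..k} \<sigma> \<and> (\<forall>V\<in>\<sigma>. even (card V))"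
    have "finite V" if "V \<in> \<sigma>" for V
      using block_card_pos[of k \<sigma> V] * that by (auto intro: card_ge_0_finite)
    then have "card {1..k} = (\<Sum>V\<in>\<sigma>. card V)" using * by (intro product_partition) auto
    moreover have "even (\<Sum>V\<in>\<sigma>. card V)" using * by (intro dvd_sum) auto
    ultimately show False using assms by simp
  qed
  then show ?thesis unfolding limit_moment_eq_even by (intro sum.neutral) blast
qed

lemma limit_moment_cong_even:
  assumes "\<And>j. j \<ge> 1 \<Longrightarrow> C' (2 * j) = C (2 * j)"
  shows "limit_moment L C' k = limit_moment L C k"
proof -
  have "C' (card V) = C (card V)" if \<sigma>: "partition_on {1..k} \<sigma>" "V \<in> \<sigma>" "even (card V)" for \<sigma> V
  proof -
    obtain j where "card V = 2 * j" using \<sigma>(3) by (elim evenE)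
    then show ?thesis using assms[of j] block_card_pos[OF \<sigma>(1,2)] by simp
  qed
  then show ?thesis
    unfolding limit_moment_eq_even by (intro sum.cong prod.cong arg_cong2[where f = "(*)"]) auto
qed

lemma limit_moment_le:
  assumes "\<And>j. j \<ge> 1 \<Longrightarrow> C (2 * j) \<ge> 0"
  shows "limit_moment L C k \<le> 3 * 12 ^ k * even_cumulant_moment C k"
  unfolding limit_moment_eq_even even_cumulant_moment_def sum_distrib_left
proof (rule sum_mono, rule mult_right_mono)
  fix \<sigma> assume "\<sigma> \<in> {\<sigma>. partition_on {1..k} \<sigma> \<and> (\<forall>V\<in>\<sigma>. even (card V))}"
  then have \<sigma>: "partition_on {1..k} \<sigma>" "finite \<sigma>" "\<And>V. V \<in> \<sigma> \<Longrightarrow> even (card V)"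
    using finite_partition_on by auto
  have "path_density L \<sigma> k \<longlonglongrightarrow> lim (path_density L \<sigma> k)"
    using path_density_converges(1)[OF \<sigma>(1,2)] by (simp add: convergent_LIMSEQ_iff)
  then show "lim (path_density L \<sigma> k) \<le> 3 * 12 ^ k"
    by (rule LIMSEQ_le_const2) (use path_density_bounds(2)[OF \<sigma>(1,2)] in \<open>auto intro!: exI[of _ 1]\<close>)
  show "0 \<le> (\<Prod>V\<in>\<sigma>. C (card V))"
  proof (rule prod_nonneg)
    fix V assume V: "V \<in> \<sigma>"
    then obtain j where "card V = 2 * j" using \<sigma>(3) by (meson evenE)
    then show "0 \<le> C (card V)" using assms[of j] block_card_pos[OF \<sigma>(1) V] by simp
  qed
qed

text \<open>
  The sequence starts at \<open>Suc n\<close> because the spectral distribution of the empty matrix is not a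
  probability measure.
\<close>

lemma eesd_moments_converge:
  assumes iid: "iid_array_with_limits M x C"
  obtains m where
    "\<And>n. has_moments (eesd (M (Suc n)) (\<lambda>\<omega>. triangular_patterned L (Suc n) (\<lambda>i. x (Suc n) i \<omega>))) (m n)"
    "\<And>k. (\<lambda>n. m n k) \<longlonglongrightarrow> limit_moment L C k"
proof -
  define \<mu> where "\<mu> n k = prob_space.expectation (M n) (\<lambda>\<omega>. x n 0 \<omega> ^ k)" for n k
  have P: "prob_space (M n)" "prob_space.indep_vars (M n) (\<lambda>_. borel) (x n) UNIV"
    "\<And>i. distr (M n) borel (x n i) = distr (M n) borel (x n 0)"
    "\<And>i k. integrable (M n) (\<lambda>\<omega>. x n i \<omega> ^ k)" for n
    using iid by (simp_all add: iid_array_with_limits_def)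
  have C: "(\<lambda>n. real n * \<mu> n k) \<longlonglongrightarrow> C k" if "k \<ge> 1" for k
    using iid that by (simp add: iid_array_with_limits_def \<mu>_def)
  have meas: "x n i \<in> borel_measurable (M n)" for n i
    using P(4)[of n i 1] by (simp add: borel_measurable_integrable)
  have mom: "prob_space.expectation (M n) (\<lambda>\<omega>. x n i \<omega> ^ k) = \<mu> n k" for n i k
  proof -
    have "prob_space.expectation (M n) (\<lambda>\<omega>. x n i \<omega> ^ k) = (LINT t|distr (M n) borel (x n i). t ^ k)"
      by (subst integral_distr) (auto intro: meas)
    also have "\<dots> = (LINT t|distr (M n) borel (x n 0). t ^ k)" by (subst P(3)) (rule refl)
    also have "\<dots> = \<mu> n k"
      unfolding \<mu>_def by (subst integral_distr) (auto intro: meas)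
    finally show ?thesis .
  qed
  define m where "m n k = prob_space.expectation (M (Suc n))
      (\<lambda>\<omega>. mat_trace (triangular_patterned L (Suc n) (\<lambda>i. x (Suc n) i \<omega>) ^\<^sub>m k)) / real (Suc n)" for n k
  have "has_moments (eesd (M (Suc n)) (\<lambda>\<omega>. triangular_patterned L (Suc n) (\<lambda>i. x (Suc n) i \<omega>))) (m n)" for n
  proof -
    interpret R: random_symmetric_matrix "M (Suc n)" "\<lambda>\<omega>. triangular_patterned L (Suc n) (\<lambda>i. x (Suc n) i \<omega>)" "Suc n"
      by (rule random_symmetric_matrix_triangular_patterned[OF P(1) meas]) simp
    show ?thesis
      unfolding has_moments_def m_def
      by (intro conjI allI R.real_distribution_eesd R.eesd_moment
          R.expectation_trace_power(1)[OF P(2) P(4) mom]) simp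
  qed
  moreover have "(\<lambda>n. m n k) \<longlonglongrightarrow> limit_moment L C k" for k
  proof -
    have "m n k = (\<Sum>\<sigma> | partition_on {1..k} \<sigma>. path_density L \<sigma> k (Suc n) *
        (\<Prod>V\<in>\<sigma>. real (Suc n) * \<mu> (Suc n) (card V)))" for n
      unfolding m_def by (rule prob_space.expectation_trace_power(2)[OF P(1) P(2) P(4) mom]) simp
    moreover have "(\<lambda>n. \<Sum>\<sigma> | partition_on {1..k} \<sigma>. path_density L \<sigma> k (Suc n) *
        (\<Prod>V\<in>\<sigma>. real (Suc n) * \<mu> (Suc n) (card V))) \<longlonglongrightarrow> limit_moment L C k"
      unfolding limit_moment_def
    proof (intro tendsto_sum tendsto_mult tendsto_prod)
      fix \<sigma> assume "\<sigma> \<in> {\<sigma>. partition_on {1..k} \<sigma>}"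
      then have \<sigma>: "partition_on {1..k} \<sigma>" "finite \<sigma>" using finite_partition_on by auto
      have "path_density L \<sigma> k \<longlonglongrightarrow> lim (path_density L \<sigma> k)"
        using path_density_converges(1)[OF \<sigma>] by (simp add: convergent_LIMSEQ_iff)
      then show "(\<lambda>n. path_density L \<sigma> k (Suc n)) \<longlonglongrightarrow> lim (path_density L \<sigma> k)" by (rule LIMSEQ_Suc)
      show "(\<lambda>n. real (Suc n) * \<mu> (Suc n) (card V)) \<longlonglongrightarrow> C (card V)" if "V \<in> \<sigma>" for V
        using C[OF block_card_pos[OF \<sigma>(1) that]] by (rule LIMSEQ_Suc)
    qed
    ultimately show ?thesis by simp
  qed
  ultimately show ?thesis by (rule that)
qed

lemma iid_array_even_limits_nonneg:
  assumes iid: "iid_array_with_limits M x C" and "k \<ge> 1"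
  shows "C (2 * k) \<ge> 0"
proof (rule LIMSEQ_le_const)
  show "(\<lambda>n. real n * prob_space.expectation (M n) (\<lambda>\<omega>. x n 0 \<omega> ^ (2 * k))) \<longlonglongrightarrow> C (2 * k)"
    using assms unfolding iid_array_with_limits_def by simp
  show "\<exists>N. \<forall>n\<ge>N. 0 \<le> real n * prob_space.expectation (M n) (\<lambda>\<omega>. x n 0 \<omega> ^ (2 * k))"
    by (auto intro!: mult_nonneg_nonneg integral_nonneg_AE)
qed

lemma weak_conv_m_Suc: "weak_conv_m (\<lambda>n. \<mu> (Suc n)) \<nu> \<Longrightarrow> weak_conv_m \<mu> \<nu>"
  unfolding weak_conv_m_def weak_conv_def by (auto dest!: LIMSEQ_imp_Suc)

section \<open>Convergence of the expected spectral distribution\<close>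

theorem mainTheorem6:
  fixes L :: matrix_pattern
    and M :: "nat \<Rightarrow> 'a measure" and x :: "nat \<Rightarrow> nat \<Rightarrow> 'a \<Rightarrow> real" and C :: "nat \<Rightarrow> real"
  assumes "iid_array_with_limits M x C"
    and "carleman_even (even_cumulant_moment C)"
  shows "\<exists>\<mu>. real_distribution \<mu> \<and> symmetric_measure \<mu> \<and>
    weak_conv_m (\<lambda>n. eesd (M n) (\<lambda>\<omega>. triangular_patterned L n (\<lambda>i. x n i \<omega>))) \<mu> \<and>
    (\<forall>(M' :: nat \<Rightarrow> 'b measure) x' C'.
       iid_array_with_limits M' x' C' \<and> (\<forall>k\<ge>1. C' (2 * k) = C (2 * k)) \<longrightarrow>
       weak_conv_m (\<lambda>n. eesd (M' n) (\<lambda>\<omega>. triangular_patterned L n (\<lambda>i. x' n i \<omega>))) \<mu>)"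
proof -
  define \<beta> where "\<beta> = limit_moment L C"
  obtain m where m:
    "\<And>n. has_moments (eesd (M (Suc n)) (\<lambda>\<omega>. triangular_patterned L (Suc n) (\<lambda>i. x (Suc n) i \<omega>))) (m n)"
    "\<And>k. (\<lambda>n. m n k) \<longlonglongrightarrow> \<beta> k"
    using eesd_moments_converge[OF assms(1), of L] unfolding \<beta>_def by blast
  obtain \<nu> where \<nu>: "has_moments \<nu> \<beta>" using exists_moment_limit[OF m] by blast
  have unique: "\<rho> = \<nu>" if \<rho>: "has_moments \<rho> \<beta>" for \<rho>
  proof (rule carleman_determinate[OF \<rho> \<nu> _ _ _ assms(2)])
    show "\<beta> (2 * k) \<le> 3 * 12 ^ (2 * k) * even_cumulant_moment C (2 * k)" if "k \<ge> 1" for k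
      unfolding \<beta>_def by (intro limit_moment_le iid_array_even_limits_nonneg[OF assms(1)])
  qed auto
  have "weak_conv_m (\<lambda>n. eesd (M n) (\<lambda>\<omega>. triangular_patterned L n (\<lambda>i. x n i \<omega>))) \<nu>"
    by (rule weak_conv_m_Suc, rule method_of_moments[OF m \<nu> unique])
  moreover have "weak_conv_m (\<lambda>n. eesd (M' n) (\<lambda>\<omega>. triangular_patterned L n (\<lambda>i. x' n i \<omega>))) \<nu>"
    if iid': "iid_array_with_limits M' x' C'" and C': "\<forall>k\<ge>1. C' (2 * k) = C (2 * k)"
    for M' :: "nat \<Rightarrow> 'b measure" and x' C'
  proof -
    have lim: "limit_moment L C' = \<beta>"
      unfolding \<beta>_def using C' by (intro ext limit_moment_cong_even) simp
    obtain m' where m':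
      "\<And>n. has_moments (eesd (M' (Suc n)) (\<lambda>\<omega>. triangular_patterned L (Suc n) (\<lambda>i. x' (Suc n) i \<omega>))) (m' n)"
      "\<And>k. (\<lambda>n. m' n k) \<longlonglongrightarrow> \<beta> k"
      using eesd_moments_converge[OF iid', of L] unfolding lim by blast
    show ?thesis by (rule weak_conv_m_Suc, rule method_of_moments[OF m' \<nu> unique])
  qed
  moreover have "symmetric_measure \<nu>"
    by (rule symmetric_of_determinate[OF \<nu> unique]) (simp_all add: \<beta>_def limit_moment_odd)
  moreover have "real_distribution \<nu>" using \<nu> by (simp add: has_moments_def)
  ultimately show ?thesis by blast
qed

end
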